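(* Let $L$ be a locally finite countable simplicial complex, let $X$ be a separable metrizable space and let $n \geq 1$. Then the following conditions are equivalent: (a) $\dim_{L}X \leq n$; (b) for every collection $(A_{1},B_{1}), (A_{2},B_{2}),\dots ,(A_{n},B_{n})$ of $n$ pairs of disjoint closed subsets of $X$ there exist closed sets $C_{1}, C_{2},\dots ,C_{n}$ such that $C_{i}$ is a partition between $A_{i}$ and $B_{i}$ for each $i$, and $L \in \mathrm{AE}\left(\bigcap_{i=1}^{n}C_{i}\right)$.
   Context: For a normal space $X$, $L \in \mathrm{AE}(X)$ means that every continuous map $f\colon A \to L$ defined on a closed subspace $A$ of $X$ admits a continuous extension $\tilde f\colon X\to L$. $\Sigma^{n}L$ denotes the $n$-th iterated suspension of $L$, with $\Sigma^{0}L = L$. The dimension $\dim_{L}X$ is the smallest integer $n\ge 0$ such that $\Sigma^{n}L \in \mathrm{AE}(X)$; the relation $\dim_L X\le n$ means $\Sigma^nL\in \mathrm{AE}(X)$. A closed set $C\subseteq X$ is a partition between $A$ and $B$ if $X\setminus C$ is the union of two disjoint open sets $U$ and $V$ with $A\subseteq U$ and $B\subseteq V$. *)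

theory Defs
  imports "HOL-Analysis.Analysis"
begin

section \<open>Final topologies\<close>

text \<open>The finest topology on the set \<open>Y\<close> making \<open>f\<close> continuous. It is the quotient topology
  if \<open>f\<close> maps \<open>topspace X\<close> onto \<open>Y\<close>; points of \<open>Y\<close> outside the image of \<open>f\<close> are isolated.\<close>

definition final_topology :: "'a topology \<Rightarrow> 'b set \<Rightarrow> ('a \<Rightarrow> 'b) \<Rightarrow> 'b topology" where
  "final_topology X Y f = topology (\<lambda>U. U \<subseteq> Y \<and> openin X {x \<in> topspace X. f x \<in> U})"

lemma openin_final_topology:
  "openin (final_topology X Y f) U \<longleftrightarrow> U \<subseteq> Y \<and> openin X {x \<in> topspace X. f x \<in> U}"
proof -
  have "istopology (\<lambda>U. U \<subseteq> Y \<and> openin X {x \<in> topspace X. f x \<in> U})"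
    unfolding istopology_def
  proof (intro conjI allI impI)
    fix S T
    assume "S \<subseteq> Y \<and> openin X {x \<in> topspace X. f x \<in> S}"
      and "T \<subseteq> Y \<and> openin X {x \<in> topspace X. f x \<in> T}"
    moreover have "{x \<in> topspace X. f x \<in> S \<inter> T}
        = {x \<in> topspace X. f x \<in> S} \<inter> {x \<in> topspace X. f x \<in> T}"
      by auto
    ultimately show "S \<inter> T \<subseteq> Y" "openin X {x \<in> topspace X. f x \<in> S \<inter> T}"
      by auto
  next
    fix \<U>
    assume *: "\<forall>S\<in>\<U>. S \<subseteq> Y \<and> openin X {x \<in> topspace X. f x \<in> S}"
    then show "\<Union>\<U> \<subseteq> Y" by auto
    have "{x \<in> topspace X. f x \<in> \<Union>\<U>} = (\<Union>S\<in>\<U>. {x \<in> topspace X. f x \<in> S})"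
      by auto
    with * show "openin X {x \<in> topspace X. f x \<in> \<Union>\<U>}"
      by (metis (no_types, lifting) imageE openin_Union)
  qed
  then show ?thesis
    by (simp add: final_topology_def)
qed

lemma topspace_final_topology:
  assumes "f ` topspace X \<subseteq> Y"
  shows "topspace (final_topology X Y f) = Y"
proof -
  have "{x \<in> topspace X. f x \<in> Y} = topspace X"
    using assms by auto
  then have "openin (final_topology X Y f) Y"
    by (simp add: openin_final_topology)
  then show ?thesis
    by (meson openin_final_topology openin_subset openin_topspace subset_antisym)
qed

section \<open>Simplicial complexes and their geometric realizations\<close>

text \<open>A complex is given by the vertex sets of its nonempty simplices.\<close>

definition simplicial_cplx :: "'v set set \<Rightarrow> bool" where
  "simplicial_cplx K \<longleftrightarrow>
     (\<forall>s\<in>K. finite s \<and> s \<noteq> {} \<and> (\<forall>t. t \<subseteq> s \<and> t \<noteq> {} \<longrightarrow> t \<in> K))"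

definition locally_finite_cplx :: "'v set set \<Rightarrow> bool" where
  "locally_finite_cplx K \<longleftrightarrow> (\<forall>v \<in> \<Union>K. finite {s \<in> K. v \<in> s})"

text \<open>Points of the realization are given by their barycentric coordinates.\<close>

definition closed_simplex :: "'v set \<Rightarrow> ('v \<Rightarrow> real) set" where
  "closed_simplex s = {p. (\<forall>v. 0 \<le> p v) \<and> (\<forall>v. v \<notin> s \<longrightarrow> p v = 0) \<and> (\<Sum>v\<in>s. p v) = 1}"

text \<open>The weak topology. Here \<open>top_of_set (closed_simplex s)\<close> is the subspace topology from the
  product topology on \<open>'v \<Rightarrow> real\<close>, i.e. the Euclidean topology of the simplex as \<open>s\<close> is finite.\<close>

definition realization :: "'v set set \<Rightarrow> ('v \<Rightarrow> real) topology" where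
  "realization K = topology (\<lambda>U. U \<subseteq> (\<Union>s\<in>K. closed_simplex s) \<and>
     (\<forall>s\<in>K. openin (top_of_set (closed_simplex s)) (U \<inter> closed_simplex s)))"

lemma openin_realization:
  "openin (realization K) U \<longleftrightarrow> U \<subseteq> (\<Union>s\<in>K. closed_simplex s) \<and>
     (\<forall>s\<in>K. openin (top_of_set (closed_simplex s)) (U \<inter> closed_simplex s))"
proof -
  have "istopology (\<lambda>U. U \<subseteq> (\<Union>s\<in>K. closed_simplex s) \<and>
     (\<forall>s\<in>K. openin (top_of_set (closed_simplex s)) (U \<inter> closed_simplex s)))"
    unfolding istopology_def
  proof (intro conjI allI impI ballI)
    fix S T s
    assume S: "S \<subseteq> (\<Union>s\<in>K. closed_simplex s) \<and>
        (\<forall>s\<in>K. openin (top_of_set (closed_simplex s)) (S \<inter> closed_simplex s))"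
      and T: "T \<subseteq> (\<Union>s\<in>K. closed_simplex s) \<and>
        (\<forall>s\<in>K. openin (top_of_set (closed_simplex s)) (T \<inter> closed_simplex s))"
    from S show "S \<inter> T \<subseteq> (\<Union>s\<in>K. closed_simplex s)" by auto
    assume "s \<in> K"
    moreover have "S \<inter> T \<inter> closed_simplex s = (S \<inter> closed_simplex s) \<inter> (T \<inter> closed_simplex s)"
      by auto
    ultimately show "openin (top_of_set (closed_simplex s)) (S \<inter> T \<inter> closed_simplex s)"
      using S T by (metis openin_Int)
  next
    fix \<U> s
    assume *: "\<forall>S\<in>\<U>. S \<subseteq> (\<Union>s\<in>K. closed_simplex s) \<and>
        (\<forall>s\<in>K. openin (top_of_set (closed_simplex s)) (S \<inter> closed_simplex s))"
    then show "\<Union>\<U> \<subseteq> (\<Union>s\<in>K. closed_simplex s)" by blast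
    assume "s \<in> K"
    moreover have "\<Union>\<U> \<inter> closed_simplex s = (\<Union>S\<in>\<U>. S \<inter> closed_simplex s)"
      by auto
    ultimately show "openin (top_of_set (closed_simplex s)) (\<Union>\<U> \<inter> closed_simplex s)"
      using * by (metis (no_types, lifting) imageE openin_Union)
  qed
  then show ?thesis
    by (simp add: realization_def)
qed

lemma topspace_realization: "topspace (realization K) = (\<Union>s\<in>K. closed_simplex s)"
proof -
  have "(\<Union>s\<in>K. closed_simplex s) \<inter> closed_simplex s = closed_simplex s" if "s \<in> K" for s
    using that by auto
  then have "openin (realization K) (\<Union>s\<in>K. closed_simplex s)"
    by (simp add: openin_realization)
  then show ?thesis
    by (meson openin_realization openin_subset openin_topspace subset_antisym)
qed

section \<open>Iterated suspensions\<close>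

text \<open>All iterated suspensions of a space with points in \<open>'b\<close> live in one type, so that
  suspension can be iterated: \<open>Base\<close> embeds the original space, and \<open>Mid x t\<close> is the class of
  \<open>(x, t)\<close> in a suspension.\<close>

datatype 'b susp_pt = Base 'b | North | South | Mid "'b susp_pt" real

definition susp_proj :: "'b susp_pt \<times> real \<Rightarrow> 'b susp_pt" where
  "susp_proj = (\<lambda>(x, t). if t = 1 then North else if t = -1 then South else Mid x t)"

text \<open>The unreduced suspension: the quotient of \<open>X \<times> [-1, 1]\<close> collapsing \<open>X \<times> {1}\<close> and \<open>X \<times> {-1}\<close>
  to one point each. Both poles are present also for empty \<open>X\<close>, so the suspension of the empty
  space is the two-point discrete space (the 0-sphere).\<close>

definition suspension :: "'b susp_pt topology \<Rightarrow> 'b susp_pt topology" where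
  "suspension X = final_topology (prod_topology X (top_of_set {-1..1}))
     ({North, South} \<union> {Mid x t |x t. x \<in> topspace X \<and> -1 < t \<and> t < 1}) susp_proj"

lemma topspace_suspension:
  "topspace (suspension X) = {North, South} \<union> {Mid x t |x t. x \<in> topspace X \<and> -1 < t \<and> t < 1}"
  unfolding suspension_def by (rule topspace_final_topology) (auto simp: susp_proj_def)

text \<open>As \<open>Base\<close> is injective, the zeroth suspension is a homeomorphic copy of \<open>L\<close>.\<close>

definition iterated_suspension :: "nat \<Rightarrow> 'b topology \<Rightarrow> 'b susp_pt topology" where
  "iterated_suspension n L = (suspension ^^ n) (final_topology L (Base ` topspace L) Base)"

lemma homeomorphic_map_Base: "homeomorphic_map L (iterated_suspension 0 L) Base"
proof -
  have ts: "topspace (iterated_suspension 0 L) = Base ` topspace L"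
    by (simp add: iterated_suspension_def topspace_final_topology)
  have "quotient_map L (iterated_suspension 0 L) Base"
    unfolding quotient_map_def ts
    by (auto simp: iterated_suspension_def openin_final_topology)
  then show ?thesis
    by (auto simp: homeomorphic_map_def inj_on_def)
qed

section \<open>Absolute extensors, dimension and partitions\<close>

text \<open>The relation \<open>L \<in> AE(X)\<close>.\<close>

definition abs_extensor :: "'b topology \<Rightarrow> 'a topology \<Rightarrow> bool" where
  "abs_extensor L X \<longleftrightarrow> (\<forall>A f. closedin X A \<and> continuous_map (subtopology X A) L f \<longrightarrow>
     (\<exists>g. continuous_map X L g \<and> (\<forall>x\<in>A. g x = f x)))"

text \<open>The relation \<open>dim\<^sub>L X \<le> n\<close>.\<close>

definition ext_dim_le :: "'b topology \<Rightarrow> 'a topology \<Rightarrow> nat \<Rightarrow> bool" where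
  "ext_dim_le L X n \<longleftrightarrow> abs_extensor (iterated_suspension n L) X"

definition partition_between :: "'a topology \<Rightarrow> 'a set \<Rightarrow> 'a set \<Rightarrow> 'a set \<Rightarrow> bool" where
  "partition_between X C A B \<longleftrightarrow> closedin X C \<and>
     (\<exists>U V. openin X U \<and> openin X V \<and> disjnt U V \<and> topspace X - C = U \<union> V \<and> A \<subseteq> U \<and> B \<subseteq> V)"

end

theory Submission
  imports Defs
begin

text \<open>
  The \<open>n\<close>-fold suspension is a ball of dimension \<open>n\<close> times \<open>L\<close>, with \<open>L\<close> collapsed over each
  boundary point; maps into it are pairs of a map \<open>v\<close> to the ball and a map to \<open>L\<close> defined where
  \<open>v\<close> is interior.

  (b) implies (a): the ball coordinates of a partial map prescribe pairs of disjoint closed sets.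
  Partitions between them meet in a set over which the \<open>L\<close>-component extends, hence it extends to a
  neighbourhood, off which the signs given by the partitions push the ball component to the boundary.

  (a) implies (b): a map \<open>v\<close> from \<open>X\<close> to the ball whose coordinates separate the given pairs, together
  with a partial map from \<open>X\<close> to \<open>L\<close>, is a partial map into the suspension. Extending it yields a new
  map to the ball, pointing in the same direction as \<open>v\<close> where \<open>v\<close> is far from 0, and a solution of the
  extension problem where the new map is close to 0. Iterating, the zero sets of the coordinates of the
  limiting direction are partitions that meet in a set on which countably many extension problems are
  solved. These suffice: up to a straight line homotopy inside simplices, every extension problem on a
  separable space is the union of an increasing sequence of problems given by finitely many members of a
  countable family of functions, each being posed only after the previous one has been solved.
\<close>

text \<open>Two obstacles shape the details. If \<open>L\<close> is not compact, a ball map and an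
  \<open>L\<close>-map combine to a continuous map into the suspension only if the
  \<open>L\<close>-map stays in a compact part of \<open>L\<close> near each point sent to the
  sphere. A function \<open>\<phi>\<close> on \<open>L\<close> with compact sublevel sets measures
  this, and in (b) implies (a) the extended \<open>L\<close>-map must be restrained by it near the
  points where the given map hits the sphere. In (a) implies (b) the intersection of the partitions
  is known only at the end, while each extension solves just one problem; hence the problems are
  built from functions on all of \<open>X\<close> chosen beforehand. The \<open>L\<close>-part of a
  stage makes sense where the weight is positive, and cutting at weight \<open>1/2\<close> gives a
  closed set there. The next stage starts from the radial projection wherever the weight is at most
  \<open>1/2\<close>, so it lies on the sphere outside the cut and keeps its direction from then on.
  The signs of the coordinates are thus eventually constant, and no convergence has to be
  proved.\<close>

lemma openin_real_less:
  fixes f g :: "'a \<Rightarrow> real"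
  assumes "continuous_map X euclideanreal f" "continuous_map X euclideanreal g"
  shows "openin X {x \<in> topspace X. f x < g x}"
proof -
  have "continuous_map X euclideanreal (\<lambda>x. f x - g x)"
    using assms by (intro continuous_intros)
  from openin_continuous_map_preimage[OF this, of "{..<0}"] show ?thesis
    by simp
qed

lemma closedin_real_le:
  fixes f g :: "'a \<Rightarrow> real"
  assumes "continuous_map X euclideanreal f" "continuous_map X euclideanreal g"
  shows "closedin X {x \<in> topspace X. f x \<le> g x}"
proof -
  have "continuous_map X euclideanreal (\<lambda>x. f x - g x)"
    using assms by (intro continuous_intros)
  from closedin_continuous_map_preimage[OF this, of "{..0}"] show ?thesis
    by simp
qed

lemma continuous_map_local:
  assumes "\<And>x. x \<in> topspace X \<Longrightarrow> \<exists>U. openin X U \<and> x \<in> U \<and> continuous_map (subtopology X U) Y f"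
  shows "continuous_map X Y f"
proof -
  obtain U where U: "\<And>x. x \<in> topspace X \<Longrightarrow> openin X (U x) \<and> x \<in> U x \<and> continuous_map (subtopology X (U x)) Y f"
    using assms by metis
  show ?thesis
    by (rule pasting_lemma[of "topspace X" X U Y "\<lambda>_. f"]) (use U in auto)
qed

lemma continuous_map_closed_Un:
  assumes "closedin X S" "closedin X T"
    and "continuous_map (subtopology X S) Y f" "continuous_map (subtopology X T) Y g"
    and agree: "\<And>x. x \<in> S \<Longrightarrow> x \<in> T \<Longrightarrow> f x = g x"
  shows "continuous_map (subtopology X (S \<union> T)) Y (\<lambda>x. if x \<in> S then f x else g x)"
proof (rule pasting_lemma_closed[of UNIV _ "\<lambda>b. if b then S else T" _ "\<lambda>b. if b then f else g"])
  fix b :: bool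
  show "closedin (subtopology X (S \<union> T)) (if b then S else T)"
    using assms(1,2) by (auto simp: closedin_subset_topspace)
  show "continuous_map (subtopology (subtopology X (S \<union> T)) (if b then S else T)) Y (if b then f else g)"
    using assms(3,4) by (auto simp: subtopology_subtopology Int_absorb1)
next
  fix b c x
  assume "x \<in> topspace (subtopology X (S \<union> T)) \<inter> (if b then S else T) \<inter> (if c then S else T)"
  then show "(if b then f else g) x = (if c then f else g) x"
    using agree[of x] by (auto split: if_splits)
next
  fix x assume "x \<in> topspace (subtopology X (S \<union> T))"
  then show "\<exists>j. j \<in> UNIV \<and> x \<in> (if j then S else T) \<and> (if x \<in> S then f x else g x) = (if j then f else g) x"
    by (cases "x \<in> S") (auto intro: exI[of _ True] exI[of _ False])
qed auto

section \<open>Coordinates on iterated suspensions\<close>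

text \<open>A point of the \<open>n\<close>-fold suspension is described by a point of the unit ball of the
  \<open>\<ell>\<^sup>1\<close>-norm in dimension \<open>n\<close> (the outermost suspension parameter has index 0) together with a
  point of \<open>L\<close>, the latter being irrelevant on the unit sphere. With suspension parameters
  \<open>t\<^sub>0, \<dots>, t\<^sub>k\<close> the coordinates are \<open>(1 - \<bar>t\<^sub>0\<bar>) \<dots> (1 - \<bar>t\<^sub>i\<^sub>-\<^sub>1\<bar>) t\<^sub>i\<close>, so that
  \<open>1 - \<Sum>\<bar>coord p i\<bar>\<close> is the product of all \<open>1 - \<bar>t\<^sub>i\<bar>\<close>, which is \<open>weight p\<close> below.\<close>

primrec coord :: "'b susp_pt \<Rightarrow> nat \<Rightarrow> real" where
  "coord (Base x) = (\<lambda>i. 0)"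
| "coord North = (\<lambda>i. if i = 0 then 1 else 0)"
| "coord South = (\<lambda>i. if i = 0 then - 1 else 0)"
| "coord (Mid y t) = (\<lambda>i. case i of 0 \<Rightarrow> t | Suc j \<Rightarrow> (1 - \<bar>t\<bar>) * coord y j)"

primrec base_pt :: "'b susp_pt \<Rightarrow> 'b" where
  "base_pt (Base x) = x"
| "base_pt North = undefined"
| "base_pt South = undefined"
| "base_pt (Mid y t) = base_pt y"

text \<open>The factors \<open>1 - \<bar>t\<bar>\<close> make any continuous function on
  \<open>L\<close> descend to the quotient, with value 0 on the sphere. The constant 1 gives
  \<open>weight\<close>; fast growing functions later detect base points that escape to infinity
  near the sphere.\<close>

primrec weighted :: "('b \<Rightarrow> real) \<Rightarrow> 'b susp_pt \<Rightarrow> real" where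
  "weighted \<eta> (Base x) = \<eta> x"
| "weighted \<eta> North = 0"
| "weighted \<eta> South = 0"
| "weighted \<eta> (Mid y t) = (1 - \<bar>t\<bar>) * weighted \<eta> y"

definition weight :: "'b susp_pt \<Rightarrow> real" where "weight = weighted (\<lambda>_. 1)"

lemma weight_simps [simp]:
  "weight (Base x) = 1" "weight North = 0" "weight South = 0" "weight (Mid y t) = (1 - \<bar>t\<bar>) * weight y"
  by (auto simp: weight_def)

lemma weighted_eq: "weighted \<eta> p = weight p * \<eta> (base_pt p)"
  by (induction p) auto

text \<open>The inverse of \<open>p \<mapsto> (base_pt p, coord p)\<close>; at the poles \<open>1 - \<bar>v 0\<bar> = 0\<close>, and no division
  takes place.\<close>

primrec join_pt :: "nat \<Rightarrow> 'b \<Rightarrow> (nat \<Rightarrow> real) \<Rightarrow> 'b susp_pt" where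
  "join_pt 0 l v = Base l"
| "join_pt (Suc n) l v = (if v 0 = 1 then North else if v 0 = -1 then South
     else Mid (join_pt n l (\<lambda>i. v (Suc i) / (1 - \<bar>v 0\<bar>))) (v 0))"

definition l1norm :: "nat \<Rightarrow> (nat \<Rightarrow> real) \<Rightarrow> real" where
  "l1norm n v = (\<Sum>i<n. \<bar>v i\<bar>)"

lemma l1norm_0 [simp]: "l1norm 0 v = 0" by (simp add: l1norm_def)

lemma l1norm_Suc: "l1norm (Suc n) v = \<bar>v 0\<bar> + l1norm n (\<lambda>i. v (Suc i))"
  by (simp add: l1norm_def sum.lessThan_Suc_shift del: sum.lessThan_Suc)

lemma l1norm_nonneg [simp]: "0 \<le> l1norm n v" by (simp add: l1norm_def sum_nonneg)

lemma l1norm_divide: "l1norm n (\<lambda>i. v i / c) = l1norm n v / \<bar>c\<bar>"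
  by (simp add: l1norm_def sum_divide_distrib)

lemma l1norm_mult: "l1norm n (\<lambda>i. c * v i) = \<bar>c\<bar> * l1norm n v"
  by (simp add: l1norm_def sum_distrib_left abs_mult)

lemma abs_le_l1norm: "i < n \<Longrightarrow> \<bar>v i\<bar> \<le> l1norm n v"
  unfolding l1norm_def by (rule member_le_sum) auto

lemma l1norm_eq_0: "l1norm n v = 0 \<longleftrightarrow> (\<forall>i<n. v i = 0)"
  by (auto simp: l1norm_def sum_nonneg_eq_0_iff)

lemma l1norm_cong: "(\<And>i. i < n \<Longrightarrow> v i = w i) \<Longrightarrow> l1norm n v = l1norm n w"
  by (simp add: l1norm_def)

abbreviation isusp :: "nat \<Rightarrow> 'b topology \<Rightarrow> 'b susp_pt topology" where
  "isusp \<equiv> iterated_suspension"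

lemma isusp_Suc: "isusp (Suc n) L = suspension (isusp n L)"
  by (simp add: iterated_suspension_def)

lemma topspace_isusp_0: "topspace (isusp 0 L) = Base ` topspace L"
  by (simp add: iterated_suspension_def topspace_final_topology)

lemma openin_isusp_0: "openin (isusp 0 L) U \<longleftrightarrow> U \<subseteq> Base ` topspace L \<and> openin L {x \<in> topspace L. Base x \<in> U}"
  by (simp add: iterated_suspension_def openin_final_topology)

lemma continuous_map_Base: "continuous_map L (isusp 0 L) Base"
  using homeomorphic_map_Base homeomorphic_imp_continuous_map by blast



lemma openin_suspension:
  "openin (suspension Y) U \<longleftrightarrow> U \<subseteq> topspace (suspension Y) \<and>
    openin (prod_topology Y (top_of_set {-1..1})) {z \<in> topspace Y \<times> {-1..1}. susp_proj z \<in> U}"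
  unfolding topspace_suspension by (simp add: suspension_def openin_final_topology)

lemma continuous_map_susp_proj:
  "continuous_map (prod_topology Y (top_of_set {-1..1})) (suspension Y) susp_proj"
  unfolding continuous_map
  by (auto simp: openin_suspension topspace_suspension) (auto simp: susp_proj_def split: if_splits)

text \<open>The universal property of the quotient. The poles appear in separate assumptions because
  \<open>susp_proj\<close> does not reach them when \<open>Y\<close> is empty.\<close>

lemma continuous_map_from_suspension:
  assumes "continuous_map (prod_topology Y (top_of_set {-1..1})) Z (\<lambda>z. f (susp_proj z))"
    and "f North \<in> topspace Z" "f South \<in> topspace Z"
  shows "continuous_map (suspension Y) Z f"
  unfolding continuous_map
proof (intro conjI allI impI)
  show "f ` topspace (suspension Y) \<subseteq> topspace Z"
  proof clarify
    fix p assume "p \<in> topspace (suspension Y)"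
    then consider "p = North" | "p = South" | x t where "p = Mid x t" "x \<in> topspace Y" "-1 < t" "t < 1"
      by (auto simp: topspace_suspension)
    then show "f p \<in> topspace Z"
    proof cases
      case 3
      then have "(x,t) \<in> topspace (prod_topology Y (top_of_set {-1..1}))" "susp_proj (x,t) = p"
        by (auto simp: susp_proj_def)
      then show ?thesis
        using continuous_map_image_subset_topspace[OF assms(1)] by (metis image_subset_iff)
    qed (use assms in auto)
  qed
  fix U assume U: "openin Z U"
  have "{z \<in> topspace Y \<times> {-1..1}. susp_proj z \<in> {p \<in> topspace (suspension Y). f p \<in> U}}
     = {z \<in> topspace (prod_topology Y (top_of_set {-1..1})). f (susp_proj z) \<in> U}"
    using continuous_map_image_subset_topspace[OF continuous_map_susp_proj[of Y]] by auto
  then show "openin (suspension Y) {p \<in> topspace (suspension Y). f p \<in> U}"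
    unfolding openin_suspension using openin_continuous_map_preimage[OF assms(1) U] by auto
qed

lemma isusp_cases:
  assumes "p \<in> topspace (isusp (Suc n) L)"
  obtains "p = North" | "p = South"
    | y t where "p = Mid y t" "y \<in> topspace (isusp n L)" "-1 < t" "t < 1"
  using assms by (auto simp: isusp_Suc topspace_suspension)

lemma weight_range: "p \<in> topspace (isusp n L) \<Longrightarrow> 0 \<le> weight p \<and> weight p \<le> 1"
proof (induction n arbitrary: p)
  case (Suc n)
  then show ?case
    by (cases rule: isusp_cases[OF Suc.prems]) (auto simp: mult_le_one)
qed (auto simp: topspace_isusp_0)

lemma l1norm_coord: "p \<in> topspace (isusp n L) \<Longrightarrow> l1norm n (coord p) = 1 - weight p"
proof (induction n arbitrary: p)
  case (Suc n)
  show ?case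
  proof (cases rule: isusp_cases[OF Suc.prems])
    case (3 y t)
    have "l1norm (Suc n) (coord p) = \<bar>t\<bar> + \<bar>1 - \<bar>t\<bar>\<bar> * l1norm n (coord y)"
      using 3 by (simp add: l1norm_Suc l1norm_mult)
    also have "\<dots> = 1 - weight p"
      using 3 Suc.IH[OF 3(2)] by (simp add: left_diff_distrib right_diff_distrib)
    finally show ?thesis .
  qed (auto simp: l1norm_Suc, simp_all add: l1norm_def)
qed (auto simp: topspace_isusp_0)

lemma base_pt_in: "p \<in> topspace (isusp n L) \<Longrightarrow> 0 < weight p \<Longrightarrow> base_pt p \<in> topspace L"
proof (induction n arbitrary: p)
  case (Suc n)
  show ?case
    by (cases rule: isusp_cases[OF Suc.prems(1)]) (use Suc in \<open>auto simp: zero_less_mult_iff\<close>)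
qed (auto simp: topspace_isusp_0)

lemma join_pt_coord: "p \<in> topspace (isusp n L) \<Longrightarrow> (0 < weight p \<Longrightarrow> base_pt p = l) \<Longrightarrow> join_pt n l (coord p) = p"
proof (induction n arbitrary: p)
  case (Suc n)
  show ?case
  proof (cases rule: isusp_cases[OF Suc.prems(1)])
    case (3 y t)
    have "join_pt n l (coord y) = y"
      using Suc.IH[OF 3(2)] Suc.prems(2) 3 by (auto simp: zero_less_mult_iff)
    moreover have "1 - \<bar>t\<bar> \<noteq> 0" using 3 by auto
    ultimately show ?thesis using 3 by auto
  qed auto
qed (auto simp: topspace_isusp_0)

lemma join_pt_cong: "(\<And>i. i < n \<Longrightarrow> v i = w i) \<Longrightarrow> join_pt n l v = join_pt n l w"
proof (induction n arbitrary: v w)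
  case (Suc n)
  have "join_pt n l (\<lambda>i. v (Suc i) / (1 - \<bar>v 0\<bar>)) = join_pt n l (\<lambda>i. w (Suc i) / (1 - \<bar>w 0\<bar>))"
    by (rule Suc.IH) (use Suc.prems in auto)
  then show ?case using Suc.prems[of 0] by simp
qed auto

text \<open>Dividing the later coordinates by \<open>1 - \<bar>v 0\<bar>\<close> carries the slice
  of the ball at height \<open>v 0\<close> onto the ball of one dimension less, interior points to
  interior points. All conjuncts are read off from this one rescaling.\<close>

lemma coord_join_pt:
  "l1norm n v \<le> 1 \<Longrightarrow> (\<forall>i<n. coord (join_pt n l v) i = v i) \<and> weight (join_pt n l v) = 1 - l1norm n v \<and>
    (l1norm n v < 1 \<longrightarrow> base_pt (join_pt n l v) = l) \<and> ((l1norm n v < 1 \<longrightarrow> l \<in> topspace L) \<longrightarrow> join_pt n l v \<in> topspace (isusp n L))"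
proof (induction n arbitrary: v)
  case 0 then show ?case by (auto simp: topspace_isusp_0)
next
  case (Suc n)
  let ?w = "\<lambda>i. v (Suc i) / (1 - \<bar>v 0\<bar>)"
  have le1: "\<bar>v 0\<bar> \<le> 1" using abs_le_l1norm[of 0 "Suc n" v] Suc.prems by simp
  show ?case
  proof (cases "\<bar>v 0\<bar> = 1")
    case True
    then have "l1norm n (\<lambda>i. v (Suc i)) = 0"
      using Suc.prems l1norm_nonneg[of n "\<lambda>i. v (Suc i)"] by (simp add: l1norm_Suc)
    then have "v (Suc i) = 0" if "i < n" for i
      using that by (simp add: l1norm_eq_0)
    moreover have "v 0 = 1 \<or> v 0 = - 1" using True by linarith
    moreover have "l1norm (Suc n) v = 1" using True \<open>l1norm n (\<lambda>i. v (Suc i)) = 0\<close> by (simp add: l1norm_Suc)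
    ultimately show ?thesis
      by (auto simp: less_Suc_eq_0_disj isusp_Suc topspace_suspension)
  next
    case False
    then have pos: "1 - \<bar>v 0\<bar> > 0" using le1 by linarith
    have eq: "l1norm n ?w * (1 - \<bar>v 0\<bar>) = l1norm (Suc n) v - \<bar>v 0\<bar>"
      using pos by (simp add: l1norm_Suc l1norm_divide)
    then have w1: "l1norm n ?w \<le> 1" and w2: "l1norm n ?w < 1 \<longleftrightarrow> l1norm (Suc n) v < 1"
      using Suc.prems pos by (auto simp: l1norm_Suc l1norm_divide)
    have v0: "v 0 \<noteq> 1" "v 0 \<noteq> -1" "-1 < v 0" "v 0 < 1" using pos by auto
    note IH = Suc.IH[OF w1]
    have "coord (join_pt (Suc n) l v) i = v i" if "i < Suc n" for i
      using that v0 IH pos by (cases i) auto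
    moreover have "weight (join_pt (Suc n) l v) = 1 - l1norm (Suc n) v"
    proof -
      have "weight (join_pt (Suc n) l v) = (1 - \<bar>v 0\<bar>) * (1 - l1norm n ?w)"
        using v0 IH by simp
      then show ?thesis using eq by (simp add: right_diff_distrib mult.commute)
    qed
    ultimately show ?thesis
      using IH v0 w2 by (auto simp: isusp_Suc topspace_suspension)
  qed
qed

lemmas coord_join_pt_eq = conjunct1[OF coord_join_pt, rule_format]
  and weight_join_pt = conjunct1[OF conjunct2[OF coord_join_pt]]
  and base_pt_join_pt = conjunct1[OF conjunct2[OF conjunct2[OF coord_join_pt]], rule_format]
  and join_pt_in = conjunct2[OF conjunct2[OF conjunct2[OF coord_join_pt]], rule_format]

section \<open>Continuity of coordinates, weight and base point\<close>

lemma continuous_map_prod_real_snd: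
  "continuous_map (prod_topology Y (top_of_set S)) euclideanreal snd"
  using continuous_map_snd continuous_map_into_fulltopology by blast

lemma continuous_map_coord: "continuous_map (isusp n L) euclideanreal (\<lambda>p. coord p i)"
proof (induction n arbitrary: i)
  case 0
  show ?case by (rule continuous_map_eq[of _ _ "\<lambda>_. 0"]) (auto simp: topspace_isusp_0)
next
  case (Suc n)
  show ?case unfolding isusp_Suc
  proof (rule continuous_map_from_suspension)
    let ?P = "prod_topology (isusp n L) (top_of_set {-1..1::real})"
    have s: "continuous_map ?P euclideanreal snd" by (rule continuous_map_prod_real_snd)
    show "continuous_map ?P euclideanreal (\<lambda>z. coord (susp_proj z) i)"
    proof (cases i)
      case 0
      show ?thesis by (rule continuous_map_eq[OF s]) (auto simp: susp_proj_def 0)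
    next
      case (Suc j)
      have "continuous_map ?P euclideanreal (\<lambda>z. (1 - \<bar>snd z\<bar>) * coord (fst z) j)"
        using continuous_map_compose[OF continuous_map_fst Suc.IH[of j], unfolded o_def] s
        by (intro continuous_intros)
      then show ?thesis
        by (rule continuous_map_eq) (auto simp: susp_proj_def Suc)
    qed
  qed auto
qed

lemma continuous_map_weighted:
  assumes "continuous_map L euclideanreal \<eta>"
  shows "continuous_map (isusp n L) euclideanreal (weighted \<eta>)"
proof (induction n)
  case 0
  have "openin L {x \<in> topspace L. \<eta> x \<in> U}" if "open U" for U
    using assms that by (simp add: openin_continuous_map_preimage)
  then show ?case
    by (auto simp: continuous_map topspace_isusp_0 openin_isusp_0)
      (smt (verit) Collect_cong image_eqI weighted.simps(1))
next
  case (Suc n)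
  show ?case unfolding isusp_Suc
  proof (rule continuous_map_from_suspension)
    let ?P = "prod_topology (isusp n L) (top_of_set {-1..1::real})"
    have s: "continuous_map ?P euclideanreal snd" by (rule continuous_map_prod_real_snd)
    have "continuous_map ?P euclideanreal (\<lambda>z. (1 - \<bar>snd z\<bar>) * weighted \<eta> (fst z))"
      using continuous_map_compose[OF continuous_map_fst Suc.IH, unfolded o_def] s
      by (intro continuous_intros)
    then show "continuous_map ?P euclideanreal (\<lambda>z. weighted \<eta> (susp_proj z))"
      by (rule continuous_map_eq) (auto simp: susp_proj_def)
  qed auto
qed

lemma continuous_map_weight: "continuous_map (isusp n L) euclideanreal weight"
  unfolding weight_def by (rule continuous_map_weighted) auto

text \<open>Points are identified only over the poles, which have weight 0. So the preimage under
  \<open>susp_proj\<close> is the product of the corresponding set one level below with the open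
  interval, and openness passes up the induction.\<close>

lemma openin_base_pt_vimage:
  assumes "openin L W"
  shows "openin (isusp n L) {p \<in> topspace (isusp n L). 0 < weight p \<and> base_pt p \<in> W}"
proof (induction n)
  case 0
  have "{x \<in> topspace L. Base x \<in> {p \<in> topspace (isusp 0 L). 0 < weight p \<and> base_pt p \<in> W}} = topspace L \<inter> W"
    by (auto simp: topspace_isusp_0)
  then show ?case using assms by (auto simp: openin_isusp_0 topspace_isusp_0)
next
  case (Suc n)
  let ?V = "{p \<in> topspace (isusp n L). 0 < weight p \<and> base_pt p \<in> W}"
  have "{z \<in> topspace (isusp n L) \<times> {-1..1}. susp_proj z \<in> {p \<in> topspace (isusp (Suc n) L). 0 < weight p \<and> base_pt p \<in> W}}
     = ?V \<times> {-1<..<1::real}"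
    by (auto simp: susp_proj_def isusp_Suc topspace_suspension zero_less_mult_iff split: if_splits)
  moreover have "openin (top_of_set {-1..1}) {-1<..<1::real}"
    by (auto simp: openin_open intro!: exI[of _ "{-1<..<1::real}"])
  ultimately show ?case
    unfolding isusp_Suc openin_suspension using Suc.IH
    by (auto simp: isusp_Suc openin_prod_Times_iff)
qed

lemma continuous_map_base_pt:
  "continuous_map (subtopology (isusp n L) {p. 0 < weight p}) L base_pt"
  unfolding continuous_map
proof (intro conjI allI impI)
  show "base_pt ` topspace (subtopology (isusp n L) {p. 0 < weight p}) \<subseteq> topspace L"
    using base_pt_in by auto
  fix U assume "openin L U"
  from openin_base_pt_vimage[OF this, of n]
  show "openin (subtopology (isusp n L) {p. 0 < weight p})
          {x \<in> topspace (subtopology (isusp n L) {p. 0 < weight p}). base_pt x \<in> U}"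
    unfolding openin_subtopology
    by (intro exI[of _ "{p \<in> topspace (isusp n L). 0 < weight p \<and> base_pt p \<in> U}"]) auto
qed

text \<open>The part of the suspension lying over \<open>C\<close>. The poles are added by hand
  since the projection misses them when \<open>susp_over n C\<close> is empty.\<close>

primrec susp_over :: "nat \<Rightarrow> 'b set \<Rightarrow> 'b susp_pt set" where
  "susp_over 0 C = Base ` C"
| "susp_over (Suc n) C = {North, South} \<union> susp_proj ` (susp_over n C \<times> {-1..1})"

lemma compactin_susp_over: "compactin L C \<Longrightarrow> compactin (isusp n L) (susp_over n C)"
proof (induction n)
  case 0
  then show ?case using image_compactin[OF _ continuous_map_Base] by auto
next
  case (Suc n)
  have "compactin (prod_topology (isusp n L) (top_of_set {-1..1})) (susp_over n C \<times> {-1..1::real})"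
    using Suc by (auto simp: compactin_Times compactin_subtopology)
  then have "compactin (isusp (Suc n) L) (susp_proj ` (susp_over n C \<times> {-1..1}))"
    unfolding isusp_Suc by (rule image_compactin[OF _ continuous_map_susp_proj])
  moreover have "compactin (isusp (Suc n) L) {North, South}"
    by (rule finite_imp_compactin) (auto simp: isusp_Suc topspace_suspension)
  ultimately show ?case
    using compactin_Un by fastforce
qed

lemma join_pt_in_susp_over: "l1norm n v \<le> 1 \<Longrightarrow> (l1norm n v < 1 \<Longrightarrow> l \<in> C) \<Longrightarrow> join_pt n l v \<in> susp_over n C"
proof (induction n arbitrary: v)
  case (Suc n)
  let ?w = "\<lambda>i. v (Suc i) / (1 - \<bar>v 0\<bar>)"
  have le1: "\<bar>v 0\<bar> \<le> 1" using abs_le_l1norm[of 0 "Suc n" v] Suc.prems by simp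
  show ?case
  proof (cases "\<bar>v 0\<bar> = 1")
    case False
    then have pos: "1 - \<bar>v 0\<bar> > 0" using le1 by linarith
    then have "l1norm n ?w \<le> 1" "l1norm n ?w < 1 \<longleftrightarrow> l1norm (Suc n) v < 1"
      using Suc.prems pos by (auto simp: l1norm_Suc l1norm_divide)
    then have "join_pt n l ?w \<in> susp_over n C" using Suc by blast
    moreover have "join_pt (Suc n) l v = susp_proj (join_pt n l ?w, v 0)" using pos by (auto simp: susp_proj_def)
    moreover have "v 0 \<in> {-1..1}" using pos by auto
    ultimately show ?thesis by auto
  qed (auto simp: abs_if split: if_splits)
qed auto

text \<open>A proper function: boundedness of \<open>\<phi>\<close> stands for staying in a compact
  part of \<open>L\<close>. The lower bound 1 gives \<open>1 / \<phi>\<close> values between 0 and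
  1.\<close>

definition exhausting :: "'b topology \<Rightarrow> ('b \<Rightarrow> real) \<Rightarrow> bool" where
  "exhausting L \<phi> \<longleftrightarrow> continuous_map L euclideanreal \<phi> \<and> (\<forall>p \<in> topspace L. 1 \<le> \<phi> p) \<and>
    (\<forall>c. compactin L {p \<in> topspace L. \<phi> p \<le> c})"

section \<open>Combining a ball map with an \<open>L\<close>-map\<close>

lemma continuous_map_l1norm:
  assumes "\<And>i. i < n \<Longrightarrow> continuous_map X euclideanreal (\<lambda>x. v x i)"
  shows "continuous_map X euclideanreal (\<lambda>x. l1norm n (v x))"
  unfolding l1norm_def using assms by (intro continuous_intros) auto

text \<open>The tube lemma: the preimage of \<open>U\<close> in the product contains
  \<open>C\<close> times an endpoint of the interval, hence a tube of uniform width. This is where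
  compactness of \<open>C\<close> enters.\<close>

lemma compact_polar_nbhd:
  assumes U: "openin (suspension Y) U" and C: "compactin Y C"
  shows "North \<in> U \<Longrightarrow> \<exists>\<delta>>0. \<forall>y\<in>C. \<forall>t. 1 - \<delta> < t \<longrightarrow> t < 1 \<longrightarrow> Mid y t \<in> U" (is "_ \<Longrightarrow> ?N")
    and "South \<in> U \<Longrightarrow> \<exists>\<delta>>0. \<forall>y\<in>C. \<forall>t. t < \<delta> - 1 \<longrightarrow> -1 < t \<longrightarrow> Mid y t \<in> U" (is "_ \<Longrightarrow> ?S")
proof -
  let ?W = "{z \<in> topspace Y \<times> {-1..1}. susp_proj z \<in> U}"
  have W: "openin (prod_topology Y (top_of_set {-1..1})) ?W"
    using U openin_suspension by blast
  have CY: "C \<subseteq> topspace Y" using C compactin_subset_topspace by blast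
  { assume "North \<in> U"
    then have "C \<times> {1} \<subseteq> ?W" using CY by (auto simp: susp_proj_def)
    from tube_lemma_left[OF W C _ this] obtain V where V: "openin (top_of_set {-1..1::real}) V" "1 \<in> V" "C \<times> V \<subseteq> ?W"
      by fastforce
    then obtain \<delta> where \<delta>: "\<delta> > 0" "\<And>t. t \<in> {-1..1} \<Longrightarrow> dist t 1 < \<delta> \<Longrightarrow> t \<in> V"
      unfolding openin_euclidean_subtopology_iff by blast
    \<comment> \<open>The minimum with 1 keeps \<open>t\<close> positive, hence inside the interval
      \<open>{-1..1}\<close>.\<close>
    have "Mid y t \<in> U" if "y \<in> C" "1 - min \<delta> 1 < t" "t < 1" for y t
    proof -
      have "t \<in> V" using that by (intro \<delta>(2)) (auto simp: dist_real_def)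
      then have "(y,t) \<in> ?W" using V(3) that by blast
      then show ?thesis using that by (auto simp: susp_proj_def split: if_splits)
    qed
    then show ?N using \<delta>(1) by (intro exI[of _ "min \<delta> 1"]) auto }
  { assume "South \<in> U"
    then have "C \<times> {-1} \<subseteq> ?W" using CY by (auto simp: susp_proj_def)
    from tube_lemma_left[OF W C _ this] obtain V where V: "openin (top_of_set {-1..1::real}) V" "-1 \<in> V" "C \<times> V \<subseteq> ?W"
      by fastforce
    then obtain \<delta> where \<delta>: "\<delta> > 0" "\<And>t. t \<in> {-1..1} \<Longrightarrow> dist t (-1) < \<delta> \<Longrightarrow> t \<in> V"
      unfolding openin_euclidean_subtopology_iff by blast
    have "Mid y t \<in> U" if "y \<in> C" "t < min \<delta> 1 - 1" "-1 < t" for y t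
    proof -
      have "t \<in> V" using that by (intro \<delta>(2)) (auto simp: dist_real_def)
      then have "(y,t) \<in> ?W" using V(3) that by blast
      then show ?thesis using that by (auto simp: susp_proj_def split: if_splits)
    qed
    then show ?S using \<delta>(1) by (intro exI[of _ "min \<delta> 1"]) auto }
qed

text \<open>For non-compact \<open>L\<close> the quotient topology at the poles is finer than the one given by the
  coordinates; this is why the base point has to stay in a compact part of \<open>L\<close> near the sphere.\<close>

proposition continuous_map_join_pt:
  assumes ex: "exhausting L \<phi>"
    and "\<And>i. i < n \<Longrightarrow> continuous_map X euclideanreal (\<lambda>x. v x i)"
    and "\<And>x. x \<in> topspace X \<Longrightarrow> l1norm n (v x) \<le> 1"
    and "continuous_map (subtopology X {x. l1norm n (v x) < 1}) L l"
    and "\<And>x. x \<in> topspace X \<Longrightarrow> l1norm n (v x) = 1 \<Longrightarrow>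
       \<exists>W c. openin X W \<and> x \<in> W \<and> (\<forall>y\<in>W. l1norm n (v y) < 1 \<longrightarrow> \<phi> (l y) \<le> c)"
  shows "continuous_map X (isusp n L) (\<lambda>x. join_pt n (l x) (v x))"
  using assms(2-)
proof (induction n arbitrary: X v)
  case 0
  then have "continuous_map X L l" by simp
  from continuous_map_compose[OF this continuous_map_Base] show ?case by (simp add: o_def)
next
  case (Suc n)
  note cv = Suc.prems(1) and le1 = Suc.prems(2) and cl = Suc.prems(3) and lb = Suc.prems(4)
  let ?F = "\<lambda>x. join_pt (Suc n) (l x) (v x)"
  let ?w = "\<lambda>x i. v x (Suc i) / (1 - \<bar>v x 0\<bar>)"
  have l_in: "l x \<in> topspace L" if "x \<in> topspace X" "l1norm (Suc n) (v x) < 1" for x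
    using continuous_map_image_subset_topspace[OF cl] that by auto
  have cv0: "continuous_map X euclideanreal (\<lambda>x. v x 0)" using cv by simp
  have v0: "\<bar>v x 0\<bar> \<le> 1" if "x \<in> topspace X" for x
    using le1[OF that] abs_le_l1norm[of 0 "Suc n" "v x"] by simp
  \<comment> \<open>Where the outermost parameter is not a pole, the map is \<open>susp_proj\<close>
    of a pair, and the induction hypothesis applies to the rescaled remaining coordinates. Points
    over the poles are treated directly below.\<close>
  define X1 where "X1 = {x \<in> topspace X. \<bar>v x 0\<bar> < 1}"
  have X1: "openin X X1" unfolding X1_def
    using cv0 by (intro openin_real_less continuous_intros)
  have tX1: "topspace (subtopology X X1) = X1" using X1_def by auto
  have eqw: "l1norm n (?w x) * (1 - \<bar>v x 0\<bar>) = l1norm (Suc n) (v x) - \<bar>v x 0\<bar>" if "x \<in> X1" for x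
    using that by (simp add: l1norm_Suc l1norm_divide X1_def)
  have w1: "l1norm n (?w x) \<le> 1" if "x \<in> X1" for x
    using le1[of x] that by (auto simp: l1norm_Suc l1norm_divide X1_def)
  have w2: "l1norm n (?w x) < 1 \<longleftrightarrow> l1norm (Suc n) (v x) < 1" and w3: "l1norm n (?w x) = 1 \<longleftrightarrow> l1norm (Suc n) (v x) = 1"
    if "x \<in> X1" for x
  proof -
    have "l1norm n (?w x) = (l1norm (Suc n) (v x) - \<bar>v x 0\<bar>) / (1 - \<bar>v x 0\<bar>)"
      using that by (simp add: l1norm_Suc l1norm_divide X1_def)
    moreover have "0 < 1 - \<bar>v x 0\<bar>" using that by (simp add: X1_def)
    ultimately show "l1norm n (?w x) < 1 \<longleftrightarrow> l1norm (Suc n) (v x) < 1" "l1norm n (?w x) = 1 \<longleftrightarrow> l1norm (Suc n) (v x) = 1"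
      by (simp_all add: divide_less_eq divide_eq_eq)
  qed
  have "continuous_map (subtopology X X1) (isusp n L) (\<lambda>x. join_pt n (l x) (?w x))"
  proof (rule Suc.IH)
    fix i assume "i < n"
    have a: "continuous_map (subtopology X X1) euclideanreal (\<lambda>x. v x (Suc i))"
         "continuous_map (subtopology X X1) euclideanreal (\<lambda>x. v x 0)"
      using cv \<open>i < n\<close> by (auto intro: continuous_map_from_subtopology)
    show "continuous_map (subtopology X X1) euclideanreal (\<lambda>x. ?w x i)"
      by (intro continuous_intros a) (auto simp: X1_def)
  next
    fix x assume "x \<in> topspace (subtopology X X1)"
    then show "l1norm n (?w x) \<le> 1" using w1 tX1 by blast
  next
    have "subtopology (subtopology X X1) {x. l1norm n (?w x) < 1} = subtopology X (X1 \<inter> {x. l1norm n (?w x) < 1})"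
      by (simp add: subtopology_subtopology)
    also have "X1 \<inter> {x. l1norm n (?w x) < 1} = X1 \<inter> {x. l1norm (Suc n) (v x) < 1}"
      using w2 by blast
    finally show "continuous_map (subtopology (subtopology X X1) {x. l1norm n (?w x) < 1}) L l"
      using cl continuous_map_from_subtopology_mono by fastforce
  next
    fix x assume x: "x \<in> topspace (subtopology X X1)" "l1norm n (?w x) = 1"
    then have "x \<in> X1" "x \<in> topspace X" using tX1 by auto
    then obtain W c where W: "openin X W" "x \<in> W" "\<forall>y\<in>W. l1norm (Suc n) (v y) < 1 \<longrightarrow> \<phi> (l y) \<le> c"
      using lb[of x] w3 x by blast
    then have "openin (subtopology X X1) (W \<inter> X1)" using openin_subtopology by blast
    then show "\<exists>W c. openin (subtopology X X1) W \<and> x \<in> W \<and> (\<forall>y\<in>W. l1norm n (?w y) < 1 \<longrightarrow> \<phi> (l y) \<le> c)"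
      using W \<open>x \<in> X1\<close> w2 by (intro exI[of _ "W \<inter> X1"] exI[of _ c]) blast
  qed
  moreover have "continuous_map (subtopology X X1) (top_of_set {-1..1}) (\<lambda>x. v x 0)"
    using cv0 tX1 by (auto simp: continuous_map_in_subtopology X1_def intro: continuous_map_from_subtopology)
  ultimately have "continuous_map (subtopology X X1) (prod_topology (isusp n L) (top_of_set {-1..1}))
      (\<lambda>x. (join_pt n (l x) (?w x), v x 0))"
    by (intro continuous_map_pairedI)
  from continuous_map_compose[OF this continuous_map_susp_proj]
  have "continuous_map (subtopology X X1) (isusp (Suc n) L) (\<lambda>x. susp_proj (join_pt n (l x) (?w x), v x 0))"
    by (simp add: isusp_Suc o_def)
  then have F1: "continuous_map (subtopology X X1) (isusp (Suc n) L) ?F"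
    by (rule continuous_map_eq) (auto simp: susp_proj_def X1_def)
  have opolar: "openin X {x \<in> topspace X. 1 - \<delta> < v x 0}" "openin X {x \<in> topspace X. v x 0 < \<delta> - 1}" for \<delta>
    using cv0 by (auto intro!: openin_real_less)
  show ?case unfolding continuous_map
  proof (intro conjI allI impI)
    show "?F ` topspace X \<subseteq> topspace (isusp (Suc n) L)"
      by (intro image_subsetI join_pt_in le1 l_in)
  next
    fix U assume U: "openin (isusp (Suc n) L) U"
    let ?S = "{x \<in> topspace X. ?F x \<in> U}"
    show "openin X ?S"
    proof (subst openin_subopen, rule ballI)
      fix x assume xS: "x \<in> ?S"
      then have x: "x \<in> topspace X" "?F x \<in> U" by auto
      show "\<exists>T. openin X T \<and> x \<in> T \<and> T \<subseteq> ?S"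
      proof (cases "x \<in> X1")
        case True
        have "openin (subtopology X X1) {y \<in> topspace (subtopology X X1). ?F y \<in> U}"
          using openin_continuous_map_preimage[OF F1 U] .
        then have "openin X {y \<in> X1. ?F y \<in> U}"
          using X1 openin_trans_full tX1 by metis
        then show ?thesis using True x X1_def by (intro exI[of _ "{y \<in> X1. ?F y \<in> U}"]) auto
      next
        case False
        then have pole: "\<bar>v x 0\<bar> = 1" using v0[OF x(1)] x(1) by (auto simp: X1_def)
        have "l1norm (Suc n) (v x) = 1"
          using pole le1[OF x(1)] abs_le_l1norm[of 0 "Suc n" "v x"] by simp
        from lb[OF x(1) this] obtain W c
          where W: "openin X W" "x \<in> W" "\<forall>y\<in>W. l1norm (Suc n) (v y) < 1 \<longrightarrow> \<phi> (l y) \<le> c"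
          by blast
        \<comment> \<open>Near \<open>x\<close> the level below is confined to this compact set, so
          closeness of \<open>v y 0\<close> to the endpoint alone forces the value into
          \<open>U\<close>; if \<open>v y 0\<close> equals the endpoint, the value is the pole
          itself.\<close>
        define C where "C = susp_over n {p \<in> topspace L. \<phi> p \<le> c}"
        have C: "compactin (isusp n L) C"
          unfolding C_def using ex by (intro compactin_susp_over) (auto simp: exhausting_def)
        have inC: "join_pt n (l y) (?w y) \<in> C" if "y \<in> W" "y \<in> X1" for y
          unfolding C_def using that w1 w2 W l_in openin_subset[OF W(1)]
          by (intro join_pt_in_susp_over) blast+
        have Fmid: "?F y = Mid (join_pt n (l y) (?w y)) (v y 0)" if "y \<in> X1" for y
          using that by (auto simp: X1_def)
        have U': "openin (suspension (isusp n L)) U" using U by (simp add: isusp_Suc)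
        show ?thesis
        proof (cases "v x 0 = 1")
          case True
          then have "North \<in> U" using x by simp
          from compact_polar_nbhd(1)[OF U' C this] obtain \<delta>
            where \<delta>: "\<delta> > 0" "\<And>y t. y \<in> C \<Longrightarrow> 1 - \<delta> < t \<Longrightarrow> t < 1 \<Longrightarrow> Mid y t \<in> U" by metis
          let ?T = "W \<inter> {x \<in> topspace X. 1 - min \<delta> 1 < v x 0}"
          have "?T \<subseteq> ?S"
          proof
            fix y assume y: "y \<in> ?T"
            show "y \<in> ?S"
            proof (cases "y \<in> X1")
              case True
              then show ?thesis using y inC[of y] Fmid \<delta>(2) by (auto simp: X1_def)
            next
              case False
              then have "v y 0 = 1" using y v0[of y] by (auto simp: X1_def abs_if split: if_splits)
              then show ?thesis using y \<open>North \<in> U\<close> by simp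
            qed
          qed
          then show ?thesis using W opolar(1)[of "min \<delta> 1"] \<delta>(1) True x
            by (intro exI[of _ ?T]) auto
        next
          case False
          then have m1: "v x 0 = -1" using pole by linarith
          then have "South \<in> U" using x by simp
          from compact_polar_nbhd(2)[OF U' C this] obtain \<delta>
            where \<delta>: "\<delta> > 0" "\<And>y t. y \<in> C \<Longrightarrow> t < \<delta> - 1 \<Longrightarrow> -1 < t \<Longrightarrow> Mid y t \<in> U" by metis
          let ?T = "W \<inter> {x \<in> topspace X. v x 0 < min \<delta> 1 - 1}"
          have "?T \<subseteq> ?S"
          proof
            fix y assume y: "y \<in> ?T"
            show "y \<in> ?S"
            proof (cases "y \<in> X1")
              case True
              then show ?thesis using y inC[of y] Fmid \<delta>(2) by (auto simp: X1_def)
            next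
              case False
              then have "v y 0 = -1" using y v0[of y] by (auto simp: X1_def abs_if split: if_splits)
              then show ?thesis using y \<open>South \<in> U\<close> by simp
            qed
          qed
          then show ?thesis using W opolar(2)[of "min \<delta> 1"] \<delta>(1) m1 x
            by (intro exI[of _ ?T]) auto
        qed
      qed
    qed
  qed
qed

section \<open>Boundedness of base points near the sphere\<close>

lemma continuous_majorant_of_sequence:
  fixes c :: "nat \<Rightarrow> real"
  shows "\<exists>g. continuous_on UNIV g \<and> (\<forall>j. \<forall>t \<ge> real j. c j \<le> g t)"
proof -
  \<comment> \<open>The \<open>j\<close>-th summand is a ramp that vanishes up to
    \<open>j - 1\<close> and is constant from \<open>j\<close> on. Hence all summands beyond the
    cut-off in \<open>g\<close>, which depends on \<open>t\<close>, are 0.\<close>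
  define G where "G N t = (\<Sum>j<N. \<bar>c j\<bar> * max 0 (min 1 (t - real j + 1)))" for N :: nat and t :: real
  define g where "g t = G (nat \<lceil>t\<rceil> + 1) t" for t
  have gG: "g t = G N t" if "t + 1 \<le> real N" "0 < N" for N t
    unfolding g_def G_def
  proof (rule sum.mono_neutral_left)
    have "nat \<lceil>t\<rceil> + 1 \<le> N" using that by linarith
    then show "{..<nat \<lceil>t\<rceil> + 1} \<subseteq> {..<N}" by auto
    show "\<forall>i\<in>{..<N} - {..<nat \<lceil>t\<rceil> + 1}. \<bar>c i\<bar> * max 0 (min 1 (t - real i + 1)) = 0"
    proof
      fix i assume "i \<in> {..<N} - {..<nat \<lceil>t\<rceil> + 1}"
      then have "t + 1 \<le> real i" by auto linarith
      then show "\<bar>c i\<bar> * max 0 (min 1 (t - real i + 1)) = 0" by simp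
    qed
  qed auto
  have "isCont g t" for t
  proof -
    obtain N :: nat where N: "max 0 (t + 1) < real N" using reals_Archimedean2 by blast
    have "continuous_on {..<real N - 1} (G N)" unfolding G_def by (intro continuous_intros)
    then have "continuous_on {..<real N - 1} g"
      by (rule continuous_on_eq) (rule gG[symmetric], use N in auto)
    then show ?thesis using N continuous_on_eq_continuous_at[of "{..<real N - 1}" g] by auto
  qed
  moreover have "c j \<le> g t" if "real j \<le> t" for j t
  proof -
    have "\<bar>c j\<bar> * max 0 (min 1 (t - real j + 1)) \<le> g t"
      unfolding g_def G_def by (rule member_le_sum) (use that in \<open>auto, linarith\<close>)
    then show ?thesis using that by simp
  qed
  ultimately show ?thesis by (intro exI[of _ g]) (auto simp: continuous_at_imp_continuous_on)
qed

text \<open>The converse: otherwise some \<open>\<eta>\<close> growing fast enough along \<open>\<phi>\<close> would make the continuous function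
  \<open>weighted \<eta>\<close> jump at \<open>f x\<close>.\<close>

proposition base_pt_locally_bounded:
  assumes ex: "exhausting L \<phi>" and X: "metrizable_space X" and f: "continuous_map X (isusp n L) f"
    and x: "x \<in> topspace X" "weight (f x) = 0"
  shows "\<exists>W c. openin X W \<and> x \<in> W \<and> (\<forall>y\<in>W. 0 < weight (f y) \<longrightarrow> \<phi> (base_pt (f y)) \<le> c)"
proof (rule ccontr)
  assume *: "\<not> ?thesis"
  obtain M d where M: "Metric_space M d" "X = Metric_space.mtopology M d"
    using X metrizable_space_def by blast
  interpret Metric_space M d by fact
  have "\<exists>y. y \<in> mball x (1 / (real j + 1)) \<and> 0 < weight (f y) \<and> real j < \<phi> (base_pt (f y))" for j :: nat
  proof -
    have "openin X (mball x (1 / (real j + 1)))" "x \<in> mball x (1 / (real j + 1))"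
      using x M by auto
    then show ?thesis using * by (meson not_le)
  qed
  then obtain y where y: "\<And>j. y j \<in> mball x (1 / (real j + 1))" "\<And>j. 0 < weight (f (y j))"
      "\<And>j. real j < \<phi> (base_pt (f (y j)))"
    by metis
  \<comment> \<open>Chosen so that \<open>weighted (g \<circ> \<phi>) \<circ> f\<close> is at least
    1 at every \<open>y j\<close>, although it is 0 at the limit \<open>x\<close> of the
    \<open>y j\<close>.\<close>
  obtain g where g: "continuous_on UNIV g" "\<And>j t. real j \<le> t \<Longrightarrow> 1 / weight (f (y j)) \<le> g t"
    using continuous_majorant_of_sequence[of "\<lambda>j. 1 / weight (f (y j))"] by blast
  have "continuous_map L euclideanreal (g \<circ> \<phi>)"
    using ex g(1) by (intro continuous_map_compose[of L euclideanreal \<phi>]) (auto simp: exhausting_def)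
  from continuous_map_compose[OF f continuous_map_weighted[OF this]]
  have "continuous_map X euclideanreal (weighted (g \<circ> \<phi>) \<circ> f)" .
  then have "openin X {z \<in> topspace X. (weighted (g \<circ> \<phi>) \<circ> f) z < 1}"
    by (rule openin_real_less) (rule continuous_map_const[THEN iffD2], simp)
  moreover have "x \<in> {z \<in> topspace X. (weighted (g \<circ> \<phi>) \<circ> f) z < 1}"
    using x by (simp add: weighted_eq)
  ultimately obtain r where r: "r > 0" "mball x r \<subseteq> {z \<in> topspace X. (weighted (g \<circ> \<phi>) \<circ> f) z < 1}"
    using M openin_mtopology by metis
  obtain j :: nat where "1 / r < real j" using reals_Archimedean2 by blast
  then have "1 / (real j + 1) < r" using r(1) by (simp add: field_simps)
  then have "y j \<in> mball x r" using y(1)[of j] mball_subset_concentric[of "1 / (real j + 1)" r x] by auto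
  then have "weighted (g \<circ> \<phi>) (f (y j)) < 1" using r by auto
  moreover have "1 / weight (f (y j)) \<le> g (\<phi> (base_pt (f (y j))))"
    using g(2) y(3)[of j] by simp
  ultimately show False
    using y(2)[of j] by (simp add: weighted_eq field_simps)
qed

section \<open>Auxiliary functions on metrizable spaces\<close>

lemma (in Metric_space) continuous_map_nonexpansive:
  assumes lip: "\<And>x y. x \<in> M \<Longrightarrow> y \<in> M \<Longrightarrow> f x \<le> f y + d x y"
  shows "continuous_map mtopology euclideanreal f"
  unfolding continuous_map
proof (intro conjI allI impI)
  fix U :: "real set" assume "openin euclideanreal U"
  then have U: "open U" by simp
  show "openin mtopology {x \<in> topspace mtopology. f x \<in> U}"
    unfolding openin_mtopology
  proof (intro conjI allI impI)
    fix x assume x: "x \<in> {x \<in> topspace mtopology. f x \<in> U}"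
    then obtain e where e: "e > 0" "\<And>t. dist t (f x) < e \<Longrightarrow> t \<in> U"
      using U open_dist by blast
    have "mball x e \<subseteq> {x \<in> topspace mtopology. f x \<in> U}"
    proof
      fix z assume z: "z \<in> mball x e"
      then have "dist (f z) (f x) < e"
        using lip[of x z] lip[of z x] commute[of x z] by (auto simp: dist_real_def)
      then show "z \<in> {x \<in> topspace mtopology. f x \<in> U}" using e z by auto
    qed
    then show "\<exists>r>0. mball x r \<subseteq> {x \<in> topspace mtopology. f x \<in> U}" using e by blast
  qed auto
qed auto

text \<open>For nonempty \<open>T\<close> the infimum of \<open>g y + d x y\<close> over
  \<open>T\<close> is the largest 1-Lipschitz function below \<open>g\<close>, be \<open>g\<close>
  continuous or not. If \<open>g\<close> is at least \<open>e\<close> on the points of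
  \<open>T\<close> within \<open>r\<close> of \<open>x\<close>, near points contribute at least
  \<open>e\<close> and far ones at least \<open>r\<close>, so it is positive at
  \<open>x\<close>.\<close>

lemma inf_convolution:
  assumes X: "metrizable_space X" and T: "T \<subseteq> topspace X" and g0: "\<And>y. y \<in> T \<Longrightarrow> 0 \<le> g y"
  obtains s :: "'a \<Rightarrow> real" where "continuous_map X euclideanreal s" "\<And>x. 0 \<le> s x" "\<And>x. x \<in> T \<Longrightarrow> s x \<le> g x"
    "\<And>x W e. openin X W \<Longrightarrow> x \<in> W \<Longrightarrow> 0 < e \<Longrightarrow> (\<And>y. y \<in> W \<Longrightarrow> y \<in> T \<Longrightarrow> e \<le> g y) \<Longrightarrow> 0 < s x"
proof (cases "T = {}")
  case True
  show ?thesis by (rule that[of "\<lambda>_. 1"]) (use True in auto)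
next
  case False
  obtain M d where M: "Metric_space M d" "X = Metric_space.mtopology M d"
    using X metrizable_space_def by blast
  interpret Metric_space M d by fact
  have TM: "T \<subseteq> M" using T M by simp
  define s where "s x = (INF y\<in>T. g y + d x y)" for x
  have bdd: "bdd_below ((\<lambda>y. g y + d x y) ` T)" for x
    using g0 by (intro bdd_belowI[of _ 0]) auto
  have lip: "s x \<le> s x' + d x x'" if "x \<in> M" "x' \<in> M" for x x'
  proof -
    have "s x - d x x' \<le> g y + d x' y" if y: "y \<in> T" for y
    proof -
      have "s x \<le> g y + d x y" unfolding s_def by (rule cINF_lower[OF bdd y])
      moreover have "d x y \<le> d x x' + d x' y"
        using \<open>x \<in> M\<close> \<open>x' \<in> M\<close> TM y by (intro triangle) auto
      ultimately show ?thesis by linarith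
    qed
    then have "s x - d x x' \<le> s x'" unfolding s_def[of x'] by (intro cINF_greatest False)
    then show ?thesis by linarith
  qed
  show ?thesis
  proof
    show "continuous_map X euclideanreal s"
      unfolding M(2) using lip by (rule continuous_map_nonexpansive)
    show "0 \<le> s x" for x
      unfolding s_def using g0 by (intro cINF_greatest False) auto
    show "s x \<le> g x" if x: "x \<in> T" for x
    proof -
      have "s x \<le> g x + d x x" unfolding s_def by (rule cINF_lower[OF bdd x])
      then show ?thesis using x TM by auto
    qed
  next
    fix x W and e :: real
    assume W: "openin X W" "x \<in> W" "0 < e" "\<And>y. y \<in> W \<Longrightarrow> y \<in> T \<Longrightarrow> e \<le> g y"
    obtain r where r: "r > 0" "mball x r \<subseteq> W" using W(1,2) M(2) openin_mtopology by blast
    have xM: "x \<in> M" using W(1,2) M(2) openin_mtopology by blast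
    have "min e r \<le> g y + d x y" if "y \<in> T" for y
    proof (cases "y \<in> mball x r")
      case True
      then have "e \<le> g y" using W(4) r(2) that by blast
      then show ?thesis by (smt (verit) nonneg)
    next
      case False
      then have "r \<le> d x y" using that TM xM by auto
      then show ?thesis using g0[OF that] by linarith
    qed
    then have "min e r \<le> s x" unfolding s_def by (intro cINF_greatest False)
    then show "0 < s x" using W(3) r(1) by linarith
  qed
qed

text \<open>Turns local bounds into one continuous bound; in the application \<open>g\<close> is the
  reciprocal of \<open>\<phi>\<close> along an \<open>L\<close>-map.\<close>

lemma positive_continuous_minorant:
  fixes g :: "'a \<Rightarrow> real"
  assumes X: "metrizable_space X" and T: "T \<subseteq> topspace X"
    and loc: "\<And>x. x \<in> T \<Longrightarrow> \<exists>W e. openin X W \<and> x \<in> W \<and> 0 < e \<and> (\<forall>y \<in> W \<inter> T. e \<le> g y)"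
  obtains s where "continuous_map X euclideanreal s" "\<And>x. x \<in> T \<Longrightarrow> 0 < s x" "\<And>x. x \<in> T \<Longrightarrow> s x \<le> g x"
proof -
  have g0: "0 \<le> g y" if "y \<in> T" for y using loc[OF that] that by (meson IntI less_imp_le order_trans)
  obtain s where s: "continuous_map X euclideanreal s" "\<And>x. x \<in> T \<Longrightarrow> s x \<le> g x"
    "\<And>x W e. openin X W \<Longrightarrow> x \<in> W \<Longrightarrow> 0 < e \<Longrightarrow> (\<And>y. y \<in> W \<Longrightarrow> y \<in> T \<Longrightarrow> e \<le> g y) \<Longrightarrow> 0 < s x"
    using inf_convolution[where g = g, OF X T g0] by metis
  have "0 < s x" if "x \<in> T" for x
    using loc[OF that] s(3)[of _ x] by (meson IntI)
  then show ?thesis using s that by blast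
qed

text \<open>With \<open>g = 0\<close> the infimum is the distance to \<open>C\<close>. Positivity
  off \<open>C\<close> comes from taking \<open>W\<close> to be the complement of \<open>C\<close>,
  where the lower bound demanded of \<open>g\<close> is vacuous.\<close>

lemma closedin_zero_set:
  assumes X: "metrizable_space X" and C: "closedin X C"
  obtains s :: "'a \<Rightarrow> real" where "continuous_map X euclideanreal s"
    "\<And>x. x \<in> C \<Longrightarrow> s x = 0" "\<And>x. x \<in> topspace X - C \<Longrightarrow> 0 < s x"
proof -
  obtain s :: "'a \<Rightarrow> real" where s: "continuous_map X euclideanreal s" "\<And>x. 0 \<le> s x" "\<And>x. x \<in> C \<Longrightarrow> s x \<le> 0"
    "\<And>x W e. openin X W \<Longrightarrow> x \<in> W \<Longrightarrow> (0::real) < e \<Longrightarrow> (\<And>y. y \<in> W \<Longrightarrow> y \<in> C \<Longrightarrow> e \<le> 0) \<Longrightarrow> 0 < s x"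
    using inf_convolution[OF X closedin_subset[OF C], of "\<lambda>_. 0"] by auto
  have "openin X (topspace X - C)" using C by blast
  then have "0 < s x" if "x \<in> topspace X - C" for x
    using that by (rule s(4)[of _ x 1]) auto
  moreover have "s x = 0" if "x \<in> C" for x using s(2,3) that by (metis order_antisym)
  ultimately show ?thesis using s(1) that by blast
qed

section \<open>Locally finite complexes\<close>

abbreviation supp :: "('v \<Rightarrow> real) \<Rightarrow> 'v set" where
  "supp p \<equiv> {v. p v \<noteq> 0}"

lemma simplicial_cplxD:
  assumes "simplicial_cplx K" "s \<in> K"
  shows "finite s" "s \<noteq> {}" "\<And>t. t \<subseteq> s \<Longrightarrow> t \<noteq> {} \<Longrightarrow> t \<in> K"
  using assms unfolding simplicial_cplx_def by blast+

lemma topspace_realization_iff: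
  assumes "simplicial_cplx K"
  shows "p \<in> topspace (realization K) \<longleftrightarrow> (\<forall>v. 0 \<le> p v) \<and> supp p \<in> K \<and> sum p (supp p) = 1"
proof
  assume "p \<in> topspace (realization K)"
  then obtain s where s: "s \<in> K" "p \<in> closed_simplex s"
    by (auto simp: topspace_realization)
  have fin: "finite s" using assms s by (auto simp: simplicial_cplx_def)
  have sub: "supp p \<subseteq> s" using s by (auto simp: closed_simplex_def)
  have sum: "sum p (supp p) = 1"
    using s sum.mono_neutral_left[OF fin sub, of p] by (auto simp: closed_simplex_def)
  then have "supp p \<noteq> {}" by force
  then have "supp p \<in> K" using simplicial_cplxD(3)[OF assms s(1) sub] by blast
  then show "(\<forall>v. 0 \<le> p v) \<and> supp p \<in> K \<and> sum p (supp p) = 1"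
    using s sum by (auto simp: closed_simplex_def)
next
  assume "(\<forall>v. 0 \<le> p v) \<and> supp p \<in> K \<and> sum p (supp p) = 1"
  then show "p \<in> topspace (realization K)"
    unfolding topspace_realization closed_simplex_def by (intro UN_I[of "supp p"]) auto
qed

lemma closed_coord:
  fixes c :: real
  shows "closed {p :: 'v \<Rightarrow> real. p v = c}" "closed {p :: 'v \<Rightarrow> real. 0 \<le> p v}" "open {p :: 'v \<Rightarrow> real. 0 < p v}"
  by (auto intro!: closed_Collect_eq closed_Collect_le open_Collect_less continuous_intros continuous_on_product_coordinates)

lemma
  fixes s :: "'v set"
  assumes "finite s"
  shows closed_closed_simplex: "closed (closed_simplex s)"
    and compact_closed_simplex: "compact (closed_simplex s)"
proof -
  have "closed_simplex s = (\<Inter>v. {p. 0 \<le> p v}) \<inter> (\<Inter>v\<in>-s. {p. p v = 0}) \<inter> {p. (\<Sum>v\<in>s. p v) = 1}"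
    by (auto simp: closed_simplex_def)
  moreover have "closed {p :: 'v \<Rightarrow> real. (\<Sum>v\<in>s. p v) = 1}"
    by (intro closed_Collect_eq continuous_intros continuous_on_product_coordinates)
  ultimately have cl: "closed (closed_simplex s)"
    by (auto intro!: closed_Int closed_INT closed_coord)
  let ?B = "PiE UNIV (\<lambda>v. if v \<in> s then {0..1} else {0}) :: ('v \<Rightarrow> real) set"
  have "compactin (product_topology (\<lambda>_. euclideanreal) UNIV) ?B"
    by (auto simp: compactin_PiE)
  then have B: "compact ?B" by (simp add: euclidean_product_topology)
  have "closed_simplex s \<subseteq> ?B"
  proof
    fix p assume p: "p \<in> closed_simplex s"
    have "p v \<le> 1" if "v \<in> s" for v
      using member_le_sum[OF that, of p] assms p by (auto simp: closed_simplex_def)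
    then show "p \<in> ?B" using p by (auto simp: closed_simplex_def PiE_iff)
  qed
  then show "compact (closed_simplex s)" using compact_Int_closed[OF B cl] by (simp add: Int_absorb1)
  show "closed (closed_simplex s)" by (rule cl)
qed

text \<open>Local finiteness reduces the weak topology to pointwise convergence of coordinates: on
  the open set where a fixed coordinate \<open>v\<close> is positive only the finitely many
  simplices containing \<open>v\<close> occur, and removing finitely many closed sets leaves an open
  set.\<close>

lemma realization_eq_top_of_set:
  assumes K: "simplicial_cplx K" "locally_finite_cplx K"
  shows "realization K = top_of_set (topspace (realization K))"
  unfolding topology_eq
proof (intro allI iffI)
  fix U assume U: "openin (realization K) U"
  have cl: "closed (closed_simplex s - U)" if "s \<in> K" for s
  proof -
    have "openin (top_of_set (closed_simplex s)) (closed_simplex s \<inter> U)"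
      using U that by (auto simp: openin_realization Int_commute)
    then have "closedin (top_of_set (closed_simplex s)) (closed_simplex s - closed_simplex s \<inter> U)"
      using closedin_diff[OF closedin_topspace] by fastforce
    then have "closedin (top_of_set (closed_simplex s)) (closed_simplex s - U)"
      by (simp add: Diff_Int)
    moreover have "closed (closed_simplex s)"
      using simplicial_cplxD(1)[OF K(1) that] by (rule closed_closed_simplex)
    ultimately show ?thesis using closedin_closed_trans by blast
  qed
  show "openin (top_of_set (topspace (realization K))) U"
  proof (subst openin_subopen, rule ballI)
    fix p assume p: "p \<in> U"
    then have pK: "p \<in> topspace (realization K)" using U openin_subset by blast
    then have sp: "\<forall>v. 0 \<le> p v" "supp p \<in> K" using topspace_realization_iff[OF K(1)] by auto
    then obtain v where "p v \<noteq> 0" using simplicial_cplxD(2)[OF K(1)] by blast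
    then have v: "p v > 0" using sp(1) by (simp add: order_less_le)
    have "v \<in> \<Union>K" using sp v by (intro UnionI[of "supp p"]) auto
    then have fin: "finite {s \<in> K. v \<in> s}" using K(2) by (auto simp: locally_finite_cplx_def)
    define T where "T = {q. 0 < q v} - (\<Union>s\<in>{s \<in> K. v \<in> s}. closed_simplex s - U)"
    have "open T" unfolding T_def using fin cl by (intro open_Diff closed_coord closed_UN) auto
    then have "openin (top_of_set (topspace (realization K))) (topspace (realization K) \<inter> T)"
      by (simp add: openin_open_Int)
    moreover have "p \<in> T" using v p by (auto simp: T_def)
    moreover have "topspace (realization K) \<inter> T \<subseteq> U"
    proof
      fix q assume q: "q \<in> topspace (realization K) \<inter> T"
      then obtain s where s: "s \<in> K" "q \<in> closed_simplex s" by (auto simp: topspace_realization)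
      then have "v \<in> s" using q by (auto simp: T_def closed_simplex_def)
      then show "q \<in> U" using q s by (auto simp: T_def)
    qed
    ultimately show "\<exists>T. openin (top_of_set (topspace (realization K))) T \<and> p \<in> T \<and> T \<subseteq> U"
      using pK by blast
  qed
next
  fix U assume "openin (top_of_set (topspace (realization K))) U"
  then obtain T where T: "open T" "U = topspace (realization K) \<inter> T"
    by (auto simp: openin_open)
  have "U \<inter> closed_simplex s = closed_simplex s \<inter> T" if "s \<in> K" for s
    using that T by (auto simp: topspace_realization)
  then show "openin (realization K) U"
    using T by (auto simp: openin_realization topspace_realization openin_open_Int)
qed

lemma continuous_map_realization_iff:
  assumes K: "simplicial_cplx K" "locally_finite_cplx K"
  shows "continuous_map X (realization K) f \<longleftrightarrow>
    (\<forall>v. continuous_map X euclideanreal (\<lambda>x. f x v)) \<and> f ` topspace X \<subseteq> topspace (realization K)"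
proof -
  have "continuous_map X (realization K) f \<longleftrightarrow>
      continuous_map X euclidean f \<and> f ` topspace X \<subseteq> topspace (realization K)"
    using realization_eq_top_of_set[OF K] continuous_map_in_subtopology[of X euclidean _ f]
    by (metis image_subset_iff_funcset)
  then show ?thesis
    by (simp add: euclidean_product_topology[symmetric] continuous_map_componentwise_UNIV)
qed

lemma continuous_map_realization_coord:
  assumes "simplicial_cplx K" "locally_finite_cplx K"
  shows "continuous_map (realization K) euclideanreal (\<lambda>p. p v)"
  using continuous_map_realization_iff[OF assms, of "realization K" id] by simp

lemma finite_star_vertices:
  assumes "simplicial_cplx K" "locally_finite_cplx K"
  shows "finite (\<Union>{s \<in> K. v \<in> s})"
proof (cases "v \<in> \<Union>K")
  case True
  then have "finite {s \<in> K. v \<in> s}" using assms(2) unfolding locally_finite_cplx_def by blast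
  then show ?thesis using simplicial_cplxD(1)[OF assms(1)] by (intro finite_Union) blast+
next
  case False
  then have "{s \<in> K. v \<in> s} = {}" by auto
  then show ?thesis by (metis Union_empty finite.emptyI)
qed

lemma realization_pos_vertex:
  assumes "simplicial_cplx K" "p \<in> topspace (realization K)"
  obtains v where "0 < p v"
proof -
  have sp: "\<forall>v. 0 \<le> p v" "supp p \<in> K" using topspace_realization_iff[OF assms(1)] assms(2) by blast+
  then obtain v where "p v \<noteq> 0" using simplicial_cplxD(2)[OF assms(1)] by blast
  then have "0 < p v" using sp(1) by (simp add: order_less_le)
  then show ?thesis by (rule that)
qed

lemma supp_subset_star:
  assumes "simplicial_cplx K" "p \<in> topspace (realization K)" "0 < p v"
  shows "supp p \<subseteq> \<Union>{s \<in> K. v \<in> s}"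
proof (rule Union_upper)
  have "supp p \<in> K" using topspace_realization_iff[OF assms(1)] assms(2) by blast
  then show "supp p \<in> {s \<in> K. v \<in> s}" using assms(3) by simp
qed

text \<open>\<open>\<phi>\<close> averages the vertex numbers plus one with the barycentric
  coordinates as weights. If all vertices of \<open>supp p\<close> had number at least
  \<open>c\<close>, then \<open>\<phi> p\<close> would be at least \<open>c + 1\<close>; so a
  sublevel set lies in the closed stars of finitely many vertices, which are compact by local
  finiteness.\<close>

proposition exhausting_realization:
  fixes K :: "'v set set"
  assumes K: "simplicial_cplx K" "locally_finite_cplx K" "countable K"
  shows "\<exists>\<phi>. exhausting (realization K) \<phi>"
proof -
  let ?L = "realization K"
  define V where "V = \<Union>K"
  have "countable V" unfolding V_def
    using K(3) simplicial_cplxD(1)[OF K(1)] countable_UN[of K "\<lambda>s. s"] by (auto intro: countable_finite)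
  then have inj: "inj_on (to_nat_on V) V" by (rule inj_on_to_nat_on)
  define e where "e v = real (to_nat_on V v)" for v
  define \<phi> where "\<phi> p = (\<Sum>v\<in>supp p. (1 + e v) * p v)" for p :: "'v \<Rightarrow> real"
  note iff = topspace_realization_iff[OF K(1)]
  have fin: "finite (supp p)" if "p \<in> topspace ?L" for p
    using simplicial_cplxD(1)[OF K(1)] that iff by blast
  have cont: "continuous_map ?L euclideanreal \<phi>"
  proof (rule continuous_map_local)
    fix p assume p: "p \<in> topspace ?L"
    obtain v where v: "0 < p v" using realization_pos_vertex[OF K(1) p] .
    let ?U = "{q \<in> topspace ?L. 0 < q v}" and ?N = "\<Union>{s \<in> K. v \<in> s}"
    have c: "continuous_map (subtopology ?L ?U) euclideanreal (\<lambda>q. q w)" for w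
      using continuous_map_realization_coord[OF K(1,2)] by (rule continuous_map_from_subtopology)
    have "continuous_map (subtopology ?L ?U) euclideanreal (\<lambda>q. \<Sum>w\<in>?N. (1 + e w) * q w)"
      by (intro continuous_intros c finite_star_vertices K(1,2))
    moreover have "(\<Sum>w\<in>?N. (1 + e w) * q w) = \<phi> q" if "q \<in> topspace (subtopology ?L ?U)" for q
      unfolding \<phi>_def using that
      by (intro sum.mono_neutral_right finite_star_vertices K(1,2) supp_subset_star) auto
    ultimately have "continuous_map (subtopology ?L ?U) euclideanreal \<phi>"
      by (rule continuous_map_eq)
    moreover have "openin ?L ?U"
      by (intro openin_real_less continuous_map_realization_coord K(1,2)) auto
    ultimately show "\<exists>U. openin ?L U \<and> p \<in> U \<and> continuous_map (subtopology ?L U) euclideanreal \<phi>"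
      using p v by (intro exI[of _ ?U]) auto
  qed
  have ge: "c + 1 \<le> \<phi> p" if p: "p \<in> topspace ?L" and c: "\<And>v. p v \<noteq> 0 \<Longrightarrow> c \<le> e v" for p c
  proof -
    have "(c + 1) * sum p (supp p) \<le> \<phi> p"
      unfolding \<phi>_def sum_distrib_left using p iff c by (intro sum_mono mult_right_mono) auto
    then show ?thesis using p iff by simp
  qed
  have comp: "compactin ?L {p \<in> topspace ?L. \<phi> p \<le> c}" for c
  proof -
    let ?S = "{p \<in> topspace ?L. \<phi> p \<le> c}"
    define M where "M = (\<Union>v\<in>{v \<in> V. e v \<le> c}. \<Union>s\<in>{s \<in> K. v \<in> s}. closed_simplex s)"
    have "finite {v \<in> V. e v \<le> c}"
    proof (rule inj_on_finite[of "to_nat_on V" _ "{..nat \<lfloor>c\<rfloor>}"])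
      show "inj_on (to_nat_on V) {v \<in> V. e v \<le> c}" using inj by (rule inj_on_subset) auto
      show "to_nat_on V ` {v \<in> V. e v \<le> c} \<subseteq> {..nat \<lfloor>c\<rfloor>}"
        by (auto simp: e_def le_nat_floor)
    qed auto
    moreover have "finite {s \<in> K. v \<in> s}" if "v \<in> V" for v
      using K(2) that by (auto simp: V_def locally_finite_cplx_def)
    ultimately have "compact M" unfolding M_def
      using simplicial_cplxD(1)[OF K(1)] by (intro compact_UN compact_closed_simplex) auto
    moreover have "M \<subseteq> topspace ?L" by (auto simp: M_def topspace_realization)
    ultimately have "compactin ?L M"
      by (subst realization_eq_top_of_set[OF K(1,2)]) (simp add: compactin_subtopology)
    moreover have "closedin ?L ?S" by (intro closedin_real_le cont) auto
    moreover have "?S \<subseteq> M"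
    proof
      fix p assume p: "p \<in> ?S"
      have "\<not> c + 1 \<le> \<phi> p" using p by auto
      then obtain v where v: "p v \<noteq> 0" "e v < c" using ge[of p c] p by force
      have "supp p \<in> K" "p \<in> closed_simplex (supp p)" using p iff by (auto simp: closed_simplex_def)
      then show "p \<in> M" unfolding M_def V_def using v by (auto intro!: exI[of _ v] bexI[of _ "supp p"])
    qed
    ultimately have "compactin ?L (?S \<inter> M)" "?S \<inter> M = ?S" by (blast intro: closed_Int_compactin)+
    then show ?thesis by simp
  qed
  have "1 \<le> \<phi> p" if "p \<in> topspace ?L" for p
    using ge[OF that, of 0] by (simp add: e_def)
  then show ?thesis using cont comp unfolding exhausting_def by blast
qed

section \<open>Extension to neighbourhoods\<close>

lemma Tietze_unit:
  assumes "normal_space X" "closedin X S" "continuous_map (subtopology X S) euclideanreal f" "f ` S \<subseteq> {0..1}"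
  obtains g where "continuous_map X euclideanreal g" "\<And>x. x \<in> topspace X \<Longrightarrow> 0 \<le> g x \<and> g x \<le> 1" "\<And>x. x \<in> S \<Longrightarrow> g x = f x"
  using Tietze_extension_realinterval[OF assms(1,2) is_interval_cc[of 0 1] _ assms(3,4)]
  by (metis atLeastAtMost_iff atLeastatMost_empty_iff2 image_subset_iff zero_le_one not_le)

text \<open>Each barycentric coordinate extends by itself, but coordinates that are positive at a
  common point must span a simplex. So the extension of the \<open>v\<close>-th one is made to
  vanish off an open set \<open>S v\<close>, and these sets meet only as the simplices of
  \<open>K\<close> permit. Dividing by the sum, where it is positive, then gives
  \<open>H\<close>.\<close>

proposition realization_nbhd_extensor:
  fixes K :: "'v set set"
  assumes K: "simplicial_cplx K" "locally_finite_cplx K"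
    and X: "metrizable_space X" and D: "closedin X D"
    and h: "continuous_map (subtopology X D) (realization K) h"
  obtains U H where "openin X U" "D \<subseteq> U" "continuous_map (subtopology X U) (realization K) H"
    "\<And>x. x \<in> D \<Longrightarrow> H x = h x"
proof -
  let ?L = "realization K"
  note iff = topspace_realization_iff[OF K(1)]
  obtain M d where M: "Metric_space M d" "X = Metric_space.mtopology M d"
    using X metrizable_space_def by blast
  interpret Metric_space M d by fact
  have normal: "normal_space X" using X by (rule metrizable_imp_normal_space)
  have DX: "D \<subseteq> topspace X" using D by (rule closedin_subset)
  have DM: "D \<subseteq> M" using DX M by simp
  have tD: "topspace (subtopology X D) = D" using DX by auto
  have h_in: "h x \<in> topspace ?L" if "x \<in> D" for x
    using continuous_map_image_subset_topspace[OF h] that tD by auto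
  have ch: "continuous_map (subtopology X D) euclideanreal (\<lambda>x. h x v)" for v
    using h continuous_map_realization_iff[OF K] by blast
  have h_le1: "h x v \<le> 1" if "x \<in> D" for x v
  proof (cases "h x v = 0")
    case False
    have "finite (supp (h x))" "sum (h x) (supp (h x)) = 1" "\<forall>w. 0 \<le> h x w"
      using h_in[OF that] iff simplicial_cplxD(1)[OF K(1)] by blast+
    then show ?thesis using member_le_sum[of v "supp (h x)" "h x"] False by auto
  qed simp
  have h_ge0: "0 \<le> h x v" if "x \<in> D" for x v
    using h_in[OF that] iff by blast
  define good where "good v a r \<longleftrightarrow> a \<in> D \<and> 0 < r \<and> (\<forall>y \<in> D \<inter> mball a r. 0 < h y v)" for v a r
  define S where "S v = \<Union>{mball a (r/2) |a r. good v a r}" for v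
  have openS: "openin X (S v)" for v
    unfolding S_def M(2) by (intro openin_Union) auto

  have S2: "x \<in> S v" if "x \<in> D" "0 < h x v" for x v
  proof -
    have "openin (subtopology X D) {y \<in> topspace (subtopology X D). 0 < h y v}"
      by (intro openin_real_less ch) auto
    then obtain W where W: "openin X W" "{y \<in> D. 0 < h y v} = W \<inter> D"
      unfolding tD openin_subtopology by blast
    then have "x \<in> W" using that by blast
    then obtain r where "r > 0" "mball x r \<subseteq> W" using W(1) M(2) openin_mtopology by blast
    then have "good v x r" using W(2) that by (auto simp: good_def)
    moreover have "x \<in> mball x (r/2)" using \<open>r > 0\<close> that DM by auto
    ultimately show ?thesis unfolding S_def by blast
  qed
  have S3: "F \<in> K" if F: "finite F" "F \<noteq> {}" "\<And>v. v \<in> F \<Longrightarrow> x \<in> S v" for F x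
  proof -
    have "\<exists>a r. good v a r \<and> x \<in> mball a (r/2)" if "v \<in> F" for v
      using F(3)[OF that] unfolding S_def by blast
    then obtain a r where ar: "\<And>v. v \<in> F \<Longrightarrow> good v (a v) (r v) \<and> x \<in> mball (a v) (r v / 2)"
      by metis
    \<comment> \<open>Thanks to the halved radii, the centre with the smallest radius lies in all
      the full balls, so \<open>h\<close> at this one centre has every vertex of \<open>F\<close> in
      its support.\<close>
    have "Min (r ` F) \<in> r ` F" using F by (intro Min_in) auto
    then obtain u where u: "u \<in> F" "r u = Min (r ` F)" by auto
    have "0 < h (a u) v" if v: "v \<in> F" for v
    proof -
      have le: "r u \<le> r v" using u v F by simp
      have "x \<in> M" "a u \<in> M" "a v \<in> M" "d (a v) x < r v / 2" "d (a u) x < r u / 2"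
        using ar[OF u(1)] ar[OF v] by simp_all
      then have "d (a v) (a u) < r v"
        using triangle[of "a v" x "a u"] commute[of x "a u"] le by simp
      then have "a u \<in> mball (a v) (r v)" using \<open>a u \<in> M\<close> \<open>a v \<in> M\<close> by auto
      then show ?thesis using ar[OF v] ar[OF u(1)] by (auto simp: good_def)
    qed
    then have "F \<subseteq> supp (h (a u))" by force
    moreover have "supp (h (a u)) \<in> K" using ar[OF u(1)] h_in iff by (auto simp: good_def)
    ultimately show ?thesis using simplicial_cplxD(3)[OF K(1)] F(2) by blast
  qed
  have "\<exists>G. continuous_map X euclideanreal G \<and> (\<forall>x\<in>topspace X. 0 \<le> G x) \<and> (\<forall>x\<in>D. G x = h x v)
          \<and> (\<forall>x\<in>topspace X - S v. G x = 0)" for v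
  proof -
    let ?g = "\<lambda>x. if x \<in> D then h x v else 0"
    have clS: "closedin X (topspace X - S v)" using openS by blast
    have "h x v = 0" if "x \<in> D" "x \<in> topspace X - S v" for x
      using that S2[of x v] h_ge0[of x v] by (auto simp: order_le_less)
    then have A1: "continuous_map (subtopology X (D \<union> (topspace X - S v))) euclideanreal ?g"
      using D clS ch[of v] by (intro continuous_map_closed_Un) auto
    have A2: "?g ` (D \<union> (topspace X - S v)) \<subseteq> {0..1}" using h_ge0 h_le1 by auto
    obtain G where G: "continuous_map X euclideanreal G" "\<And>x. x \<in> topspace X \<Longrightarrow> 0 \<le> G x \<and> G x \<le> 1"
        "\<And>x. x \<in> D \<union> (topspace X - S v) \<Longrightarrow> G x = ?g x"
      using Tietze_unit[OF normal closedin_Un[OF D clS] A1 A2] by blast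
    have "G x = 0" if "x \<in> topspace X - S v" for x
      using G(3)[of x] that S2[of x v] h_ge0[of x v] by (auto simp: order_le_less)
    then show ?thesis using G by (intro exI[of _ G]) auto
  qed
  then obtain G where cG: "\<And>v. continuous_map X euclideanreal (G v)"
    and G0: "\<And>v x. x \<in> topspace X \<Longrightarrow> 0 \<le> G v x" and GD: "\<And>v x. x \<in> D \<Longrightarrow> G v x = h x v"
    and GS: "\<And>v x. x \<in> topspace X - S v \<Longrightarrow> G v x = 0"
    by metis
  define Q where "Q x = {v. G v x \<noteq> 0}" for x
  have QS: "x \<in> S v" if "x \<in> topspace X" "v \<in> Q x" for x v
    using GS that by (auto simp: Q_def)
  \<comment> \<open>Applying \<open>S3\<close> to pairs already confines \<open>Q x\<close> to a
    finite star; only then can \<open>S3\<close> be applied to the whole of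
    \<open>Q x\<close>.\<close>
  have Qstar: "Q x \<subseteq> \<Union>{s \<in> K. v \<in> s}" if "x \<in> topspace X" "v \<in> Q x" for x v
  proof
    fix w assume "w \<in> Q x"
    then have "{v, w} \<in> K" using that QS by (intro S3[of _ x]) auto
    then show "w \<in> \<Union>{s \<in> K. v \<in> s}" by blast
  qed
  have Qfin: "finite (Q x)" if "x \<in> topspace X" for x
    using Qstar[OF that] finite_star_vertices[OF K] by (metis ex_in_conv finite.emptyI finite_subset)
  define U where "U = (\<Union>v. {x \<in> topspace X. 0 < G v x})"
  have U: "x \<in> U \<longleftrightarrow> x \<in> topspace X \<and> Q x \<noteq> {}" for x
    using G0 by (auto simp: U_def Q_def order_less_le) 
  have oU: "openin X U" unfolding U_def using cG by (intro openin_Union) (auto intro!: openin_real_less)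
  define H where "H x v = G v x / (\<Sum>w\<in>Q x. G w x)" for x v
  have sumpos: "0 < (\<Sum>w\<in>Q x. G w x)" if "x \<in> U" for x
    using that U Qfin G0 by (intro sum_pos) (auto simp: Q_def order_less_le)
  have suppH: "supp (H x) = Q x" if "x \<in> U" for x
    using sumpos[OF that] by (auto simp: H_def Q_def)
  have H_in: "H x \<in> topspace ?L" if "x \<in> U" for x
    unfolding iff
  proof (intro conjI allI)
    show "0 \<le> H x v" for v
      using that U G0 sumpos[OF that] unfolding H_def by (intro divide_nonneg_nonneg) auto
    show "supp (H x) \<in> K"
      unfolding suppH[OF that] using that U Qfin QS by (intro S3[of _ x]) auto
    show "sum (H x) (supp (H x)) = 1"
      unfolding suppH[OF that] using sumpos[OF that] by (simp add: H_def sum_divide_distrib[symmetric])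
  qed
  have "continuous_map (subtopology X U) ?L H"
    unfolding continuous_map_realization_iff[OF K]
  proof (intro conjI allI)
    show "H ` topspace (subtopology X U) \<subseteq> topspace ?L" using H_in by auto
    fix v
    show "continuous_map (subtopology X U) euclideanreal (\<lambda>x. H x v)"
    proof (rule continuous_map_local)
      fix x assume "x \<in> topspace (subtopology X U)"
      then have xU: "x \<in> U" and xX: "x \<in> topspace X" by auto
      then obtain u where u: "0 < G u x" by (auto simp: U_def)
      let ?W = "{y \<in> topspace X. 0 < G u y}" and ?N = "\<Union>{s \<in> K. u \<in> s}"
      have WU: "?W \<subseteq> U" by (auto simp: U_def)
      have oW: "openin X ?W" by (intro openin_real_less cG) auto
      have eq: "(\<Sum>w\<in>?N. G w y) = (\<Sum>w\<in>Q y. G w y)" if "y \<in> ?W" for y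
        using that by (intro sum.mono_neutral_right finite_star_vertices K Qstar) (auto simp: Q_def)
      have c: "continuous_map (subtopology X ?W) euclideanreal (G w)" for w
        using cG by (rule continuous_map_from_subtopology)
      have "continuous_map (subtopology X ?W) euclideanreal (\<lambda>y. G v y / (\<Sum>w\<in>?N. G w y))"
      proof (intro continuous_intros c finite_star_vertices K)
        fix y assume "y \<in> topspace (subtopology X ?W)"
        then show "(\<Sum>w\<in>?N. G w y) \<noteq> 0" using eq[of y] sumpos[of y] WU by auto
      qed
      then have "continuous_map (subtopology X ?W) euclideanreal (\<lambda>y. H y v)"
        by (rule continuous_map_eq) (use eq in \<open>auto simp: H_def\<close>)
      moreover have "subtopology (subtopology X U) ?W = subtopology X ?W"
        using WU by (simp add: subtopology_subtopology Int_absorb1)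
      moreover have "openin (subtopology X U) ?W" using oW WU by (meson openin_subset_topspace_eq openin_open_subtopology oU)
      ultimately show "\<exists>W. openin (subtopology X U) W \<and> x \<in> W \<and>
           continuous_map (subtopology (subtopology X U) W) euclideanreal (\<lambda>y. H y v)"
        using u xX by (intro exI[of _ ?W]) auto
    qed
  qed
  moreover have "H x = h x" if "x \<in> D" for x
  proof -
    have "Q x = supp (h x)" using GD[OF that] by (simp add: Q_def)
    moreover have "(\<Sum>w\<in>supp (h x). G w x) = sum (h x) (supp (h x))" using GD[OF that] by simp
    ultimately have "(\<Sum>w\<in>Q x. G w x) = 1" using h_in[OF that] iff by metis
    then show ?thesis using GD[OF that] by (auto simp: H_def)
  qed
  moreover have "D \<subseteq> U"
  proof
    fix x assume x: "x \<in> D"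
    then obtain v where "0 < h x v" using realization_pos_vertex[OF K(1) h_in] by blast
    then show "x \<in> U" using x GD DX by (auto simp: U_def intro!: exI[of _ v])
  qed
  ultimately show ?thesis using that oU by blast
qed

section \<open>From partitions to maps into the suspension\<close>

lemma sum_lt_of_bounds:
  assumes "1 \<le> n" "\<And>i. i < n \<Longrightarrow> \<bar>v i\<bar> < 1 / (2 * real n)"
  shows "l1norm n v < 1/2"
proof -
  have "l1norm n v < (\<Sum>i<n. 1 / (2 * real n))"
    unfolding l1norm_def using assms by (intro sum_strict_mono) (auto simp: lessThan_empty_iff)
  then show ?thesis using assms(1) by simp
qed

text \<open>The part \<open>A1\<close> of \<open>A\<close> sent to the sphere has no
  \<open>L\<close>-component. So the \<open>L\<close>-map is extended in the complement of
  \<open>A1\<close>, from \<open>A - A1\<close> and the intersection of the partitions to a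
  neighbourhood \<open>N2\<close>; the ball map is then forced onto the sphere off
  \<open>N2\<close>.\<close>

proposition ext_dim_le_of_partitions:
  fixes K :: "'v set set" and X :: "'a topology"
  assumes K: "simplicial_cplx K" "locally_finite_cplx K" "countable K"
    and X: "metrizable_space X" and n: "1 \<le> n"
    and part: "\<And>A B :: nat \<Rightarrow> 'a set.
       (\<forall>i\<in>{1..n}. closedin X (A i) \<and> closedin X (B i) \<and> disjnt (A i) (B i)) \<Longrightarrow>
       (\<exists>C :: nat \<Rightarrow> 'a set.
          (\<forall>i\<in>{1..n}. partition_between X (C i) (A i) (B i)) \<and>
          abs_extensor (realization K) (subtopology X (\<Inter>i\<in>{1..n}. C i)))"
  shows "ext_dim_le (realization K) X n"
  unfolding ext_dim_le_def abs_extensor_def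
proof (intro allI impI, elim conjE)
  fix A f
  assume A: "closedin X A" and f: "continuous_map (subtopology X A) (isusp n (realization K)) f"
  let ?L = "realization K"
  obtain \<phi> where ex: "exhausting ?L \<phi>" using exhausting_realization[OF K] by blast
  then have \<phi>: "continuous_map ?L euclideanreal \<phi>" "\<And>p. p \<in> topspace ?L \<Longrightarrow> 1 \<le> \<phi> p"
    by (auto simp: exhausting_def)
  have normal: "normal_space X" using X by (rule metrizable_imp_normal_space)
  have AX: "A \<subseteq> topspace X" using A by (rule closedin_subset)
  have tA: "topspace (subtopology X A) = A" using AX by auto
  have f_in: "f x \<in> topspace (isusp n ?L)" if "x \<in> A" for x
    using continuous_map_image_subset_topspace[OF f] that tA by auto
  have cu: "continuous_map (subtopology X A) euclideanreal (\<lambda>x. coord (f x) i)" for i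
    using continuous_map_compose[OF f continuous_map_coord] by (simp add: o_def)
  have cwt: "continuous_map (subtopology X A) euclideanreal (\<lambda>x. weight (f x))"
    using continuous_map_compose[OF f continuous_map_weight] by (simp add: o_def)
  have nu: "l1norm n (coord (f x)) = 1 - weight (f x)" "0 \<le> weight (f x)" "weight (f x) \<le> 1" if "x \<in> A" for x
    using l1norm_coord[OF f_in] weight_range[OF f_in] that by auto
  define A1 where "A1 = {x \<in> A. weight (f x) = 0}"
  have "closedin (subtopology X A) {x \<in> topspace (subtopology X A). weight (f x) \<le> 0}"
    by (intro closedin_real_le cwt) auto
  moreover have "{x \<in> topspace (subtopology X A). weight (f x) \<le> 0} = A1"
    unfolding tA A1_def using nu(2) by (auto simp: order_antisym)
  ultimately have clA1: "closedin X A1" using A closedin_trans_full by metis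
  have sub_closed: "closedin X {x \<in> A. g x \<le> h x}"
    if "continuous_map (subtopology X A) euclideanreal g" "continuous_map (subtopology X A) euclideanreal h" for g h
    using closedin_real_le[OF that] A closedin_trans_full unfolding tA by blast
  \<comment> \<open>If all coordinates are below \<open>\<delta>\<close> in absolute value, the norm
    is below \<open>1/2\<close>. So the weight of \<open>f\<close> exceeds \<open>1/2\<close> on
    \<open>A \<inter> CC\<close>, while at a point of \<open>A1\<close>, where the norm is 1, some
    coordinate has absolute value at least \<open>\<delta>\<close>.\<close>
  define \<delta> where "\<delta> = 1 / (2 * real n)"
  have \<delta>: "0 < \<delta>" using n by (simp add: \<delta>_def)
  \<comment> \<open>Partitions are numbered from 1, coordinates from 0.\<close>
  define PA where "PA i = {x \<in> A. \<delta> \<le> coord (f x) (i - 1)}" for i :: nat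
  define PB where "PB i = {x \<in> A. coord (f x) (i - 1) \<le> - \<delta>}" for i :: nat
  have "\<forall>i\<in>{1..n}. closedin X (PA i) \<and> closedin X (PB i) \<and> disjnt (PA i) (PB i)"
    unfolding PA_def PB_def using \<delta> by (auto intro!: sub_closed cu simp: disjnt_iff)
  from part[OF this] obtain C where C: "\<And>i. i \<in> {1..n} \<Longrightarrow> partition_between X (C i) (PA i) (PB i)"
    and aeC: "abs_extensor ?L (subtopology X (\<Inter>i\<in>{1..n}. C i))" by blast
  define CC where "CC = (\<Inter>i\<in>{1..n}. C i)"
  have "\<exists>U V. openin X U \<and> openin X V \<and> disjnt U V \<and> topspace X - C (Suc i) = U \<union> V
       \<and> PA (Suc i) \<subseteq> U \<and> PB (Suc i) \<subseteq> V" if "i < n" for i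
    using C[of "Suc i"] that unfolding partition_between_def by auto
  then obtain U V where UV: "\<And>i. i < n \<Longrightarrow> openin X (U i) \<and> openin X (V i) \<and> disjnt (U i) (V i) \<and>
      topspace X - C (Suc i) = U i \<union> V i \<and> PA (Suc i) \<subseteq> U i \<and> PB (Suc i) \<subseteq> V i"
    by metis
  have clC: "closedin X (C (Suc i))" if "i < n" for i
    using C[of "Suc i"] that unfolding partition_between_def by auto
  have CC_eq: "CC = (\<Inter>i\<in>{..<n}. C (Suc i))"
    unfolding CC_def by (metis INT_extend_simps(10) atLeast0LessThan image_Suc_lessThan)
  have clCC: "closedin X CC"
    unfolding CC_eq using n clC by (intro closedin_Inter) (auto simp: lessThan_empty_iff)
  have CCX: "CC \<subseteq> topspace X" using clCC by (rule closedin_subset)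
  have wtCC: "1/2 < weight (f x)" if "x \<in> A" "x \<in> CC" for x
  proof -
    have "\<bar>coord (f x) i\<bar> < \<delta>" if i: "i < n" for i
    proof -
      have "x \<in> C (Suc i)" using \<open>x \<in> CC\<close> i CC_eq by auto
      then have "x \<notin> U i \<union> V i" using UV[OF i] by blast
      then have "x \<notin> PA (Suc i)" "x \<notin> PB (Suc i)" using UV[OF i] by auto
      then show ?thesis using \<open>x \<in> A\<close> by (auto simp: PA_def PB_def)
    qed
    then have "l1norm n (coord (f x)) < 1/2" using n by (intro sum_lt_of_bounds) (auto simp: \<delta>_def)
    then show ?thesis using nu[OF that(1)] by simp
  qed
  have "A - A1 = A \<inter> {x. 0 < weight (f x)}" using nu(2) by (auto simp: A1_def order_less_le)
  then have AA1: "subtopology X (A - A1) = subtopology (subtopology X A) {x. 0 < weight (f x)}"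
    by (simp add: subtopology_subtopology)
  have cbs: "continuous_map (subtopology X (A - A1)) ?L (\<lambda>x. base_pt (f x))"
  proof -
    have "continuous_map (subtopology X (A - A1)) (subtopology (isusp n ?L) {p. 0 < weight p}) f"
      unfolding AA1 by (auto simp: continuous_map_in_subtopology intro: continuous_map_from_subtopology[OF f])
    from continuous_map_compose[OF this continuous_map_base_pt] show ?thesis by (simp add: o_def)
  qed
  have "A \<inter> CC \<subseteq> A - A1" using wtCC by (force simp: A1_def)
  then have "continuous_map (subtopology X (A \<inter> CC)) ?L (\<lambda>x. base_pt (f x))"
    using cbs continuous_map_from_subtopology_mono by blast
  then have "continuous_map (subtopology (subtopology X CC) (A \<inter> CC)) ?L (\<lambda>x. base_pt (f x))"
    by (simp add: subtopology_subtopology Int_absorb1 Int_commute Int_left_commute)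
  moreover have "closedin (subtopology X CC) (A \<inter> CC)" using A by (metis closedin_subtopology)
  ultimately obtain g where g: "continuous_map (subtopology X CC) ?L g" "\<And>x. x \<in> A \<inter> CC \<Longrightarrow> g x = base_pt (f x)"
    using aeC[unfolded abs_extensor_def CC_def[symmetric], rule_format, of "A \<inter> CC" "\<lambda>x. base_pt (f x)"]
    by auto
  \<comment> \<open>In general \<open>A - A1\<close> is closed only relative to the complement of
    \<open>A1\<close>, so the neighbourhood extension is carried out in this subspace.\<close>
  define X' where "X' = subtopology X (topspace X - A1)"
  have mX': "metrizable_space X'" unfolding X'_def using X by (rule metrizable_space_subtopology)
  have tX': "topspace X' = topspace X - A1" by (auto simp: X'_def)
  have oX': "openin X (topspace X - A1)" using clA1 by blast
  have openX': "openin X W \<and> W \<inter> A1 = {}" if "openin X' W" for W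
    using that oX' openin_trans_full[OF that[unfolded X'_def]] openin_subset[OF that] unfolding tX' by auto
  have CA1: "CC \<inter> A1 = {}" using wtCC by (force simp: A1_def)
  define T where "T = (A - A1) \<union> CC"
  have clT1: "closedin X' (A - A1)"
    unfolding X'_def closedin_subtopology using A AX by (intro exI[of _ A]) auto
  have clT2: "closedin X' CC"
    unfolding X'_def closedin_subtopology using clCC CCX CA1 by (intro exI[of _ CC]) auto
  define l0 where "l0 x = (if x \<in> A - A1 then base_pt (f x) else g x)" for x
  have "continuous_map (subtopology X' T) ?L l0"
    unfolding T_def l0_def
  proof (rule continuous_map_closed_Un[OF clT1 clT2])
    have "(topspace X - A1) \<inter> (A - A1) = A - A1" "(topspace X - A1) \<inter> CC = CC"
      using AX CCX CA1 by auto
    then show "continuous_map (subtopology X' (A - A1)) ?L (\<lambda>x. base_pt (f x))" "continuous_map (subtopology X' CC) ?L g"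
      unfolding X'_def using cbs g(1) by (simp_all add: subtopology_subtopology)
    show "base_pt (f x) = g x" if "x \<in> A - A1" "x \<in> CC" for x
      using g(2) that by simp
  qed
  moreover have clT: "closedin X' T" unfolding T_def using clT1 clT2 by blast
  ultimately obtain N H where N: "openin X' N" "T \<subseteq> N" "continuous_map (subtopology X' N) ?L H"
      "\<And>x. x \<in> T \<Longrightarrow> H x = l0 x"
    using realization_nbhd_extensor[OF K(1,2) mX'] by metis
  have oN: "openin X N" "N \<inter> A1 = {}" using openX'[OF N(1)] by auto
  have NX: "N \<subseteq> topspace X" using oN openin_subset by blast
  have "(topspace X - A1) \<inter> N = N" using oN NX by auto
  then have cH: "continuous_map (subtopology X N) ?L H"
    using N(3) unfolding X'_def by (simp add: subtopology_subtopology)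
  have H_in: "H x \<in> topspace ?L" if "x \<in> N" for x
    using continuous_map_image_subset_topspace[OF cH] that NX by auto
  have c\<phi>H: "continuous_map (subtopology X N) euclideanreal (\<lambda>x. \<phi> (H x))"
    using continuous_map_compose[OF cH \<phi>(1)] by (simp add: o_def)
  have openN: "openin X {y \<in> N. \<phi> (H y) < c}" for c
  proof -
    have "openin (subtopology X N) {y \<in> topspace (subtopology X N). \<phi> (H y) < c}"
      by (intro openin_real_less c\<phi>H) auto
    moreover have "topspace (subtopology X N) = N" using NX by auto
    ultimately show ?thesis using oN(1) openin_trans_full by metis
  qed
  \<comment> \<open>Near \<open>A1\<close> the map \<open>H\<close> may leave every compact set. On
    \<open>A\<close> this is excluded by continuity of \<open>f\<close>, which gives a local lower
    bound for \<open>gg\<close>; a continuous positive \<open>s\<close> below \<open>gg\<close> then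
    carries the control over to a neighbourhood.\<close>
  define gg where "gg x = (if x \<in> A1 then 1 else 1 / \<phi> (H x))" for x
  have loc: "\<exists>W e. openin X W \<and> x \<in> W \<and> 0 < e \<and> (\<forall>y \<in> W \<inter> (A \<union> CC). e \<le> gg y)" if x: "x \<in> A \<union> CC" for x
  proof (cases "x \<in> A1")
    case True
    then have "x \<in> topspace (subtopology X A)" "weight (f x) = 0" using tA by (auto simp: A1_def)
    from base_pt_locally_bounded[OF ex metrizable_space_subtopology[OF X] f this]
    obtain W c where W: "openin (subtopology X A) W" "x \<in> W" "\<forall>y\<in>W. 0 < weight (f y) \<longrightarrow> \<phi> (base_pt (f y)) \<le> c"
      by blast
    then obtain W' where W': "openin X W'" "W = W' \<inter> A" unfolding openin_subtopology by blast
    \<comment> \<open>Removing \<open>CC\<close> leaves only points of \<open>A\<close>, for which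
      the bound from \<open>f\<close> is available.\<close>
    let ?W = "W' \<inter> (topspace X - CC)" and ?e = "1 / max 1 c"
    have "?e \<le> gg y" if y: "y \<in> ?W \<inter> (A \<union> CC)" for y
    proof (cases "y \<in> A1")
      case False
      then have yT: "y \<in> A - A1" "y \<in> T" "y \<in> W" using y W' by (auto simp: T_def)
      then have "0 < weight (f y)" using nu(2)[of y] by (auto simp: A1_def order_less_le)
      then have "\<phi> (H y) \<le> c" using W(3) yT N(4) by (simp add: l0_def)
      moreover have "1 \<le> \<phi> (H y)" using \<phi>(2) H_in N(2) yT by blast
      ultimately show ?thesis using False by (simp add: gg_def frac_le)
    qed (simp add: gg_def)
    moreover have "openin X ?W" using W' clCC by blast
    moreover have "x \<in> ?W" using True W W' CA1 AX by (auto simp: A1_def)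
    ultimately show ?thesis by (intro exI[of _ ?W] exI[of _ ?e]) auto
  next
    case False
    then have "x \<in> N" using x N(2) by (auto simp: T_def)
    then have 1: "1 \<le> \<phi> (H x)" using \<phi>(2) H_in by blast
    let ?W = "{y \<in> N. \<phi> (H y) < \<phi> (H x) + 1}" and ?e = "1 / (\<phi> (H x) + 1)"
    have "?e \<le> gg y" if y: "y \<in> ?W" for y
    proof -
      have "1 \<le> \<phi> (H y)" "y \<notin> A1" using \<phi>(2) H_in y oN(2) by auto
      then show ?thesis using y by (simp add: gg_def frac_le)
    qed
    then show ?thesis using openN \<open>x \<in> N\<close> 1 by (intro exI[of _ ?W] exI[of _ ?e]) auto
  qed
  obtain s where s: "continuous_map X euclideanreal s" "\<And>x. x \<in> A \<union> CC \<Longrightarrow> 0 < s x"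
      "\<And>x. x \<in> A \<union> CC \<Longrightarrow> s x \<le> gg x"
    using positive_continuous_minorant[where g = gg, OF X _ loc] AX CCX by blast
  \<comment> \<open>On \<open>T\<close> the product is at most 1, so the bound 2 holds on an open
    set around \<open>T\<close>.\<close>
  define N' where "N' = {x \<in> N. s x * \<phi> (H x) < 2}"
  have oN': "openin X' N'"
  proof -
    have tN: "topspace (subtopology X N) = N" using NX by auto
    have "openin (subtopology X N) {y \<in> topspace (subtopology X N). s y * \<phi> (H y) < 2}"
      by (intro openin_real_less continuous_map_real_mult c\<phi>H continuous_map_from_subtopology[OF s(1)]) auto
    then have "openin X N'" unfolding N'_def tN using oN(1) openin_trans_full by blast
    moreover have "N' \<subseteq> topspace X - A1" using NX oN(2) by (auto simp: N'_def)
    ultimately show ?thesis unfolding X'_def openin_subtopology by blast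
  qed
  have "T \<subseteq> N'"
  proof
    fix x assume x: "x \<in> T"
    then have xN: "x \<in> N" "x \<notin> A1" using N(2) oN(2) by auto
    then have "1 \<le> \<phi> (H x)" using \<phi>(2) H_in by blast
    moreover have "s x \<le> 1 / \<phi> (H x)" using s(3)[of x] x xN by (auto simp: T_def gg_def)
    ultimately have "s x * \<phi> (H x) \<le> 1" by (simp add: field_simps)
    then show "x \<in> N'" using xN by (simp add: N'_def)
  qed
  then obtain N2 where N2: "openin X' N2" "T \<subseteq> N2" "X' closure_of N2 \<subseteq> N'"
    using normal_space_alt[THEN iffD1, OF metrizable_imp_normal_space[OF mX'], rule_format, of T N'] clT oN'
    by metis
  have oN2: "openin X N2" "N2 \<inter> A1 = {}" using openX'[OF N2(1)] by auto
  have N2N': "N2 \<subseteq> N'" using N2 closure_of_subset openin_subset by (metis order_trans)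
  \<comment> \<open>Off \<open>N2\<close> the \<open>L\<close>-map is given up, and the ball map has
    to take values in the sphere. \<open>Z\<close> meets \<open>A\<close> only in \<open>A1\<close>,
    where \<open>f\<close> is on the sphere already.\<close>
  define Z where "Z = topspace X - N2"
  have clZ: "closedin X Z" unfolding Z_def using oN2 by blast
  have AZ: "A \<inter> Z = A1" using N2(2) oN2 AX by (auto simp: Z_def T_def A1_def)
  have CZ: "CC \<inter> Z = {}" using N2(2) by (auto simp: Z_def T_def)
  \<comment> \<open>A function vanishing exactly on \<open>C (Suc i)\<close>, with its sign reversed
    on one side of the partition.\<close>
  have "\<exists>p. continuous_map X euclideanreal p \<and> (\<forall>x\<in>U i. 0 < p x) \<and> (\<forall>x\<in>V i. p x < (0::real))" if i: "i < n" for i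
  proof -
    have UVi: "openin X (U i)" "openin X (V i)" "U i \<inter> V i = {}" "topspace X - C (Suc i) = U i \<union> V i"
      using UV[OF i] by (auto simp: disjnt_def)
    obtain q :: "'a \<Rightarrow> real" where q: "continuous_map X euclideanreal q" "\<And>x. x \<in> C (Suc i) \<Longrightarrow> q x = 0"
      "\<And>x. x \<in> topspace X - C (Suc i) \<Longrightarrow> 0 < q x"
      using closedin_zero_set[OF X clC[OF i]] by metis
    let ?p = "\<lambda>x. if x \<in> topspace X - V i then q x else - q x"
    have cc: "closedin X (topspace X - U i)" "closedin X (topspace X - V i)" using UVi by auto
    have "continuous_map (subtopology X ((topspace X - V i) \<union> (topspace X - U i))) euclideanreal ?p"
    proof (rule continuous_map_closed_Un[OF cc(2,1)])
      fix x assume "x \<in> topspace X - V i" "x \<in> topspace X - U i"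
      then have "x \<in> C (Suc i)" using UVi by blast
      then show "q x = - q x" using q(2) by simp
    qed (use q(1) in \<open>auto intro!: continuous_map_from_subtopology continuous_intros\<close>)
    moreover have "(topspace X - V i) \<union> (topspace X - U i) = topspace X" using UVi by auto
    ultimately have "continuous_map X euclideanreal ?p" by simp
    moreover have "0 < ?p x" if "x \<in> U i" for x
    proof -
      have "x \<in> topspace X - V i" "x \<in> topspace X - C (Suc i)" using that UVi openin_subset[OF UVi(1)] by blast+
      then show ?thesis using q(3) by simp
    qed
    moreover have "?p x < 0" if "x \<in> V i" for x
    proof -
      have "x \<notin> topspace X - V i" "x \<in> topspace X - C (Suc i)" using that UVi by blast+
      then show ?thesis using q(3) by simp
    qed
    ultimately show ?thesis by (intro exI[of _ ?p]) auto
  qed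
  then obtain w0 :: "nat \<Rightarrow> 'a \<Rightarrow> real" where w0: "\<And>i. i < n \<Longrightarrow> continuous_map X euclideanreal (w0 i)"
      "\<And>i x. i < n \<Longrightarrow> x \<in> U i \<Longrightarrow> 0 < w0 i x" "\<And>i x. i < n \<Longrightarrow> x \<in> V i \<Longrightarrow> w0 i x < 0"
    by metis
  have "\<exists>g. continuous_map X euclideanreal g \<and> (\<forall>x\<in>A. g x = coord (f x) i)" for i
    using Tietze_extension_realinterval[OF normal A is_interval_univ _ cu] by (metis UNIV_not_empty subset_UNIV)
  then obtain u where u: "\<And>i. continuous_map X euclideanreal (u i)" "\<And>i x. x \<in> A \<Longrightarrow> u i x = coord (f x) i"
    by metis
  \<comment> \<open>Where \<open>u i\<close> and \<open>w0 i\<close> have the same sign for some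
    \<open>i\<close>, no convex combination of the two vectors vanishes. So \<open>\<tau>\<close>
    can lead from \<open>u\<close> on \<open>A1\<close> to \<open>w0\<close> off \<open>M\<close>
    without creating a zero on \<open>Z\<close>.\<close>
  define M where "M = (\<Union>i\<in>{..<n}. {x \<in> topspace X. 0 < u i x * w0 i x})"
  have oM: "openin X M"
    unfolding M_def using u w0 by (intro openin_Union) (auto intro!: openin_real_less continuous_intros)
  have A1M: "A1 \<subseteq> M"
  proof
    fix x assume x: "x \<in> A1"
    then have xA: "x \<in> A" "x \<in> topspace X" using AX by (auto simp: A1_def)
    have "\<not> l1norm n (coord (f x)) < 1/2" using nu[OF xA(1)] x by (simp add: A1_def)
    then obtain i where i: "i < n" "\<delta> \<le> \<bar>coord (f x) i\<bar>"
      using sum_lt_of_bounds[OF n, of "coord (f x)"] unfolding \<delta>_def by (meson not_le)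
    have "0 < u i x * w0 i x"
    proof (cases "0 \<le> coord (f x) i")
      case True
      then have "x \<in> U i" using i UV[OF i(1)] xA by (auto simp: PA_def)
      then show ?thesis using w0 i True \<delta> u(2) xA by (auto intro!: mult_pos_pos)
    next
      case False
      then have "x \<in> V i" using i UV[OF i(1)] xA by (auto simp: PB_def)
      then show ?thesis using w0 i False \<delta> u(2) xA by (auto intro!: mult_neg_neg)
    qed
    then show "x \<in> M" using i xA by (auto simp: M_def)
  qed
  obtain \<tau> where \<tau>: "continuous_map X (top_of_set {0..1::real}) \<tau>" "\<tau> ` A1 \<subseteq> {0}" "\<tau> ` (topspace X - M) \<subseteq> {1}"
    using Urysohn_lemma[OF normal clA1, of "topspace X - M" 0 1] oM A1M by (auto simp: disjnt_iff)
  then have c\<tau>: "continuous_map X euclideanreal \<tau>" and r\<tau>: "\<And>x. x \<in> topspace X \<Longrightarrow> 0 \<le> \<tau> x \<and> \<tau> x \<le> 1"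
    by (auto simp: continuous_map_in_subtopology)
  define w where "w x i = (1 - \<tau> x) * u i x + \<tau> x * w0 i x" for x i
  have cw: "continuous_map X euclideanreal (\<lambda>x. w x i)" if "i < n" for i
    unfolding w_def using c\<tau> u w0 that by (intro continuous_intros) auto
  have w_nz: "0 < l1norm n (w x)" if x: "x \<in> Z" for x
  proof -
    have xX: "x \<in> topspace X" using x by (simp add: Z_def)
    have "\<exists>i<n. w x i \<noteq> 0"
    proof (cases "x \<in> M")
      case True
      then obtain i where i: "i < n" "0 < u i x * w0 i x" by (auto simp: M_def)
      have "0 < (1 - \<tau> x) * (u i x * u i x) + \<tau> x * (u i x * w0 i x)"
      proof (cases "\<tau> x = 0")
        case True
        then show ?thesis using i by (auto simp: zero_less_mult_iff)
      next
        case False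
        then have "0 < \<tau> x * (u i x * w0 i x)" using i r\<tau>[OF xX] by simp
        moreover have "0 \<le> (1 - \<tau> x) * (u i x * u i x)" using r\<tau>[OF xX] by simp
        ultimately show ?thesis by linarith
      qed
      also have "\<dots> = u i x * w x i" by (simp add: w_def algebra_simps)
      finally show ?thesis using i by (intro exI[of _ i]) auto
    next
      case False
      then have 1: "\<tau> x = 1" using \<tau> xX by auto
      have "x \<notin> CC" using CZ x by auto
      then obtain i where i: "i < n" "x \<notin> C (Suc i)" by (auto simp: CC_eq)
      then have "x \<in> U i \<or> x \<in> V i" using UV xX by blast
      then have "w0 i x \<noteq> 0" using w0 i by (metis order_less_irrefl)
      then show ?thesis using i 1 by (auto simp: w_def)
    qed
    then have "l1norm n (w x) \<noteq> 0" by (auto simp: l1norm_eq_0)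
    then show ?thesis using l1norm_nonneg[of n "w x"] by linarith
  qed
  have wA1: "w x i = coord (f x) i" if "x \<in> A1" for x i
    using \<tau> u that by (auto simp: w_def A1_def image_subset_iff)
  define r0 where "r0 x i = (if x \<in> A then coord (f x) i else w x i / l1norm n (w x))" for x i
  have cr0: "continuous_map (subtopology X (A \<union> Z)) euclideanreal (\<lambda>x. r0 x i)" if i: "i < n" for i
    unfolding r0_def
  proof (rule continuous_map_closed_Un[OF A clZ])
    show "continuous_map (subtopology X A) euclideanreal (\<lambda>x. coord (f x) i)" by (rule cu)
    have c: "continuous_map (subtopology X Z) euclideanreal (\<lambda>x. w x j)" if "j < n" for j
      using cw[OF that] by (rule continuous_map_from_subtopology)
    show "continuous_map (subtopology X Z) euclideanreal (\<lambda>x. w x i / l1norm n (w x))"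
      using w_nz i by (intro continuous_intros continuous_map_l1norm c) force+
    fix x assume "x \<in> A" "x \<in> Z"
    then have x: "x \<in> A1" using AZ by auto
    then have "l1norm n (w x) = l1norm n (coord (f x))" using wA1 by (intro l1norm_cong) auto
    also have "\<dots> = 1" using nu x by (simp add: A1_def)
    finally show "coord (f x) i = w x i / l1norm n (w x)" using wA1[OF x] by simp
  qed
  have "\<exists>g. continuous_map X euclideanreal g \<and> (\<forall>x\<in>A \<union> Z. g x = r0 x i)" if "i < n" for i
    using Tietze_extension_realinterval[OF normal closedin_Un[OF A clZ] is_interval_univ _ cr0[OF that]]
    by (metis UNIV_not_empty subset_UNIV)
  then obtain r1 where r1: "\<And>i. i < n \<Longrightarrow> continuous_map X euclideanreal (r1 i)"
      "\<And>i x. i < n \<Longrightarrow> x \<in> A \<union> Z \<Longrightarrow> r1 i x = r0 x i"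
    by metis
  \<comment> \<open>Division by \<open>m\<close> retracts onto the unit ball and leaves the values
    on \<open>A \<union> Z\<close> fixed, which have norm at most 1.\<close>
  define m where "m x = max 1 (l1norm n (\<lambda>i. r1 i x))" for x
  define r where "r x i = r1 i x / m x" for x i
  have m1: "1 \<le> m x" for x by (simp add: m_def)
  have cm: "continuous_map X euclideanreal m"
    unfolding m_def using r1(1) by (intro continuous_intros continuous_map_l1norm) auto
  have "m x \<noteq> 0" for x using m1[of x] by linarith
  then have cr: "continuous_map X euclideanreal (\<lambda>x. r x i)" if "i < n" for i
    unfolding r_def by (intro continuous_intros r1(1)[OF that] cm)
  have r_le: "l1norm n (r x) \<le> 1" for x
    using m1[of x] unfolding r_def l1norm_divide by (auto simp: m_def divide_le_eq)
  have r0_le: "l1norm n (r0 x) \<le> 1" if "x \<in> A \<union> Z" for x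
  proof (cases "x \<in> A")
    case True
    then have "l1norm n (r0 x) = l1norm n (coord (f x))" by (intro l1norm_cong) (simp add: r0_def)
    then show ?thesis using nu[OF True] by simp
  next
    case False
    then have "l1norm n (r0 x) = l1norm n (\<lambda>i. w x i / l1norm n (w x))" by (intro l1norm_cong) (simp add: r0_def)
    then show ?thesis using w_nz[of x] that False by (simp add: l1norm_divide)
  qed
  have r_eq: "r x i = r0 x i" if "x \<in> A \<union> Z" "i < n" for x i
  proof -
    have "l1norm n (\<lambda>i. r1 i x) = l1norm n (r0 x)" using r1(2) that(1) by (intro l1norm_cong) auto
    then have "m x = 1" using r0_le[OF that(1)] by (simp add: m_def)
    then show ?thesis using r1(2) that by (simp add: r_def)
  qed
  have r_A: "r x i = coord (f x) i" if "x \<in> A" "i < n" for x i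
    using r_eq[of x i] that by (simp add: r0_def)
  have r_Z: "l1norm n (r x) = 1" if "x \<in> Z" for x
  proof (cases "x \<in> A")
    case True
    then have "x \<in> A1" using that AZ by auto
    then have "l1norm n (coord (f x)) = 1" using nu by (simp add: A1_def)
    then show ?thesis using r_A[OF True] l1norm_cong[of n "r x" "coord (f x)"] by simp
  next
    case False
    have "l1norm n (r x) = l1norm n (r0 x)" using that r_eq by (intro l1norm_cong) auto
    also have "\<dots> = l1norm n (\<lambda>i. w x i / l1norm n (w x))"
      using False by (intro l1norm_cong) (simp add: r0_def)
    finally show ?thesis using w_nz[OF that] by (simp add: l1norm_divide)
  qed
  have r_N2: "x \<in> N2" if "x \<in> topspace X" "l1norm n (r x) < 1" for x
    using that r_Z[of x] by (auto simp: Z_def)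
  define F where "F x = join_pt n (H x) (r x)" for x
  have "continuous_map X (isusp n ?L) F"
    unfolding F_def
  proof (rule continuous_map_join_pt[OF ex cr r_le])
    have "topspace X \<inter> {x. l1norm n (r x) < 1} \<subseteq> N" using r_N2 N2N' by (auto simp: N'_def)
    from continuous_map_from_subtopology_mono[OF cH this]
    show "continuous_map (subtopology X {x. l1norm n (r x) < 1}) ?L H"
      using subtopology_restrict by metis
  next
    fix x assume x: "x \<in> topspace X" "l1norm n (r x) = 1"
    \<comment> \<open>Boundedness of \<open>\<phi> (H y)\<close> has three sources: near
      \<open>A1\<close> the function \<open>s\<close> is bounded away from 0; in \<open>N'\<close>
      continuity of \<open>H\<close> suffices; off the closure of \<open>N2\<close> no point has
      norm below 1.\<close>
    consider "x \<in> A1" | "x \<in> N'" | "x \<in> topspace X' - X' closure_of N2"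
      using x(1) N2(3) tX' by blast
    then show "\<exists>W c. openin X W \<and> x \<in> W \<and> (\<forall>y\<in>W. l1norm n (r y) < 1 \<longrightarrow> \<phi> (H y) \<le> c)"
    proof cases
      case 1
      then have sx: "0 < s x" using s(2) by (auto simp: A1_def)
      let ?W = "{y \<in> topspace X. s x / 2 < s y}"
      have "\<phi> (H y) \<le> 4 / s x" if y: "y \<in> ?W" "l1norm n (r y) < 1" for y
      proof -
        have "y \<in> N'" using r_N2 y N2N' by auto
        then have lt: "s y * \<phi> (H y) < 2" and ge: "1 \<le> \<phi> (H y)" using \<phi>(2) H_in by (auto simp: N'_def)
        have "\<phi> (H y) * s x \<le> \<phi> (H y) * (2 * s y)" using y ge by (intro mult_left_mono) auto
        also have "\<dots> = 2 * (s y * \<phi> (H y))" by simp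
        finally have "\<phi> (H y) * s x \<le> 4" using lt by linarith
        then show ?thesis using sx by (simp add: pos_le_divide_eq)
      qed
      moreover have "openin X ?W" by (intro openin_real_less s(1)) auto
      ultimately show ?thesis using sx x by (intro exI[of _ ?W] exI[of _ "4 / s x"]) auto
    next
      case 2
      then have "x \<in> N" by (simp add: N'_def)
      then show ?thesis using openN[of "\<phi> (H x) + 1"]
        by (intro exI[of _ "{y \<in> N. \<phi> (H y) < \<phi> (H x) + 1}"] exI[of _ "\<phi> (H x) + 1"]) auto
    next
      case 3
      let ?W = "topspace X' - X' closure_of N2"
      have "openin X' ?W" by (intro openin_diff) auto
      then have "openin X ?W" using openX' by blast
      moreover have "\<not> l1norm n (r y) < 1" if "y \<in> ?W" for y
        using that r_N2[of y] tX' closure_of_subset[of N2 X'] openin_subset[OF N2(1)] by blast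
      ultimately show ?thesis using 3 by (intro exI[of _ ?W]) auto
    qed
  qed
  moreover have "F x = f x" if x: "x \<in> A" for x
  proof -
    have "F x = join_pt n (H x) (coord (f x))" unfolding F_def using r_A[OF x] by (intro join_pt_cong) auto
    also have "\<dots> = f x"
    proof (rule join_pt_coord[OF f_in[OF x]])
      assume "0 < weight (f x)"
      then have "x \<in> A - A1" using x by (auto simp: A1_def)
      then show "base_pt (f x) = H x" using N(4)[of x] by (simp add: T_def l0_def)
    qed
    finally show ?thesis .
  qed
  ultimately show "\<exists>g. continuous_map X (isusp n ?L) g \<and> (\<forall>x\<in>A. g x = f x)" by blast
qed

section \<open>From maps into the suspension to partitions\<close>

lemma continuous_map_base_pt_comp:
  assumes F: "continuous_map X (isusp n L) F"
  shows "continuous_map (subtopology X {x. 0 < weight (F x)}) L (\<lambda>x. base_pt (F x))"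
proof -
  have "continuous_map (subtopology X {x. 0 < weight (F x)}) (subtopology (isusp n L) {p. 0 < weight p}) F"
    by (auto simp: continuous_map_in_subtopology intro: continuous_map_from_subtopology[OF F])
  from continuous_map_compose[OF this continuous_map_base_pt] show ?thesis by (simp add: o_def)
qed

text \<open>On the set \<open>E\<close> where \<open>r\<close> lies on the sphere any
  \<open>L\<close>-value is allowed, so \<open>r\<close> together with \<open>g\<close> on
  \<open>D\<close> already defines a map into the suspension on \<open>D \<union> E\<close>, to
  which \<open>ae\<close> applies. The boundedness condition follows from continuity of
  \<open>g\<close> at points of \<open>D\<close> and is vacuous near the others.\<close>

lemma suspension_step:
  assumes ex: "exhausting L \<phi>" and ae: "abs_extensor (isusp n L) X"
    and cr: "\<And>i. i < n \<Longrightarrow> continuous_map X euclideanreal (\<lambda>x. r x i)"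
    and r_le: "\<And>x. x \<in> topspace X \<Longrightarrow> l1norm n (r x) \<le> 1"
    and D: "closedin X D" and g: "continuous_map (subtopology X D) L g"
  obtains F where "continuous_map X (isusp n L) F"
    "\<And>x. x \<in> topspace X \<Longrightarrow> l1norm n (r x) = 1 \<Longrightarrow> weight (F x) = 0 \<and> (\<forall>i<n. coord (F x) i = r x i)"
    "\<And>x. x \<in> D \<Longrightarrow> 0 < weight (F x) \<Longrightarrow> base_pt (F x) = g x"
proof -
  define E where "E = {x \<in> topspace X. 1 \<le> l1norm n (r x)}"
  have E: "closedin X E" unfolding E_def by (intro closedin_real_le continuous_map_l1norm cr) auto
  have DX: "D \<subseteq> topspace X" using D by (rule closedin_subset)
  have tD: "topspace (subtopology X D) = D" using DX by auto
  have tS: "topspace (subtopology X (D \<union> E)) = D \<union> E" using DX by (auto simp: E_def)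
  have ltD: "x \<in> D" if "x \<in> D \<union> E" "l1norm n (r x) < 1" for x
    using that by (auto simp: E_def)
  have c\<phi>: "continuous_map (subtopology X D) euclideanreal (\<lambda>x. \<phi> (g x))"
    using continuous_map_compose[OF g, of euclideanreal \<phi>] ex by (simp add: o_def exhausting_def)
  have "continuous_map (subtopology X (D \<union> E)) (isusp n L) (\<lambda>x. join_pt n (g x) (r x))"
  proof (rule continuous_map_join_pt[OF ex])
    show "continuous_map (subtopology X (D \<union> E)) euclideanreal (\<lambda>x. r x i)" if "i < n" for i
      using cr[OF that] by (rule continuous_map_from_subtopology)
    show "l1norm n (r x) \<le> 1" if "x \<in> topspace (subtopology X (D \<union> E))" for x
      using that r_le by auto
    have "(D \<union> E) \<inter> {x. l1norm n (r x) < 1} \<subseteq> D" using ltD by auto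
    from continuous_map_from_subtopology_mono[OF g this]
    show "continuous_map (subtopology (subtopology X (D \<union> E)) {x. l1norm n (r x) < 1}) L g"
      by (simp add: subtopology_subtopology)
  next
    fix x assume "x \<in> topspace (subtopology X (D \<union> E))"
    then have x: "x \<in> D \<union> E" "x \<in> topspace X" using tS by auto
    show "\<exists>W c. openin (subtopology X (D \<union> E)) W \<and> x \<in> W \<and> (\<forall>y\<in>W. l1norm n (r y) < 1 \<longrightarrow> \<phi> (g y) \<le> c)"
    proof (cases "x \<in> D")
      case True
      have "openin (subtopology X D) {y \<in> topspace (subtopology X D). \<phi> (g y) < \<phi> (g x) + 1}"
        by (intro openin_real_less c\<phi>) auto
      then obtain W where W: "openin X W" "{y \<in> D. \<phi> (g y) < \<phi> (g x) + 1} = W \<inter> D"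
        unfolding tD openin_subtopology by blast
      have "openin (subtopology X (D \<union> E)) (W \<inter> (D \<union> E))"
        using W(1) openin_subtopology by blast
      moreover have "\<phi> (g y) \<le> \<phi> (g x) + 1" if "y \<in> W \<inter> (D \<union> E)" "l1norm n (r y) < 1" for y
      proof -
        have "y \<in> {y \<in> D. \<phi> (g y) < \<phi> (g x) + 1}" using that ltD[of y] unfolding W(2) by auto
        then show ?thesis by simp
      qed
      ultimately show ?thesis using True W(2) x
        by (intro exI[of _ "W \<inter> (D \<union> E)"] exI[of _ "\<phi> (g x) + 1"]) auto
    next
      case False
      have "openin (subtopology X (D \<union> E)) ((topspace X - D) \<inter> (D \<union> E))"
        using D openin_subtopology by blast
      then show ?thesis using False x ltD
        by (intro exI[of _ "(topspace X - D) \<inter> (D \<union> E)"] exI[of _ 0]) auto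
    qed
  qed
  with closedin_Un[OF D E]
  have "\<exists>F. continuous_map X (isusp n L) F \<and> (\<forall>x\<in>D \<union> E. F x = join_pt n (g x) (r x))"
    by (intro ae[unfolded abs_extensor_def, rule_format] conjI)
  then obtain F where F: "continuous_map X (isusp n L) F" "\<And>x. x \<in> D \<union> E \<Longrightarrow> F x = join_pt n (g x) (r x)"
    by blast
  show ?thesis
  proof
    show "continuous_map X (isusp n L) F" by fact
  next
    fix x assume x: "x \<in> topspace X" "l1norm n (r x) = 1"
    then have "F x = join_pt n (g x) (r x)" using F(2) by (simp add: E_def)
    then show "weight (F x) = 0 \<and> (\<forall>i<n. coord (F x) i = r x i)"
      using x coord_join_pt_eq[where v = "r x" and l = "g x"] weight_join_pt[where v = "r x" and l = "g x"] by simp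
  next
    fix x assume x: "x \<in> D" "0 < weight (F x)"
    then have "F x = join_pt n (g x) (r x)" "l1norm n (r x) \<le> 1" using F(2) r_le DX by auto
    then show "base_pt (F x) = g x"
      using x weight_join_pt[where v = "r x" and l = "g x"] base_pt_join_pt[where v = "r x" and l = "g x"] by simp
  qed
qed

text \<open>The coordinates of \<open>F\<close> are divided by
  \<open>max (1/2) (1 - weight (F x))\<close>: where the weight is at most \<open>1/2\<close> this
  is the radial projection to the sphere, elsewhere it doubles the coordinates and stays in the
  ball. Feeding the result to \<open>suspension_step\<close> freezes directions on the former
  set.\<close>

lemma tower_step:
  assumes ex: "exhausting L \<phi>" and ae: "abs_extensor (isusp n L) X"
    and F: "continuous_map X (isusp n L) F"
    and D: "closedin X D" and g: "continuous_map (subtopology X D) L g"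
  obtains F' where "continuous_map X (isusp n L) F'"
    "\<And>x. x \<in> topspace X \<Longrightarrow> weight (F x) \<le> 1/2 \<Longrightarrow>
       weight (F' x) = 0 \<and> (\<forall>i<n. coord (F' x) i = coord (F x) i / (1 - weight (F x)))"
    "\<And>x. x \<in> D \<Longrightarrow> 0 < weight (F' x) \<Longrightarrow> base_pt (F' x) = g x"
proof -
  define m where "m x = max (1/2) (1 - weight (F x))" for x
  define r where "r x i = coord (F x) i / m x" for x i
  have m: "0 < m x" for x by (simp add: m_def)
  have cF: "continuous_map X euclideanreal (\<lambda>x. coord (F x) i)" "continuous_map X euclideanreal (\<lambda>x. weight (F x))" for i
    using continuous_map_compose[OF F continuous_map_coord] continuous_map_compose[OF F continuous_map_weight]
    by (simp_all add: o_def)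
  have F_in: "F x \<in> topspace (isusp n L)" if "x \<in> topspace X" for x
    using continuous_map_image_subset_topspace[OF F] that by auto
  have cm: "continuous_map X euclideanreal m" unfolding m_def by (intro continuous_intros cF) auto
  have m0: "m x \<noteq> 0" for x using m[of x] by simp
  have cr: "continuous_map X euclideanreal (\<lambda>x. r x i)" for i
    unfolding r_def by (intro continuous_intros cF cm m0)
  have nr: "l1norm n (r x) = (1 - weight (F x)) / m x" if "x \<in> topspace X" for x
    using m[of x] l1norm_coord[OF F_in[OF that]] unfolding r_def l1norm_divide by simp
  have r_le: "l1norm n (r x) \<le> 1" if "x \<in> topspace X" for x
    using m[of x] unfolding nr[OF that] by (simp add: divide_le_eq) (simp add: m_def)
  obtain F' where F': "continuous_map X (isusp n L) F'"
    "\<And>x. x \<in> topspace X \<Longrightarrow> l1norm n (r x) = 1 \<Longrightarrow> weight (F' x) = 0 \<and> (\<forall>i<n. coord (F' x) i = r x i)"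
    "\<And>x. x \<in> D \<Longrightarrow> 0 < weight (F' x) \<Longrightarrow> base_pt (F' x) = g x"
    using suspension_step[OF ex ae cr r_le D g] by blast
  show ?thesis
  proof
    fix x assume x: "x \<in> topspace X" "weight (F x) \<le> 1/2"
    then have "m x = 1 - weight (F x)" by (simp add: m_def)
    then show "weight (F' x) = 0 \<and> (\<forall>i<n. coord (F' x) i = coord (F x) i / (1 - weight (F x)))"
      using F'(2)[OF x(1)] nr[OF x(1)] m[of x] by (simp add: r_def)
  qed (use F' in auto)
qed

text \<open>Stage \<open>m + 1\<close> treats the pair of a \<open>G j\<close> and a member of \<open>\<C>\<close> that is encoded by \<open>m\<close> under the
  Cantor pairing; there \<open>j \<le> m\<close>, so that \<open>G j\<close> is already available.\<close>

proposition partition_tower: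
  fixes X :: "'a topology" and \<C> :: "('a set \<times> 'a set \<times> ('a \<Rightarrow> 'b)) set"
  assumes ex: "exhausting L \<phi>" and X: "normal_space X" and ae: "abs_extensor (isusp n L) X" and n: "1 \<le> n"
    and \<C>: "countable \<C>" "\<C> \<noteq> {}" "\<forall>(A, E, h) \<in> \<C>. closedin X A \<and> closedin X E"
    and AB: "\<forall>i\<in>{1..n}. closedin X (A i) \<and> closedin X (B i) \<and> disjnt (A i) (B i)"
  obtains C :: "nat \<Rightarrow> 'a set" and Y :: "nat \<Rightarrow> 'a set" and G :: "nat \<Rightarrow> 'a \<Rightarrow> 'b" where
    "\<And>i. i \<in> {1..n} \<Longrightarrow> partition_between X (C i) (A i) (B i)"
    "(\<Inter>i\<in>{1..n}. C i) = (\<Inter>m. Y m)"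
    "\<And>m. closedin X (Y m)" "decseq Y" "\<And>m. continuous_map (subtopology X (Y m)) L (G m)"
    "\<And>j A E h. (A, E, h) \<in> \<C> \<Longrightarrow> continuous_map (subtopology X (E \<inter> Y j)) L h \<Longrightarrow>
       (\<And>x. x \<in> A \<inter> E \<inter> Y j \<Longrightarrow> G j x = h x) \<Longrightarrow>
       \<exists>m\<ge>j. (\<forall>x \<in> A \<inter> Y m. G m x = G j x) \<and> (\<forall>x \<in> E \<inter> Y m. G m x = h x)"
proof -
  have "\<exists>w. continuous_map X euclideanreal w \<and> (\<forall>x\<in>A (Suc i). w x = (1::real)) \<and> (\<forall>x\<in>B (Suc i). w x = -1)"
    if "i < n" for i
  proof -
    have "closedin X (A (Suc i))" "closedin X (B (Suc i))" "disjnt (A (Suc i)) (B (Suc i))"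
      using bspec[OF AB, of "Suc i"] that by auto
    from Urysohn_lemma_alt[OF X this, of 1 "-1"] obtain g :: "'a \<Rightarrow> real"
      where "continuous_map X euclideanreal g" "g ` A (Suc i) \<subseteq> {1}" "g ` B (Suc i) \<subseteq> {-1}" by blast
    then show ?thesis by (intro exI[of _ g]) auto
  qed
  then obtain w :: "nat \<Rightarrow> 'a \<Rightarrow> real" where w: "\<And>i. i < n \<Longrightarrow> continuous_map X euclideanreal (w i)"
    "\<And>i x. i < n \<Longrightarrow> x \<in> A (Suc i) \<Longrightarrow> w i x = 1" "\<And>i x. i < n \<Longrightarrow> x \<in> B (Suc i) \<Longrightarrow> w i x = -1"
    by metis
  \<comment> \<open>Rescaling into the ball. On \<open>A (Suc i)\<close> and
    \<open>B (Suc i)\<close> the value of \<open>w i\<close> is \<open>1\<close> or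
    \<open>-1\<close>, so the vector has norm at least 1 and ends up on the sphere with its signs
    kept.\<close>
  define m0 where "m0 x = max 1 (l1norm n (\<lambda>i. w i x))" for x
  have m0: "1 \<le> m0 x" "m0 x \<noteq> 0" for x using max.cobounded1[of 1 "l1norm n (\<lambda>i. w i x)"] by (auto simp: m0_def)
  define r where "r x i = w i x / m0 x" for x i
  have cm0: "continuous_map X euclideanreal m0"
    unfolding m0_def using w(1) by (intro continuous_intros continuous_map_l1norm) auto
  have cr: "continuous_map X euclideanreal (\<lambda>x. r x i)" if "i < n" for i
    unfolding r_def by (intro continuous_intros w(1)[OF that] cm0 m0(2))
  have nr: "l1norm n (r x) = l1norm n (\<lambda>i. w i x) / m0 x" for x
    using m0(1)[of x] unfolding r_def l1norm_divide by simp
  have r_le: "l1norm n (r x) \<le> 1" for x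
    using m0(1)[of x] unfolding nr by (simp add: divide_le_eq) (simp add: m0_def)
  \<comment> \<open>Stage 0 only brings the ball map into play; its extension problem has empty
    domain.\<close>
  have "continuous_map (subtopology X {}) L (\<lambda>_. undefined)" by (simp add: continuous_map)
  from suspension_step[OF ex ae cr r_le closedin_empty this]
  obtain F0 where F0: "continuous_map X (isusp n L) F0"
    "\<And>x. x \<in> topspace X \<Longrightarrow> l1norm n (r x) = 1 \<Longrightarrow> weight (F0 x) = 0 \<and> (\<forall>i<n. coord (F0 x) i = r x i)"
    by metis
  define Yy where "Yy F = {x \<in> topspace X. 1/2 \<le> weight (F x)}" for F :: "'a \<Rightarrow> 'b susp_pt"
  \<comment> \<open>The last clause is conditional, so that a next stage exists whether or not the
    problem is well posed at this point. \<open>Fm\<close> is the latest stage, \<open>Fj\<close>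
    the earlier one whose base points are to be preserved on \<open>A\<close>.\<close>
  define stp where "stp = (\<lambda>(A, E, h) Fm Fj F'. continuous_map X (isusp n L) F' \<and>
    (\<forall>x\<in>topspace X. weight (Fm x) \<le> 1/2 \<longrightarrow>
       weight (F' x) = 0 \<and> (\<forall>i<n. coord (F' x) i = coord (Fm x) i / (1 - weight (Fm x)))) \<and>
    (Yy Fm \<subseteq> Yy Fj \<longrightarrow> continuous_map (subtopology X (E \<inter> Yy Fm)) L h \<longrightarrow>
      (\<forall>x\<in>A \<inter> E \<inter> Yy Fm. base_pt (Fj x) = h x) \<longrightarrow>
      (\<forall>x\<in>A \<inter> Yy F'. base_pt (F' x) = base_pt (Fj x)) \<and> (\<forall>x\<in>E \<inter> Yy F'. base_pt (F' x) = h x)))"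
  have clY: "closedin X (Yy F)" if "continuous_map X (isusp n L) F" for F
    using continuous_map_compose[OF that continuous_map_weight] unfolding Yy_def
    by (intro closedin_real_le) (auto simp: o_def)
  have cbs: "continuous_map (subtopology X (Yy F)) L (\<lambda>x. base_pt (F x))" if "continuous_map X (isusp n L) F" for F
    by (rule continuous_map_from_subtopology_mono[OF continuous_map_base_pt_comp[OF that]]) (auto simp: Yy_def)
  have stp_ex: "\<exists>F'. stp c Fm Fj F'"
    if c: "c \<in> \<C>" and Fm: "continuous_map X (isusp n L) Fm" and Fj: "continuous_map X (isusp n L) Fj" for c Fm Fj
  proof -
    obtain A E h where c_eq: "c = (A, E, h)" using prod_cases3 by blast
    then have AE: "closedin X A" "closedin X E" using \<C>(3) c by auto
    show ?thesis
    proof (cases "Yy Fm \<subseteq> Yy Fj \<and> continuous_map (subtopology X (E \<inter> Yy Fm)) L h \<and>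
        (\<forall>x\<in>A \<inter> E \<inter> Yy Fm. base_pt (Fj x) = h x)")
      case True
      let ?D = "(E \<inter> Yy Fm) \<union> (A \<inter> Yy Fm)" and ?g = "\<lambda>x. if x \<in> E \<inter> Yy Fm then h x else base_pt (Fj x)"
      have cD: "closedin X (E \<inter> Yy Fm)" "closedin X (A \<inter> Yy Fm)" using AE clY[OF Fm] by auto
      have "continuous_map (subtopology X (A \<inter> Yy Fm)) L (\<lambda>x. base_pt (Fj x))"
        by (rule continuous_map_from_subtopology_mono[OF cbs[OF Fj]]) (use True in auto)
      then have "continuous_map (subtopology X ?D) L ?g"
        using True by (intro continuous_map_closed_Un cD) auto
      from tower_step[OF ex ae Fm closedin_Un[OF cD] this] obtain F' where F':
        "continuous_map X (isusp n L) F'"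
        "\<And>x. x \<in> topspace X \<Longrightarrow> weight (Fm x) \<le> 1/2 \<Longrightarrow>
          weight (F' x) = 0 \<and> (\<forall>i<n. coord (F' x) i = coord (Fm x) i / (1 - weight (Fm x)))"
        "\<And>x. x \<in> ?D \<Longrightarrow> 0 < weight (F' x) \<Longrightarrow> base_pt (F' x) = ?g x" by blast
      have YY: "x \<in> Yy Fm" "0 < weight (F' x)" if "x \<in> Yy F'" for x
        using F'(2)[of x] that by (cases "weight (Fm x) \<le> 1/2"; force simp: Yy_def)+
      have "base_pt (F' x) = base_pt (Fj x)" if "x \<in> A \<inter> Yy F'" for x
        using F'(3)[of x] YY[of x] that True by auto
      moreover have "base_pt (F' x) = h x" if "x \<in> E \<inter> Yy F'" for x
        using F'(3)[of x] YY[of x] that by auto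
      ultimately have "stp c Fm Fj F'" unfolding stp_def c_eq using F'(1,2) by auto
      then show ?thesis by blast
    next
      case False
      have "continuous_map (subtopology X {}) L h" by (simp add: continuous_map)
      from tower_step[OF ex ae Fm closedin_empty this] obtain F' where F':
        "continuous_map X (isusp n L) F'"
        "\<And>x. x \<in> topspace X \<Longrightarrow> weight (Fm x) \<le> 1/2 \<Longrightarrow>
          weight (F' x) = 0 \<and> (\<forall>i<n. coord (F' x) i = coord (Fm x) i / (1 - weight (Fm x)))" by metis
      have "stp c Fm Fj F'" unfolding stp_def c_eq using F' False by auto
      then show ?thesis by blast
    qed
  qed
  define c where "c m = from_nat_into \<C> (fst (prod_decode m))" for m
  define jj where "jj m = snd (prod_decode m)" for m
  have jj: "jj m \<le> m" for m
    unfolding jj_def by (metis le_prod_encode_2 prod.collapse prod_decode_inverse)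
  have c_in: "c m \<in> \<C>" for m unfolding c_def using \<C>(2) by (rule from_nat_into)
  \<comment> \<open>Choice runs over whole histories \<open>s\<close>, since the step to stage
    \<open>m + 1\<close> refers to stage \<open>jj m\<close> and not just to stage
    \<open>m\<close>.\<close>
  define P where "P m s \<longleftrightarrow> s 0 = F0 \<and> (\<forall>j\<le>m. continuous_map X (isusp n L) (s j))"
    for m :: nat and s :: "nat \<Rightarrow> 'a \<Rightarrow> 'b susp_pt"
  define Q where "Q m s s' \<longleftrightarrow> (\<forall>j\<le>m. s' j = s j) \<and> stp (c m) (s m) (s (jj m)) (s' (Suc m))"
    for m :: nat and s s' :: "nat \<Rightarrow> 'a \<Rightarrow> 'b susp_pt"
  have "\<exists>f. \<forall>m. P m (f m) \<and> Q m (f m) (f (Suc m))"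
  proof (rule dependent_nat_choice)
    show "\<exists>s. P 0 s" using F0(1) by (intro exI[of _ "\<lambda>_. F0"]) (simp add: P_def)
  next
    fix s m assume s: "P m s"
    then have "continuous_map X (isusp n L) (s m)" "continuous_map X (isusp n L) (s (jj m))"
      using jj by (auto simp: P_def)
    from stp_ex[OF c_in this] obtain F' where F': "stp (c m) (s m) (s (jj m)) F'" by blast
    then have "continuous_map X (isusp n L) F'" by (auto simp: stp_def split: prod.splits)
    then have "P (Suc m) (s(Suc m := F'))" using s by (auto simp: P_def le_Suc_eq)
    moreover have "Q m s (s(Suc m := F'))" using F' by (auto simp: Q_def)
    ultimately show "\<exists>s'. P (Suc m) s' \<and> Q m s s'" by blast
  qed
  then obtain f where f: "\<And>m. P m (f m)" "\<And>m. Q m (f m) (f (Suc m))" by blast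
  define F where "F m = f m m" for m
  have fF: "f m j = F j" if "j \<le> m" for m j
    using that
  proof (induction m rule: dec_induct)
    case (step m)
    then show ?case using f(2)[of m] by (simp add: Q_def)
  qed (simp add: F_def)
  have F_0: "F 0 = F0" using f(1)[of 0] by (simp add: P_def F_def)
  have cF: "continuous_map X (isusp n L) (F m)" for m using f(1)[of m] by (simp add: P_def F_def)
  have stpF: "stp (c m) (F m) (F (jj m)) (F (Suc m))" for m
    using f(2)[of m] jj[of m] by (simp add: Q_def fF)
  have F_in: "F m x \<in> topspace (isusp n L)" if "x \<in> topspace X" for m x
    using continuous_map_image_subset_topspace[OF cF] that by auto
  have F_Suc: "weight (F (Suc m) x) = 0" "\<And>i. i < n \<Longrightarrow> coord (F (Suc m) x) i = coord (F m x) i / (1 - weight (F m x))"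
    if "x \<in> topspace X" "weight (F m x) \<le> 1/2" for m x
    using stpF[of m] that by (auto simp: stp_def split: prod.splits)
  have stable: "weight (F m x) \<le> 1/2 \<and> (\<forall>i<n. sgn (coord (F m x) i) = sgn (coord (F j x) i))"
    if "j \<le> m" "x \<in> topspace X" "weight (F j x) \<le> 1/2" for j m x
    using that(1)
  proof (induction m rule: dec_induct)
    case (step m)
    then have "0 < 1 - weight (F m x)" by linarith
    then have "sgn (coord (F m x) i / (1 - weight (F m x))) = sgn (coord (F m x) i)" for i
      by (simp add: sgn_if divide_simps)
    then show ?case using F_Suc[OF that(2), of m] step by auto
  qed (use that in auto)
  \<comment> \<open>Strict inequalities make the unions open. Once the weight is at most
    \<open>1/2\<close>, \<open>stable\<close> fixes the signs for all later stages; comparing two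
    stages at the later one shows that \<open>U i\<close> and \<open>V i\<close> are
    disjoint.\<close>
  define U where "U i = (\<Union>m. {x \<in> topspace X. weight (F m x) < 1/2} \<inter> {x \<in> topspace X. 0 < coord (F m x) i})" for i
  define V where "V i = (\<Union>m. {x \<in> topspace X. weight (F m x) < 1/2} \<inter> {x \<in> topspace X. coord (F m x) i < 0})" for i
  define C where "C i = topspace X - (U (i - 1) \<union> V (i - 1))" for i
  have cc: "continuous_map X euclideanreal (\<lambda>x. coord (F m x) i)" "continuous_map X euclideanreal (\<lambda>x. weight (F m x))" for m i
    using continuous_map_compose[OF cF continuous_map_coord] continuous_map_compose[OF cF continuous_map_weight]
    by (simp_all add: o_def)
  have oUV: "openin X (U i)" "openin X (V i)" for i
    unfolding U_def V_def
    by (rule openin_Union; clarify; intro openin_Int openin_real_less cc continuous_map_const[THEN iffD2]; simp)+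
  have UVX: "U i \<union> V i \<subseteq> topspace X" for i by (auto simp: U_def V_def)
  have dUV: "disjnt (U i) (V i)" if "i < n" for i
    unfolding disjnt_iff
  proof (intro allI notI)
    fix x assume "x \<in> U i \<and> x \<in> V i"
    then obtain m m' where m: "x \<in> topspace X" "weight (F m x) < 1/2" "0 < coord (F m x) i"
        "weight (F m' x) < 1/2" "coord (F m' x) i < 0"
      by (auto simp: U_def V_def)
    have "sgn (coord (F m x) i) = sgn (coord (F (max m m') x) i)" "sgn (coord (F m' x) i) = sgn (coord (F (max m m') x) i)"
      using stable[of m "max m m'" x] stable[of m' "max m m'" x] m that by auto
    then show False using m by simp
  qed
  have AX: "A (Suc i) \<subseteq> topspace X" "B (Suc i) \<subseteq> topspace X" if "i < n" for i
    using bspec[OF AB, of "Suc i"] that closedin_subset by auto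
  have F0_AB: "weight (F 0 x) = 0 \<and> coord (F 0 x) i = w i x / m0 x" if i: "i < n" and x: "x \<in> A (Suc i) \<union> B (Suc i)" for i x
  proof -
    have "\<bar>w i x\<bar> = 1" using w(2,3) i x by auto
    then have "1 \<le> l1norm n (\<lambda>i. w i x)" using abs_le_l1norm[OF i, of "\<lambda>i. w i x"] by simp
    then have "l1norm n (r x) = 1" unfolding nr by (simp add: m0_def)
    then show ?thesis using F0(2)[of x] AX[OF i] x i by (auto simp: F_0 r_def)
  qed
  have part: "partition_between X (C i) (A i) (B i)" if "i \<in> {1..n}" for i
  proof -
    obtain k where k: "i = Suc k" "k < n" using \<open>i \<in> {1..n}\<close> by (cases i) auto
    have "A i \<subseteq> U k"
    proof
      fix x assume x: "x \<in> A i"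
      then have "0 < coord (F 0 x) k" "weight (F 0 x) < 1/2" "x \<in> topspace X"
        using F0_AB[of k x] w(2)[of k x] k m0(1)[of x] AX by auto
      then show "x \<in> U k" unfolding U_def by blast
    qed
    moreover have "B i \<subseteq> V k"
    proof
      fix x assume x: "x \<in> B i"
      then have "coord (F 0 x) k < 0" "weight (F 0 x) < 1/2" "x \<in> topspace X"
        using F0_AB[of k x] w(3)[of k x] k m0(1)[of x] AX by auto
      then show "x \<in> V k" unfolding V_def by blast
    qed
    moreover have "topspace X - C i = U k \<union> V k" using UVX k by (auto simp: C_def)
    moreover have "closedin X (C i)" unfolding C_def using oUV by blast
    ultimately show ?thesis
      unfolding partition_between_def using oUV[of k] dUV[OF k(2)]
      by (intro conjI exI[of _ "U k"] exI[of _ "V k"])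
  qed
  have "(\<Inter>i\<in>{1..n}. C i) = (\<Inter>m. Yy (F m))"
  proof (intro equalityI subsetI)
    fix x assume x: "x \<in> (\<Inter>i\<in>{1..n}. C i)"
    then have "x \<in> C 1" using n by auto
    then have xX: "x \<in> topspace X" by (simp add: C_def)
    \<comment> \<open>A smaller weight means norm above \<open>1/2\<close>, hence a nonzero
      coordinate, whose sign puts \<open>x\<close> into some \<open>U i\<close> or
      \<open>V i\<close>.\<close>
    have "1/2 \<le> weight (F m x)" for m
    proof (rule ccontr)
      assume less: "\<not> 1/2 \<le> weight (F m x)"
      then have "l1norm n (coord (F m x)) \<noteq> 0" using l1norm_coord[OF F_in[OF xX]] by simp
      then obtain i where i: "i < n" "coord (F m x) i \<noteq> 0" by (auto simp: l1norm_eq_0)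
      have "x \<in> U i \<union> V i"
      proof (cases "0 < coord (F m x) i")
        case True
        then have "x \<in> U i" using less xX unfolding U_def by (intro UN_I[of m]) auto
        then show ?thesis ..
      next
        case False
        then have "x \<in> V i" using less xX i(2) unfolding V_def by (intro UN_I[of m]) auto
        then show ?thesis ..
      qed
      moreover have "x \<in> C (Suc i)" using x i by auto
      ultimately show False by (simp add: C_def)
    qed
    then show "x \<in> (\<Inter>m. Yy (F m))" using xX by (simp add: Yy_def)
  next
    fix x assume "x \<in> (\<Inter>m. Yy (F m))"
    then have "x \<in> Yy (F m)" for m by blast
    then have "x \<in> topspace X" "\<And>m. \<not> weight (F m x) < 1/2" by (simp_all add: Yy_def not_less)
    then show "x \<in> (\<Inter>i\<in>{1..n}. C i)" by (simp add: C_def U_def V_def)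
  qed
  moreover have dec: "decseq (\<lambda>m. Yy (F m))"
    unfolding decseq_Suc_iff
  proof (intro allI subsetI)
    fix m x assume "x \<in> Yy (F (Suc m))"
    then show "x \<in> Yy (F m)" using F_Suc[of x m] by (fastforce simp: Yy_def)
  qed
  moreover have "\<exists>m\<ge>j. (\<forall>x \<in> A \<inter> Yy (F m). base_pt (F m x) = base_pt (F j x)) \<and> (\<forall>x \<in> E \<inter> Yy (F m). base_pt (F m x) = h x)"
    if "(A, E, h) \<in> \<C>" and h: "continuous_map (subtopology X (E \<inter> Yy (F j))) L h"
      and agree: "\<And>x. x \<in> A \<inter> E \<inter> Yy (F j) \<Longrightarrow> base_pt (F j x) = h x" for j A E h
  proof -
    obtain k where k: "from_nat_into \<C> k = (A, E, h)"
      using \<C>(1) \<open>(A, E, h) \<in> \<C>\<close> from_nat_into_surj by metis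
    \<comment> \<open>\<open>k\<close> numbers the problem and \<open>j\<close> the stage whose
      values are to be preserved; it is solved at stage \<open>Suc m\<close>.\<close>
    define m where "m = prod_encode (k, j)"
    have m: "c m = (A, E, h)" "jj m = j" by (simp_all add: c_def jj_def m_def k)
    have jm: "j \<le> m" using jj[of m] m by simp
    then have sub: "Yy (F m) \<subseteq> Yy (F j)" using dec by (simp add: decseq_def)
    then have "E \<inter> Yy (F m) \<subseteq> E \<inter> Yy (F j)" by auto
    from continuous_map_from_subtopology_mono[OF h this]
    have "(\<forall>x \<in> A \<inter> Yy (F (Suc m)). base_pt (F (Suc m) x) = base_pt (F j x)) \<and> (\<forall>x \<in> E \<inter> Yy (F (Suc m)). base_pt (F (Suc m) x) = h x)"
      using stpF[of m] sub agree unfolding m stp_def by auto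
    then show ?thesis using jm by (intro exI[of _ "Suc m"]) auto
  qed
  ultimately show ?thesis using that[of C "\<lambda>m. Yy (F m)" "\<lambda>m x. base_pt (F m x)"] part clY[OF cF] cbs[OF cF] by blast
qed

section \<open>Extension problems given by finite data\<close>

text \<open>\<open>u s k\<close> is a bump around a point \<open>s\<close> of a countable dense set:
  1 within \<open>1 / (k + 1)\<close> of \<open>s\<close>, 0 beyond \<open>2 / (k + 1)\<close>. If
  \<open>s\<close> is that close to \<open>x\<close>, the bump is positive only within
  \<open>3 / (k + 1)\<close> of \<open>x\<close>. The zero function keeps later subfamilies
  nonempty.\<close>

lemma countable_separating_family:
  assumes "metrizable_space X" "separable_space X"
  obtains \<U> :: "('a \<Rightarrow> real) set" where "countable \<U>" "(\<lambda>_. 0) \<in> \<U>"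
    "\<And>u. u \<in> \<U> \<Longrightarrow> continuous_map X euclideanreal u" "\<And>u x. u \<in> \<U> \<Longrightarrow> 0 \<le> u x"
    "\<And>x W. openin X W \<Longrightarrow> x \<in> W \<Longrightarrow> \<exists>u\<in>\<U>. u x = 1 \<and> (\<forall>y\<in>topspace X. 0 < u y \<longrightarrow> y \<in> W)"
proof -
  obtain M d where M: "Metric_space M d" "X = Metric_space.mtopology M d"
    using assms(1) metrizable_space_def by blast
  interpret Metric_space M d by fact
  obtain S where S: "countable S" "S \<subseteq> M" "mtopology closure_of S = M"
    using assms(2) unfolding separable_space_def M(2) by auto
  define u where "u s k y = max 0 (min 1 (2 - (real k + 1) * d s y))" for s and k :: nat and y
  show ?thesis
  proof
    let ?U = "insert (\<lambda>_. 0) ((\<lambda>(s,k). u s k) ` (S \<times> UNIV))"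
    show "countable ?U" using S(1) by auto
    show "(\<lambda>_. 0) \<in> ?U" by simp
    have "continuous_map X euclideanreal (d s)" if "s \<in> S" for s
      unfolding M(2) using that S(2)
      by (intro continuous_map_nonexpansive) (metis commute subsetD triangle)
    then have "continuous_map X euclideanreal (u s k)" if "s \<in> S" for s k
      unfolding u_def using that by (intro continuous_intros) auto
    then show "continuous_map X euclideanreal v" if "v \<in> ?U" for v using that by auto
    show "0 \<le> v x" if "v \<in> ?U" for v x using that by (auto simp: u_def)
    fix x W assume W: "openin X W" "x \<in> W"
    then have xM: "x \<in> M" using openin_mtopology M(2) by blast
    obtain r where r: "r > 0" "mball x r \<subseteq> W" using W M(2) openin_mtopology by blast
    obtain k :: nat where "3 / r < real k" using reals_Archimedean2 by blast
    then have k: "3 / (real k + 1) < r" using r(1) by (simp add: field_simps)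
    have "x \<in> mtopology closure_of S" using S(3) xM by simp
    then have "\<exists>s\<in>S. s \<in> mball x (1 / (real k + 1))"
      unfolding metric_closure_of by simp
    then obtain s where s: "s \<in> S" "s \<in> mball x (1 / (real k + 1))" by blast
    then have sx: "(real k + 1) * d s x < 1" "s \<in> M" using commute[of s x] by (auto simp: field_simps)
    have "y \<in> W" if y: "y \<in> topspace X" "0 < u s k y" for y
    proof -
      have yM: "y \<in> M" using y M by simp
      have "(real k + 1) * d s y < 2" using y(2) by (auto simp: u_def)
      moreover have "d x y \<le> d s x + d s y" using triangle[of x s y] xM sx(2) yM commute[of x s] by simp
      then have "(real k + 1) * d x y \<le> (real k + 1) * (d s x + d s y)" by (intro mult_left_mono) auto
      ultimately have "(real k + 1) * d x y < 3" using sx(1) by (simp add: distrib_left)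
      then have "d x y < 3 / (real k + 1)" by (simp add: pos_less_divide_eq mult.commute)
      then have "d x y < r" using k by simp
      then show ?thesis using r(2) xM yM by auto
    qed
    moreover have "u s k x = 1" using sx(1) by (simp add: u_def)
    ultimately show "\<exists>u\<in>?U. u x = 1 \<and> (\<forall>y\<in>topspace X. 0 < u y \<longrightarrow> y \<in> W)"
      using s(1) by (intro bexI[of _ "u s k"]) auto
  qed
qed

text \<open>In the application the \<open>a i\<close> vanish on the domain \<open>D\<close> of a map to be extended and their sets
  \<open>a i = 1\<close> cover the complement, while the \<open>b j\<close> do the same for \<open>D\<close>. The condition
  \<open>\<forall>i\<le>j. a i x \<le> 1/3\<close> keeps \<open>aset X k a\<close> disjoint from what the \<open>b j\<close> with \<open>k \<le> j + 1\<close> contribute, so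
  that on \<open>aset X k a\<close> a finite amount of data decides.\<close>

definition aset :: "'a topology \<Rightarrow> nat \<Rightarrow> (nat \<Rightarrow> 'a \<Rightarrow> real) \<Rightarrow> 'a set" where
  "aset X k a = {x \<in> topspace X. \<exists>i<k. 2/3 \<le> a i x}"

definition eset :: "'a topology \<Rightarrow> nat \<Rightarrow> (nat \<Rightarrow> 'a \<Rightarrow> real) \<Rightarrow> (nat \<Rightarrow> 'a \<Rightarrow> real) \<Rightarrow> 'a set" where
  "eset X k a b = {x \<in> topspace X. \<exists>j<k. 1/2 \<le> b j x \<and> (\<forall>i\<le>j. a i x \<le> 1/3)}"

text \<open>The factors \<open>1 - \<beta>\<close> turn the functions \<open>\<beta> j = min 1 (2 * b j)\<close> into a partition of unity
  on the set where one of the first \<open>k\<close> of them is 1, without using the later ones.\<close>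

definition pou :: "(nat \<Rightarrow> 'a \<Rightarrow> real) \<Rightarrow> nat \<Rightarrow> 'a \<Rightarrow> real" where
  "pou b j x = min 1 (2 * b j x) * (\<Prod>i<j. 1 - min 1 (2 * b i x))"

text \<open>The canonical map to the nerve of the sets \<open>0 < b j\<close>, with each index
  \<open>j\<close> replaced by a vertex \<open>l j\<close>; the weights of indices with equal labels
  add up.\<close>

definition hmap :: "nat \<Rightarrow> (nat \<Rightarrow> 'a \<Rightarrow> real) \<Rightarrow> (nat \<Rightarrow> 'v) \<Rightarrow> 'a \<Rightarrow> 'v \<Rightarrow> real" where
  "hmap k b l x v = (\<Sum>j<k. of_bool (l j = v) * pou b j x)"

text \<open>Telescoping: \<open>pou b j\<close> is the difference of two consecutive partial
  products.\<close>

lemma sum_pou: "(\<Sum>j<k. pou b j x) = 1 - (\<Prod>i<k. 1 - min 1 (2 * b i x))"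
  by (induction k) (simp_all add: pou_def algebra_simps)

lemma sum_pou_eq_1:
  assumes "j < k" "1/2 \<le> b j x"
  shows "(\<Sum>j<k. pou b j x) = 1"
proof -
  have "1 - min 1 (2 * b j x) = 0" using assms(2) by simp
  then have "(\<Prod>i<k. 1 - min 1 (2 * b i x)) = 0" using assms(1) by (intro prod_zero) auto
  then show ?thesis by (simp add: sum_pou)
qed

lemma pou_nonneg: "(\<And>i. 0 \<le> b i x) \<Longrightarrow> 0 \<le> pou b j x"
  unfolding pou_def by (intro mult_nonneg_nonneg prod_nonneg) auto

lemma pou_later: "i < j \<Longrightarrow> 1/2 \<le> b i x \<Longrightarrow> pou b j x = 0"
proof -
  assume "i < j" "1/2 \<le> b i x"
  then have "(\<Prod>i<j. 1 - min 1 (2 * b i x)) = 0" by (intro prod_zero bexI[of _ i]) auto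
  then show ?thesis by (simp add: pou_def)
qed

text \<open>After an index \<open>j\<close> with \<open>1/2 \<le> b j x\<close> all further terms
  \<open>pou b i x\<close> vanish.\<close>

lemma hmap_mono:
  assumes "x \<in> eset X k a b" "k \<le> m"
  shows "hmap m b l x = hmap k b l x"
proof
  fix v
  obtain j where j: "j < k" "1/2 \<le> b j x" using assms(1) by (auto simp: eset_def)
  show "hmap m b l x v = hmap k b l x v"
    unfolding hmap_def using assms(2) pou_later[of j _ b x] j
    by (intro sum.mono_neutral_right) auto
qed

lemma hmap_in_simplex:
  assumes x: "x \<in> eset X k a b" and b0: "\<And>i. 0 \<le> b i x"
    and s: "finite s" "\<And>j. 0 < b j x \<Longrightarrow> l j \<in> s"
  shows "hmap k b l x \<in> closed_simplex s"
proof -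
  have p0: "0 \<le> pou b j x" for j using b0 by (rule pou_nonneg)
  have ps: "l j \<in> s" if "pou b j x \<noteq> 0" for j
  proof -
    have "b j x \<noteq> 0" using that by (auto simp: pou_def)
    then show ?thesis using b0[of j] s(2)[of j] by simp
  qed
  have "(\<Sum>v\<in>s. hmap k b l x v) = (\<Sum>j<k. \<Sum>v\<in>s. of_bool (l j = v) * pou b j x)"
    unfolding hmap_def by (rule sum.swap)
  also have "\<dots> = (\<Sum>j<k. pou b j x)"
  proof (rule sum.cong)
    fix j
    have "(\<Sum>v\<in>s. of_bool (l j = v) * pou b j x) = (\<Sum>v\<in>s. if v = l j then pou b j x else 0)"
      by (intro sum.cong) auto
    also have "\<dots> = pou b j x" using s(1) ps[of j] by (auto simp: sum.delta)
    finally show "(\<Sum>v\<in>s. of_bool (l j = v) * pou b j x) = pou b j x" .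
  qed simp
  also have "\<dots> = 1" using x by (auto simp: eset_def intro: sum_pou_eq_1)
  finally have "(\<Sum>v\<in>s. hmap k b l x v) = 1" .
  moreover have "0 \<le> hmap k b l x v" for v
    unfolding hmap_def using p0 by (intro sum_nonneg) auto
  moreover have "hmap k b l x v = 0" if "v \<notin> s" for v
    unfolding hmap_def using ps that by (intro sum.neutral) auto
  ultimately show ?thesis by (simp add: closed_simplex_def)
qed

lemma continuous_map_hmap:
  assumes "\<And>j. continuous_map X euclideanreal (b j)"
  shows "continuous_map X euclideanreal (\<lambda>x. hmap k b l x v)"
  unfolding hmap_def pou_def using assms by (intro continuous_intros) auto

lemma closedin_aset:
  assumes a: "\<And>i. i < k \<Longrightarrow> continuous_map X euclideanreal (a i)"
  shows "closedin X (aset X k a)"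
proof -
  have "aset X k a = (\<Union>i\<in>{..<k}. {x \<in> topspace X. 2/3 \<le> a i x})"
    by (auto simp: aset_def)
  moreover have "closedin X {x \<in> topspace X. 2/3 \<le> a i x}" if "i < k" for i
    using a[OF that] by (intro closedin_real_le) auto
  ultimately show ?thesis by (simp only:) (rule closedin_Union, auto)
qed

lemma closedin_eset:
  assumes a: "\<And>i. i < k \<Longrightarrow> continuous_map X euclideanreal (a i)"
    and b: "\<And>i. i < k \<Longrightarrow> continuous_map X euclideanreal (b i)"
  shows "closedin X (eset X k a b)"
proof -
  have "eset X k a b =
      (\<Union>j\<in>{..<k}. {x \<in> topspace X. 1/2 \<le> b j x} \<inter> (\<Inter>i\<in>{..j}. {x \<in> topspace X. a i x \<le> 1/3}))"
    by (auto simp: eset_def)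
  moreover have "closedin X ({x \<in> topspace X. 1/2 \<le> b j x} \<inter> (\<Inter>i\<in>{..j}. {x \<in> topspace X. a i x \<le> 1/3}))"
    if j: "j < k" for j
  proof (intro closedin_Int closedin_Inter)
    show "closedin X {x \<in> topspace X. 1/2 \<le> b j x}" using b[OF j] by (intro closedin_real_le) auto
    fix S assume "S \<in> (\<lambda>i. {x \<in> topspace X. a i x \<le> 1/3}) ` {..j}"
    then obtain i where "i \<le> j" and S: "S = {x \<in> topspace X. a i x \<le> 1/3}" by blast
    then have i: "i < k" using j by simp
    show "closedin X S" unfolding S using a[OF i] by (intro closedin_real_le) auto
  qed auto
  ultimately show ?thesis by (simp only:) (rule closedin_Union, auto)
qed

text \<open>Only the first \<open>k\<close> members of the sequences matter, so that countably many functions and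
  labels give countably many problems.\<close>

definition problems :: "'a topology \<Rightarrow> ('a \<Rightarrow> real) set \<Rightarrow> 'v set \<Rightarrow> ('a set \<times> 'a set \<times> ('a \<Rightarrow> 'v \<Rightarrow> real)) set" where
  "problems X \<U> V = {(aset X k a, eset X k a b, hmap k b l) |k a b l.
     (\<forall>i<k. a i \<in> \<U> \<and> b i \<in> \<U> \<and> l i \<in> V)}"

lemma countable_problems:
  fixes X :: "'a topology" and V :: "'v set"
  assumes "countable \<U>" "countable V"
  shows "countable (problems X \<U> V)"
proof -
  let ?f = "\<lambda>(as, fs, ls). (aset X (length as) (nth as), eset X (length as) (nth as) (nth fs), hmap (length as) (nth fs) (nth ls))"
  have "problems X \<U> V \<subseteq> ?f ` (lists \<U> \<times> lists \<U> \<times> lists V)"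
  proof
    fix c assume "c \<in> problems X \<U> V"
    then obtain k a b l where c: "c = (aset X k a, eset X k a b, hmap k b l)"
      and *: "\<forall>i<k. a i \<in> \<U> \<and> b i \<in> \<U> \<and> l i \<in> V" unfolding problems_def by blast
    let ?as = "map a [0..<k]" and ?fs = "map b [0..<k]" and ?ls = "map l [0..<k]"
    have "aset X k (nth ?as) = aset X k a" by (auto simp: aset_def)
    moreover have "eset X k (nth ?as) (nth ?fs) = eset X k a b"
      unfolding eset_def by (intro Collect_cong) (auto intro!: exI)
    moreover have "hmap k (nth ?fs) (nth ?ls) = hmap k b l"
    proof (intro ext)
      fix x v
      have "pou (nth ?fs) j x = pou b j x" if "j < k" for j
        unfolding pou_def using that by (intro arg_cong2[where f = "(*)"] prod.cong) auto
      then show "hmap k (nth ?fs) (nth ?ls) x v = hmap k b l x v"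
        unfolding hmap_def by (intro sum.cong) auto
    qed
    ultimately have "c = ?f (?as, ?fs, ?ls)" using c by simp
    moreover have "(?as, ?fs, ?ls) \<in> lists \<U> \<times> lists \<U> \<times> lists V" using * by auto
    ultimately show "c \<in> ?f ` (lists \<U> \<times> lists \<U> \<times> lists V)" by blast
  qed
  moreover have "countable (lists \<U> \<times> lists \<U> \<times> lists V)" using assms by (intro countable_SIGMA countable_lists)
  ultimately show ?thesis by (rule countable_subset[OF _ countable_image])
qed

section \<open>Solving an arbitrary problem on the intersection\<close>

lemma closed_simplex_convex:
  assumes "p \<in> closed_simplex s" "q \<in> closed_simplex s" "0 \<le> t" "t \<le> 1"
  shows "(\<lambda>v. (1 - t) * p v + t * q v) \<in> closed_simplex s"
  using assms by (auto simp: closed_simplex_def sum.distrib sum_distrib_left[symmetric])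

text \<open>The given map extends to \<open>H\<close> on a neighbourhood \<open>N\<close> of
  \<open>D\<close>, and \<open>?h k\<close> approximates \<open>H\<close> only up to lying in the
  same closed simplex, which suffices for a straight line homotopy. Stages \<open>f k\<close> are
  picked that agree with \<open>?h k\<close> on the overlap of \<open>?A k\<close> and
  \<open>?E k\<close> and whose values on \<open>?A k\<close> persist, so that they have a limit
  \<open>Gf\<close> off \<open>D\<close>.\<close>

proposition abs_extensor_core:
  fixes K :: "'v set set" and X :: "'a topology" and G :: "nat \<Rightarrow> 'a \<Rightarrow> 'v \<Rightarrow> real"
  assumes K: "simplicial_cplx K" "locally_finite_cplx K"
    and X: "metrizable_space X"
    and \<U>: "countable \<U>" "(\<lambda>_. 0) \<in> \<U>"
    "\<And>u. u \<in> \<U> \<Longrightarrow> continuous_map X euclideanreal u" "\<And>u x. u \<in> \<U> \<Longrightarrow> 0 \<le> u x"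
    "\<And>x W. openin X W \<Longrightarrow> x \<in> W \<Longrightarrow> \<exists>u\<in>\<U>. u x = 1 \<and> (\<forall>y\<in>topspace X. 0 < u y \<longrightarrow> y \<in> W)"
    and V: "countable V" "\<Union>K \<subseteq> V" "V \<noteq> {}"
    and Y: "\<And>m. closedin X (Y m)" "decseq Y" "\<And>m. continuous_map (subtopology X (Y m)) (realization K) (G m)"
    and tower: "\<And>j A E h. (A, E, h) \<in> problems X \<U> V \<Longrightarrow>
       continuous_map (subtopology X (E \<inter> Y j)) (realization K) h \<Longrightarrow>
       (\<And>x. x \<in> A \<inter> E \<inter> Y j \<Longrightarrow> G j x = h x) \<Longrightarrow>
       \<exists>m\<ge>j. (\<forall>x \<in> A \<inter> Y m. G m x = G j x) \<and> (\<forall>x \<in> E \<inter> Y m. G m x = h x)"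
  shows "abs_extensor (realization K) (subtopology X (\<Inter>m. Y m))"
  unfolding abs_extensor_def
proof (intro allI impI, elim conjE)
  fix D h
  let ?L = "realization K"
  define Z where "Z = (\<Inter>m. Y m)"
  assume "closedin (subtopology X (\<Inter>m. Y m)) D"
    and "continuous_map (subtopology (subtopology X (\<Inter>m. Y m)) D) ?L h"
  then have DZ: "closedin (subtopology X Z) D" and h: "continuous_map (subtopology (subtopology X Z) D) ?L h"
    by (simp_all add: Z_def)
  have Z: "closedin X Z" unfolding Z_def using Y(1) by blast
  have ZX: "Z \<subseteq> topspace X" using Z by (rule closedin_subset)
  have DsubZ: "D \<subseteq> Z" using DZ closedin_subset by fastforce
  have D: "closedin X D" using DZ Z closedin_trans_full by blast
  have DX: "D \<subseteq> topspace X" using D by (rule closedin_subset)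
  have normal: "normal_space X" using X by (rule metrizable_imp_normal_space)
  have "continuous_map (subtopology X D) ?L h" using h DsubZ by (simp add: subtopology_subtopology Int_absorb1)
  then obtain N H where N: "openin X N" "D \<subseteq> N" "continuous_map (subtopology X N) ?L H" "\<And>x. x \<in> D \<Longrightarrow> H x = h x"
    using realization_nbhd_extensor[OF K X D] by metis
  have NX: "N \<subseteq> topspace X" using N openin_subset by blast
  have tN: "topspace (subtopology X N) = N" using NX by auto
  have cH: "continuous_map (subtopology X N) euclideanreal (\<lambda>x. H x v)" for v
    using N(3) continuous_map_realization_iff[OF K] by blast
  have H_in: "H x \<in> topspace ?L" if "x \<in> N" for x
    using continuous_map_image_subset_topspace[OF N(3)] that tN by auto
  have suppK: "supp (H x) \<in> K" if "x \<in> N" for x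
    using H_in[OF that] topspace_realization_iff[OF K(1)] by blast
  have fin: "finite (supp (H x))" if "x \<in> N" for x
    using simplicial_cplxD(1)[OF K(1) suppK[OF that]] .
  have H_simplex: "H x \<in> closed_simplex (supp (H x))" if "x \<in> N" for x
    using H_in[OF that] topspace_realization_iff[OF K(1)] by (auto simp: closed_simplex_def)
  have in_L: "p \<in> topspace ?L" if "x \<in> N" "p \<in> closed_simplex (supp (H x))" for x p
    using suppK[OF that(1)] that(2) by (auto simp: topspace_realization)
  \<comment> \<open>\<open>SN\<close> collects the functions that vanish on \<open>D\<close>;
    \<open>SD\<close> those positive only where \<open>H\<close> has a positive coordinate
    \<open>v\<close>, paired with that \<open>v\<close>. The sets where an enumerated function is 1
    cover the complement of \<open>D\<close> and \<open>D\<close>, respectively.\<close>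
  define SN where "SN = {u \<in> \<U>. \<forall>x\<in>D. u x = 0}"
  define SD where "SD = {(u, v). u \<in> \<U> \<and> v \<in> V \<and> (\<forall>x\<in>topspace X. 0 < u x \<longrightarrow> x \<in> N \<and> 0 < H x v)}"
  define a where "a = from_nat_into SN"
  define b where "b i = fst (from_nat_into SD i)" for i
  define l where "l i = snd (from_nat_into SD i)" for i
  have SN: "SN \<noteq> {}" "countable SN" using \<U> by (auto simp: SN_def)
  have "SD \<subseteq> \<U> \<times> V" by (auto simp: SD_def)
  then have "countable SD" using \<U>(1) V(1) by (intro countable_subset[OF _ countable_SIGMA])
  have "SD \<noteq> {}" using \<U>(2) V(3) by (auto simp: SD_def)
  have a: "a i \<in> \<U>" "x \<in> D \<Longrightarrow> a i x = 0" for i x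
    using from_nat_into[OF SN(1), of i] by (auto simp: a_def SN_def)
  have b: "b i \<in> \<U>" "l i \<in> V" "x \<in> topspace X \<Longrightarrow> 0 < b i x \<Longrightarrow> x \<in> N \<and> 0 < H x (l i)" for i x
    using from_nat_into[OF \<open>SD \<noteq> {}\<close>, of i] by (auto simp: b_def l_def SD_def split: prod.splits)
  have ca: "continuous_map X euclideanreal (a i)" and cb: "continuous_map X euclideanreal (b i)" for i
    using a b \<U>(3) by blast+
  have b0: "0 \<le> b i x" for i x using b \<U>(4) by blast
  have cover_a: "\<exists>i. a i x = 1" if "x \<in> topspace X - D" for x
  proof -
    have "openin X (topspace X - D)" using D by blast
    then obtain u where u: "u \<in> \<U>" "u x = 1" "\<forall>y\<in>topspace X. 0 < u y \<longrightarrow> y \<in> topspace X - D"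
      using \<U>(5)[of "topspace X - D" x] \<open>x \<in> topspace X - D\<close> by metis
    then have "u \<in> SN" using \<U>(4)[OF u(1)] DX by (force simp: SN_def order_le_less)
    then show ?thesis using u(2) from_nat_into_surj[OF SN(2)] unfolding a_def by metis
  qed
  have cover_b: "\<exists>i. b i x = 1" if "x \<in> D" for x
  proof -
    have "x \<in> N" using N(2) that by blast
    then obtain v where v: "0 < H x v" using realization_pos_vertex[OF K(1) H_in] by blast
    then have "v \<in> supp (H x)" by simp
    then have "v \<in> V" using suppK[OF \<open>x \<in> N\<close>] V(2) by blast
    have "openin (subtopology X N) {y \<in> topspace (subtopology X N). 0 < H y v}"
      by (intro openin_real_less cH) auto
    then have "openin X {y \<in> N. 0 < H y v}" using N(1) openin_trans_full tN by metis
    then obtain u where u: "u \<in> \<U>" "u x = 1" "\<forall>y\<in>topspace X. 0 < u y \<longrightarrow> y \<in> {y \<in> N. 0 < H y v}"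
      using \<U>(5)[OF \<open>openin X {y \<in> N. 0 < H y v}\<close>, of x] v \<open>x \<in> N\<close> by auto
    then have "(u, v) \<in> SD" using \<open>v \<in> V\<close> by (simp add: SD_def)
    then show ?thesis using u(2) from_nat_into_surj[OF \<open>countable SD\<close>] unfolding b_def by (metis fst_conv)
  qed
  let ?A = "\<lambda>k. aset X k a" and ?E = "\<lambda>k. eset X k a b" and ?h = "\<lambda>k. hmap k b l"
  have A_mono: "?A k \<subseteq> ?A m" and E_mono: "?E k \<subseteq> ?E m" if "k \<le> m" for k m
    using that by (auto simp: aset_def eset_def intro: less_le_trans)
  have E_N: "x \<in> N" if "x \<in> ?E k" for x k
  proof -
    obtain j where "x \<in> topspace X" "1/2 \<le> b j x" using \<open>x \<in> ?E k\<close> by (auto simp: eset_def)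
    then show ?thesis using b(3)[of x j] by simp
  qed
  have h_simplex: "?h k x \<in> closed_simplex (supp (H x))" if "x \<in> ?E k" for k x
  proof (rule hmap_in_simplex[OF that b0 fin[OF E_N[OF that]]])
    fix j assume "0 < b j x"
    moreover have "x \<in> topspace X" using that by (simp add: eset_def)
    ultimately show "l j \<in> supp (H x)" using b(3)[of x j] by auto
  qed
  have prob: "(?A k, ?E k, ?h k) \<in> problems X \<U> V" for k
    unfolding problems_def using a b by blast
  have ch: "continuous_map X euclideanreal (\<lambda>x. ?h k x v)" for k v using cb by (rule continuous_map_hmap)
  have chE: "continuous_map (subtopology X S) ?L (?h k)" if "S \<subseteq> ?E k" for S k
    unfolding continuous_map_realization_iff[OF K]
  proof (intro conjI allI image_subsetI)
    show "continuous_map (subtopology X S) euclideanreal (\<lambda>x. ?h k x v)" for v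
      using ch by (rule continuous_map_from_subtopology)
    fix x assume "x \<in> topspace (subtopology X S)"
    then have x: "x \<in> ?E k" using that by auto
    show "?h k x \<in> topspace ?L" by (rule in_L[OF E_N[OF x] h_simplex[OF x]])
  qed
  define P where "P k m \<longleftrightarrow> (\<forall>x \<in> ?A k \<inter> ?E k \<inter> Y m. G m x = ?h k x)" for k m
  define Q where "Q k m m' \<longleftrightarrow> m \<le> m' \<and> (\<forall>x \<in> ?A k \<inter> Y m'. G m' x = G m x)" for k m m' :: nat
  have "\<exists>f. \<forall>k. P k (f k) \<and> Q k (f k) (f (Suc k))"
  proof (rule dependent_nat_choice)
    show "\<exists>m. P 0 m" by (auto simp: P_def aset_def)
  next
    fix m k assume P: "P k m"
    have "continuous_map (subtopology X (?E k \<inter> Y m)) ?L (?h k)" by (rule chE) auto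
    from tower[OF prob this] P obtain m' where m': "m \<le> m'" "\<forall>x \<in> ?A k \<inter> Y m'. G m' x = G m x"
      "\<forall>x \<in> ?E k \<inter> Y m'. G m' x = ?h k x" unfolding P_def by blast
    have "G m' x = ?h (Suc k) x" if x: "x \<in> ?A (Suc k) \<inter> ?E (Suc k) \<inter> Y m'" for x
    proof -
      obtain i j where ij: "i < Suc k" "2/3 \<le> a i x" "j < Suc k" "1/2 \<le> b j x" "\<forall>i\<le>j. a i x \<le> 1/3"
        using x by (auto simp: aset_def eset_def)
      \<comment> \<open>So \<open>j < i \<le> k\<close>: the enlarged overlap consists of points of
        \<open>?E k\<close>, where stage \<open>m'\<close> solves the problem.\<close>
      have "\<not> i \<le> j" using ij by force
      then have "x \<in> ?E k" using ij x by (auto simp: eset_def intro!: exI[of _ j])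
      then show ?thesis using m'(3) x hmap_mono[of x X k a b "Suc k" l] by auto
    qed
    then show "\<exists>m'. P (Suc k) m' \<and> Q k m m'" using m' by (auto simp: P_def Q_def)
  qed
  then obtain f where f: "\<And>k. P k (f k)" "\<And>k. Q k (f k) (f (Suc k))" by blast
  have G_stable: "G (f m) x = G (f k) x" if "k \<le> m" "x \<in> ?A k" "x \<in> Z" for k m x
    using that(1)
  proof (induction m rule: dec_induct)
    case (step m)
    have "x \<in> ?A m" using A_mono[OF step(1)] that by auto
    moreover have "x \<in> Y (f (Suc m))" using that by (auto simp: Z_def)
    ultimately show ?case using f(2)[of m] step by (auto simp: Q_def)
  qed simp
  define Gf where "Gf x = G (f (LEAST k. x \<in> ?A k)) x" for x
  define hf where "hf x = ?h (LEAST k. x \<in> ?E k) x" for x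
  have Gf: "Gf x = G (f k) x" if "x \<in> ?A k" "x \<in> Z" for k x
    unfolding Gf_def using G_stable[OF Least_le[of "\<lambda>k. x \<in> ?A k" k] LeastI[of "\<lambda>k. x \<in> ?A k" k]] that by simp
  have hf: "hf x = ?h k x" if "x \<in> ?E k" for k x
    unfolding hf_def
    using hmap_mono[where l = l, OF LeastI[of "\<lambda>k. x \<in> ?E k" k] Least_le[of "\<lambda>k. x \<in> ?E k" k]] that
    by simp
  have Gf_hf: "Gf x = hf x" if "x \<in> ?A k" "x \<in> ?E m" "x \<in> Z" for x k m
  proof -
    let ?k = "max k m"
    have "x \<in> ?A ?k" "x \<in> ?E ?k" using A_mono[of k ?k] E_mono[of m ?k] that by auto
    moreover have "x \<in> Y (f ?k)" using that by (auto simp: Z_def)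
    ultimately show ?thesis using f(1)[of ?k] Gf[of x ?k] hf[of x ?k] that by (auto simp: P_def)
  qed
  \<comment> \<open>Open cores of the sets \<open>?E (Suc j)\<close>. They cover \<open>D\<close>,
    since all \<open>a i\<close> vanish there and some \<open>b j\<close> is 1.\<close>
  define O' where "O' j = {x \<in> topspace X. 1/2 < b j x} \<inter> (\<Inter>i\<in>{..j}. {x \<in> topspace X. a i x < 1/3})" for j
  have oO': "openin X (O' j)" for j
    unfolding O'_def
  proof (intro openin_Int openin_Inter)
    show "openin X {x \<in> topspace X. 1/2 < b j x}" by (intro openin_real_less cb) auto
    fix S assume "S \<in> (\<lambda>i. {x \<in> topspace X. a i x < 1/3}) ` {..j}"
    then obtain i where S: "S = {x \<in> topspace X. a i x < 1/3}" by blast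
    show "openin X S" unfolding S by (intro openin_real_less ca) auto
  qed auto
  have O'E: "O' j \<subseteq> ?E (Suc j)" for j by (force simp: O'_def eset_def)
  have "D \<subseteq> (\<Union>j. O' j)"
  proof
    fix x assume x: "x \<in> D"
    then obtain j where "b j x = 1" using cover_b by blast
    then have "x \<in> O' j" using x DX a(2) by (auto simp: O'_def)
    then show "x \<in> (\<Union>j. O' j)" by blast
  qed
  moreover have "openin X (\<Union>j. O' j)" using oO' by blast
  ultimately obtain T where T: "openin X T" "D \<subseteq> T" "X closure_of T \<subseteq> (\<Union>j. O' j)"
    using normal_space_alt[THEN iffD1, OF normal, rule_format, of D "\<Union>j. O' j"] D by metis
  have TX: "T \<subseteq> X closure_of T" using T(1) closure_of_subset openin_subset by metis
  have "closedin X (topspace X - T)" "disjnt D (topspace X - T)" using T by (auto simp: disjnt_iff)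
  then obtain \<tau> where \<tau>': "continuous_map X (top_of_set {0..1::real}) \<tau>" "\<tau> ` D \<subseteq> {0}" "\<tau> ` (topspace X - T) \<subseteq> {1}"
    using Urysohn_lemma[OF normal D, of "topspace X - T" 0 1] by auto
  then have \<tau>: "continuous_map X euclideanreal \<tau>" "\<And>x. x \<in> topspace X \<Longrightarrow> 0 \<le> \<tau> x \<and> \<tau> x \<le> 1"
    "\<And>x. x \<in> D \<Longrightarrow> \<tau> x = 0" "\<And>x. x \<in> topspace X - T \<Longrightarrow> \<tau> x = 1"
    by (auto simp: continuous_map_in_subtopology)
  \<comment> \<open>Along \<open>\<tau>\<close> the map moves from \<open>H\<close> on
    \<open>D\<close> to \<open>hf\<close> off \<open>T\<close>. Both branches match on
    \<open>O' j \<inter> Z\<close> outside the closure of \<open>T\<close>, where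
    \<open>\<tau>\<close> is 1 and \<open>Gf\<close> equals \<open>hf\<close>.\<close>
  define \<Phi> where "\<Phi> x = (if x \<in> X closure_of T then (\<lambda>v. (1 - \<tau> x) * H x v + \<tau> x * hf x v) else Gf x)" for x
  have in_A: "\<exists>k. x \<in> ?A k" if "x \<in> topspace X - D" for x
  proof -
    obtain i where "a i x = 1" using cover_a \<open>x \<in> topspace X - D\<close> by blast
    then have "x \<in> ?A (Suc i)" using that by (auto simp: aset_def intro!: exI[of _ i])
    then show ?thesis by blast
  qed
  have "continuous_map (subtopology X Z) ?L \<Phi>"
  proof (rule continuous_map_local)
    fix x assume "x \<in> topspace (subtopology X Z)"
    then have x: "x \<in> topspace X" "x \<in> Z" by auto
    show "\<exists>W. openin (subtopology X Z) W \<and> x \<in> W \<and> continuous_map (subtopology (subtopology X Z) W) ?L \<Phi>"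
    proof (cases "\<exists>j. x \<in> O' j")
      case True
      then obtain j where j: "x \<in> O' j" by blast
      let ?W = "O' j \<inter> Z"
      have eq: "\<Phi> y = (\<lambda>v. (1 - \<tau> y) * H y v + \<tau> y * ?h (Suc j) y v)" if y: "y \<in> ?W" for y
      proof (cases "y \<in> X closure_of T")
        case True
        have "y \<in> ?E (Suc j)" using O'E y by blast
        then show ?thesis using True hf[of y "Suc j"] by (simp add: \<Phi>_def)
      next
        case False
        have yE: "y \<in> ?E (Suc j)" using O'E y by auto
        then have yX: "y \<in> topspace X" by (simp add: eset_def)
        have "y \<notin> T" "y \<notin> D" using TX T(2) False by auto
        then obtain k where "y \<in> ?A k" using in_A yX by blast
        then have "Gf y = ?h (Suc j) y" using Gf_hf[of y k "Suc j"] hf[OF yE] yE y by simp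
        then show ?thesis using \<tau>(4)[of y] False yX \<open>y \<notin> T\<close> by (simp add: \<Phi>_def)
      qed
      have WN: "?W \<subseteq> N" using O'E E_N by blast
      have "continuous_map (subtopology X ?W) ?L (\<lambda>y v. (1 - \<tau> y) * H y v + \<tau> y * ?h (Suc j) y v)"
        unfolding continuous_map_realization_iff[OF K]
      proof (intro conjI allI)
        fix v
        have c: "continuous_map (subtopology X ?W) euclideanreal (\<lambda>y. H y v)"
          "continuous_map (subtopology X ?W) euclideanreal \<tau>"
          "continuous_map (subtopology X ?W) euclideanreal (\<lambda>y. ?h (Suc j) y v)"
          using continuous_map_from_subtopology_mono[OF cH WN] \<tau>(1) ch by (auto intro: continuous_map_from_subtopology)
        show "continuous_map (subtopology X ?W) euclideanreal (\<lambda>y. (1 - \<tau> y) * H y v + \<tau> y * ?h (Suc j) y v)"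
          by (intro continuous_intros c)
      next
        show "(\<lambda>y v. (1 - \<tau> y) * H y v + \<tau> y * ?h (Suc j) y v) ` topspace (subtopology X ?W) \<subseteq> topspace ?L"
        proof clarify
          fix y assume "y \<in> topspace (subtopology X ?W)"
          then have y: "y \<in> ?E (Suc j)" "y \<in> topspace X" using O'E by auto
          show "(\<lambda>v. (1 - \<tau> y) * H y v + \<tau> y * ?h (Suc j) y v) \<in> topspace ?L"
            using \<tau>(2)[OF y(2)] E_N[OF y(1)]
            by (intro in_L[OF E_N[OF y(1)]] closed_simplex_convex H_simplex h_simplex[OF y(1)]) auto
        qed
      qed
      then have "continuous_map (subtopology X ?W) ?L \<Phi>"
        by (rule continuous_map_eq) (use eq in auto)
      moreover have "Z \<inter> ?W = ?W" by auto
      moreover have "openin (subtopology X Z) ?W" using oO' openin_subtopology by blast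
      ultimately show ?thesis using j x by (intro exI[of _ ?W]) (simp add: subtopology_subtopology)
    next
      case False
      then have xT: "x \<notin> X closure_of T" using T(3) by auto
      then have "x \<notin> D" using TX T(2) by auto
      then obtain i where i: "a i x = 1" using cover_a x by blast
      \<comment> \<open>All points of \<open>?W'\<close> lie in \<open>?A (Suc i)\<close>, so on
        \<open>Z\<close> the map \<open>Gf\<close> coincides near \<open>x\<close> with the single
        stage \<open>f (Suc i)\<close>.\<close>
      let ?W' = "{y \<in> topspace X. 2/3 < a i y} \<inter> (topspace X - X closure_of T)"
      let ?W = "?W' \<inter> Z"
      have "openin X ?W'" by (intro openin_Int openin_real_less ca openin_diff) auto
      then have oW: "openin (subtopology X Z) ?W" using openin_subtopology by blast
      have "?W \<subseteq> Y (f (Suc i))" by (auto simp: Z_def)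
      from continuous_map_from_subtopology_mono[OF Y(3) this]
      have "continuous_map (subtopology X ?W) ?L \<Phi>"
      proof (rule continuous_map_eq)
        fix y assume "y \<in> topspace (subtopology X ?W)"
        then have "y \<in> ?A (Suc i)" "y \<in> Z" "y \<notin> X closure_of T" by (auto simp: aset_def intro!: exI[of _ i])
        then show "G (f (Suc i)) y = \<Phi> y" using Gf by (simp add: \<Phi>_def)
      qed
      moreover have "Z \<inter> ?W = ?W" by auto
      ultimately show ?thesis using oW x xT i by (intro exI[of _ ?W]) (simp add: subtopology_subtopology)
    qed
  qed
  moreover have "\<Phi> x = h x" if "x \<in> D" for x
  proof -
    have "x \<in> X closure_of T" using that T(2) TX by auto
    then show ?thesis using \<tau>(3)[OF that] N(4)[OF that] by (simp add: \<Phi>_def)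
  qed
  ultimately show "\<exists>g. continuous_map (subtopology X (\<Inter>m. Y m)) ?L g \<and> (\<forall>x\<in>D. g x = h x)"
    unfolding Z_def by blast
qed

proposition partitions_of_ext_dim_le:
  fixes K :: "'v set set" and X :: "'a topology"
  assumes K: "simplicial_cplx K" "locally_finite_cplx K" "countable K"
    and X: "metrizable_space X" "separable_space X" and n: "1 \<le> n"
    and dim: "ext_dim_le (realization K) X n"
    and AB: "\<forall>i\<in>{1..n}. closedin X (A i) \<and> closedin X (B i) \<and> disjnt (A i) (B i)"
  shows "\<exists>C :: nat \<Rightarrow> 'a set. (\<forall>i\<in>{1..n}. partition_between X (C i) (A i) (B i)) \<and>
          abs_extensor (realization K) (subtopology X (\<Inter>i\<in>{1..n}. C i))"
proof -
  obtain \<phi> where \<phi>: "exhausting (realization K) \<phi>" using exhausting_realization[OF K] by blast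
  obtain \<U> :: "('a \<Rightarrow> real) set" where \<U>: "countable \<U>" "(\<lambda>_. 0) \<in> \<U>"
    "\<And>u. u \<in> \<U> \<Longrightarrow> continuous_map X euclideanreal u" "\<And>u x. u \<in> \<U> \<Longrightarrow> 0 \<le> u x"
    "\<And>x W. openin X W \<Longrightarrow> x \<in> W \<Longrightarrow> \<exists>u\<in>\<U>. u x = 1 \<and> (\<forall>y\<in>topspace X. 0 < u y \<longrightarrow> y \<in> W)"
    using countable_separating_family[OF X] by blast
  \<comment> \<open>The additional label keeps \<open>V\<close> nonempty even if \<open>K\<close>
    has no simplices.\<close>
  define V where "V = insert undefined (\<Union>K)"
  have V: "countable V" "\<Union>K \<subseteq> V" "V \<noteq> {}"
    using K(3) simplicial_cplxD(1)[OF K(1)] countable_UN[of K "\<lambda>s. s"]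
    by (auto simp: V_def intro: countable_finite)
  have ne: "problems X \<U> V \<noteq> {}" unfolding problems_def by blast
  have cl: "\<forall>(A, E, h) \<in> problems X \<U> V. closedin X A \<and> closedin X E"
    using \<U>(3) unfolding problems_def by (auto intro!: closedin_aset closedin_eset)
  show ?thesis
  proof (rule partition_tower[OF \<phi> metrizable_imp_normal_space[OF X(1)] dim[unfolded ext_dim_le_def] n
        countable_problems[OF \<U>(1) V(1)] ne cl AB])
    fix C Y G
    assume part: "\<And>i. i \<in> {1..n} \<Longrightarrow> partition_between X (C i) (A i) (B i)"
    and C: "(\<Inter>i\<in>{1..n}. C i) = (\<Inter>m. Y m)"
    and Y: "\<And>m. closedin X (Y m)" "decseq Y" "\<And>m. continuous_map (subtopology X (Y m)) (realization K) (G m)"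
    and tower: "\<And>j A E h. (A, E, h) \<in> problems X \<U> V \<Longrightarrow>
       continuous_map (subtopology X (E \<inter> Y j)) (realization K) h \<Longrightarrow>
       (\<And>x. x \<in> A \<inter> E \<inter> Y j \<Longrightarrow> G j x = h x) \<Longrightarrow>
       \<exists>m\<ge>j. (\<forall>x \<in> A \<inter> Y m. G m x = G j x) \<and> (\<forall>x \<in> E \<inter> Y m. G m x = h x)"
    have "abs_extensor (realization K) (subtopology X (\<Inter>m. Y m))"
      by (rule abs_extensor_core[where \<U> = \<U> and V = V and G = G]) (fact K X \<U> V Y tower)+
    then have "abs_extensor (realization K) (subtopology X (\<Inter>i\<in>{1..n}. C i))"
      unfolding C .
    then show ?thesis using part by (intro exI[of _ C]) auto
  qed
qed

theorem theorem4p1: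
  fixes K :: "'v set set" and X :: "'a topology" and n :: nat
  assumes "simplicial_cplx K" and "locally_finite_cplx K" and "countable K"
    and "metrizable_space X" and "separable_space X"
    and "n \<ge> 1"
  shows "ext_dim_le (realization K) X n \<longleftrightarrow>
    (\<forall>A B :: nat \<Rightarrow> 'a set.
       (\<forall>i\<in>{1..n}. closedin X (A i) \<and> closedin X (B i) \<and> disjnt (A i) (B i)) \<longrightarrow>
       (\<exists>C :: nat \<Rightarrow> 'a set.
          (\<forall>i\<in>{1..n}. partition_between X (C i) (A i) (B i)) \<and>
          abs_extensor (realization K) (subtopology X (\<Inter>i\<in>{1..n}. C i))))"
  (is "?dim \<longleftrightarrow> ?part")
proof
  assume ?dim
  then show ?part using partitions_of_ext_dim_le[OF assms] by simp
next
  assume ?part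
  then show ?dim by (intro ext_dim_le_of_partitions assms(1-4,6)) blast
qed

end
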